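(* There exists a polynomial-time algorithm $\mathcal{A}_{\text{Ulam}}$ such that on an input of $k \in \mathbb{N}$, it returns the first $k$ coefficients of $U(1,X)$---that is, $\{a_i\}_{i=0}^k$, $\{b_i\}_{i=0}^k$, $\{c_i\}_{i=0}^k$, $\{d_i\}_{i=0}^k$---and an integer $N$ such that for all integers $n \geq N$, \[ U(1,n) \cap [1, c_k n + d_k] = \bigcup_{i=0}^\infty [a_i n + b_i, c_i n + d_i] \cap [1, c_k n + d_k], \] where on both sides the intervals are intervals of integers.
   Context: Integer Ulam sequences: for an integer $n \geq 2$, $U(1,n)$ is the sequence of integers starting with $1, n$ in which every subsequent term is the smallest integer, larger than all previous terms, that can be written as the sum of two distinct previous terms in exactly one way. Order on $\mathbb{Z}[X]$: $\mathbb{Z}[X]$ is an ordered ring with the lexicographic order: $p(X) > q(X)$ iff the leading coefficient of $p(X) - q(X)$ is positive. For $x \le y$ in $\mathbb{Z}[X]$, $[x,y] = \{z \in \mathbb{Z}[X] : x \le z \le y\}$. Let $G_d$ be the additive subgroup of $\mathbb{Z}[X]$ generated by $1, X, \dots, X^d$ (polynomials of degree at most $d$). Given $0 < a < b$ in $\mathbb{Z}[X]$, an Ulam sequence starting with $a,b$ is a set $U \subset G_{\deg b}$ such that (1) $U \cap (-\infty, b] = \{a,b\}$; (2) for all $p < q$ in $G_{\deg b}$, $U \cap [p,q]$ has both a minimum and a maximum; (3) for every $p \in (b,\infty)$, $p \in U$ iff $p$ is the smallest element of the set of $q \in G_{\deg b}$ with $q$ larger than every element of $U \cap (-\infty,p)$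 and such that there is exactly one pair $x \ne y$ in $U$ with $q = x + y$. $U(1,X)$ denotes the unique Ulam sequence in $\mathbb{Z}[X]$ starting with $1, X$. It can be written as $U(1,X) = \bigcup_{i=0}^\infty [a_iX + b_i, c_iX + d_i]$ with integers $a_i,b_i,c_i,d_i$, where the intervals are listed in increasing order (every element of the $i$-th interval is less than every element of the $i'$-th interval for $i<i'$) and $c_iX + d_i + 1 < a_{i+1}X + b_{i+1}$ for all $i$; the integer sequences $a_i, b_i, c_i, d_i$ (uniquely determined) are called the coefficients of $U(1,X)$. (Here $[a_0X+b_0,c_0X+d_0] = \{1\}$.) *)

theory Defs
  imports Complex_Main "HOL-Computational_Algebra.Polynomial" "HOL-Library.Log_Nat"
begin

section \<open>Ulam sequences of integers\<close>

text \<open>Ordering the two summands counts each unordered pair of distinct elements once.\<close>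

definition unique_sum :: "'a::{linorder,plus} set \<Rightarrow> 'a \<Rightarrow> bool" where
  "unique_sum S q \<longleftrightarrow> (\<exists>!(x, y). x \<in> S \<and> y \<in> S \<and> x < y \<and> q = x + y)"

text \<open>
  The term of index \<open>m\<close> (counting from 0) of \<open>U(1,n)\<close>, meaningful for \<open>n \<ge> 2\<close>.
  The sum of the two largest terms so far is always a candidate and the candidates are bounded
  below, so the least one exists.
\<close>

function ulam :: "int \<Rightarrow> nat \<Rightarrow> int" where
  "ulam n m =
     (if m = 0 then 1
      else if m = 1 then n
      else (LEAST q. (\<forall>x \<in> ulam n ` {..<m}. x < q) \<and> unique_sum (ulam n ` {..<m}) q))"
  by auto
termination
  by (relation "measure snd") auto

declare ulam.simps [simp del]

definition ulam_set :: "int \<Rightarrow> int set" where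
  "ulam_set n = range (ulam n)"


section \<open>Ulam sequences in the ordered ring of integer polynomials\<close>

text \<open>
  The library order on \<^typ>\<open>int poly\<close> is the required one: \<open>q < p\<close> iff the leading coefficient of
  \<open>p - q\<close> is positive.
\<close>

definition deg_le :: "nat \<Rightarrow> int poly set" where
  "deg_le d = {p. degree p \<le> d}"

definition is_minimum :: "'a::order set \<Rightarrow> 'a \<Rightarrow> bool" where
  "is_minimum S x \<longleftrightarrow> x \<in> S \<and> (\<forall>y\<in>S. x \<le> y)"

definition is_maximum :: "'a::order set \<Rightarrow> 'a \<Rightarrow> bool" where
  "is_maximum S x \<longleftrightarrow> x \<in> S \<and> (\<forall>y\<in>S. y \<le> x)"

text \<open>
  The minimum and maximum of \<open>U \<inter> {p..q}\<close> can only be asked for when this set is nonempty;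
  for instance it is empty for \<open>a = 1\<close>, \<open>b = X\<close>, \<open>p = 2\<close>, \<open>q = 3\<close>.
\<close>

definition poly_ulam_sequence :: "int poly \<Rightarrow> int poly \<Rightarrow> int poly set \<Rightarrow> bool" where
  "poly_ulam_sequence a b U \<longleftrightarrow>
     0 < a \<and> a < b \<and> U \<subseteq> deg_le (degree b) \<and>
     U \<inter> {..b} = {a, b} \<and>
     (\<forall>p \<in> deg_le (degree b). \<forall>q \<in> deg_le (degree b). p < q \<longrightarrow> U \<inter> {p..q} \<noteq> {} \<longrightarrow>
        (\<exists>x. is_minimum (U \<inter> {p..q}) x) \<and> (\<exists>x. is_maximum (U \<inter> {p..q}) x)) \<and>
     (\<forall>p \<in> {b<..}. p \<in> U \<longleftrightarrow>
        is_minimum {q \<in> deg_le (degree b). (\<forall>x \<in> U \<inter> {..<p}. x < q) \<and> unique_sum U q} p)"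

text \<open>\<open>lin a b\<close> is the polynomial \<open>a X + b\<close>.\<close>

definition lin :: "int \<Rightarrow> int \<Rightarrow> int poly" where
  "lin a b = [:b, a:]"

text \<open>
  Every interval is nonempty and the gap condition is strict, so the intervals are listed in
  increasing order and are the maximal intervals of \<open>U\<close>.
\<close>

definition ulam_coefficients ::
  "int poly set \<Rightarrow> (nat \<Rightarrow> int) \<Rightarrow> (nat \<Rightarrow> int) \<Rightarrow> (nat \<Rightarrow> int) \<Rightarrow> (nat \<Rightarrow> int) \<Rightarrow> bool" where
  "ulam_coefficients U a b c d \<longleftrightarrow>
     U = (\<Union>i. {lin (a i) (b i)..lin (c i) (d i)}) \<and>
     (\<forall>i. lin (a i) (b i) \<le> lin (c i) (d i)) \<and>
     (\<forall>i. lin (c i) (d i) + 1 < lin (a (Suc i)) (b (Suc i)))"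


section \<open>Polynomial-time algorithms\<close>

text \<open>
  The model of computation is the random access machine of Cook and Reckhow with logarithmic
  cost, which is polynomially equivalent to the multitape Turing machine. Registers are indexed
  by natural numbers and hold arbitrary integers. An indirect access through a negative address
  is a fault: the machine is stuck and does not halt.
\<close>

datatype instr =
    Const nat int        \<comment> \<open>\<open>Const i z\<close>: \<open>R i := z\<close>\<close>
  | Add nat nat nat      \<comment> \<open>\<open>Add i j k\<close>: \<open>R i := R j + R k\<close>\<close>
  | Sub nat nat nat      \<comment> \<open>\<open>Sub i j k\<close>: \<open>R i := R j - R k\<close>\<close>
  | Load nat nat         \<comment> \<open>\<open>Load i j\<close>: \<open>R i := R (R j)\<close>\<close>
  | Store nat nat        \<comment> \<open>\<open>Store i j\<close>: \<open>R (R i) := R j\<close>\<close>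
  | JumpPos nat nat      \<comment> \<open>\<open>JumpPos j l\<close>: continue at position \<open>l\<close> if \<open>R j > 0\<close>\<close>
  | Print nat            \<comment> \<open>\<open>Print j\<close>: append \<open>R j\<close> to the output\<close>

type_synonym ram_program = "instr list"

text \<open>Program counter, registers, output so far.\<close>

type_synonym config = "nat \<times> (nat \<Rightarrow> int) \<times> int list"

fun exec_instr :: "instr \<Rightarrow> config \<Rightarrow> config option" where
  "exec_instr (Const i z) (l, R, ys) = Some (Suc l, R(i := z), ys)"
| "exec_instr (Add i j k) (l, R, ys) = Some (Suc l, R(i := R j + R k), ys)"
| "exec_instr (Sub i j k) (l, R, ys) = Some (Suc l, R(i := R j - R k), ys)"
| "exec_instr (Load i j) (l, R, ys) =
     (if R j < 0 then None else Some (Suc l, R(i := R (nat (R j))), ys))"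
| "exec_instr (Store i j) (l, R, ys) =
     (if R i < 0 then None else Some (Suc l, R(nat (R i) := R j), ys))"
| "exec_instr (JumpPos j l') (l, R, ys) = Some (if R j > 0 then l' else Suc l, R, ys)"
| "exec_instr (Print j) (l, R, ys) = Some (Suc l, R, ys @ [R j])"

text \<open>Number of binary digits of the absolute value, plus one for the sign.\<close>

definition int_size :: "int \<Rightarrow> nat" where
  "int_size z = floorlog 2 (nat \<bar>z\<bar>) + 1"

text \<open>An instruction is charged for the sizes of the integers it handles, addresses included.\<close>

fun instr_cost :: "instr \<Rightarrow> (nat \<Rightarrow> int) \<Rightarrow> nat" where
  "instr_cost (Const i z) R = int_size z"
| "instr_cost (Add i j k) R = int_size (R j) + int_size (R k)"
| "instr_cost (Sub i j k) R = int_size (R j) + int_size (R k)"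
| "instr_cost (Load i j) R = int_size (R j) + int_size (R (nat (R j)))"
| "instr_cost (Store i j) R = int_size (R i) + int_size (R j)"
| "instr_cost (JumpPos j l) R = int_size (R j)"
| "instr_cost (Print j) R = int_size (R j)"

text \<open>\<open>ram_run P s t s'\<close>: program \<open>P\<close> gets from \<open>s\<close> to \<open>s'\<close> in finitely many steps of total cost \<open>t\<close>.\<close>

inductive ram_run :: "ram_program \<Rightarrow> config \<Rightarrow> nat \<Rightarrow> config \<Rightarrow> bool" for P where
  refl: "ram_run P s 0 s"
| step: "l < length P \<Longrightarrow> exec_instr (P ! l) (l, R, ys) = Some s' \<Longrightarrow> ram_run P s' t s'' \<Longrightarrow>
         ram_run P (l, R, ys) (instr_cost (P ! l) R + t) s''"

text \<open>
  On input \<open>k\<close> the machine starts at position 0 with \<open>k\<close> in register 0 and all other registers 0.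
  It halts when control leaves the program.
\<close>

definition ram_computes :: "ram_program \<Rightarrow> nat \<Rightarrow> nat \<Rightarrow> int list \<Rightarrow> bool" where
  "ram_computes P k t ys \<longleftrightarrow>
     (\<exists>l R. ram_run P (0, (\<lambda>_. 0)(0 := int k), []) t (l, R, ys) \<and> length P \<le> l)"

definition ram_output :: "ram_program \<Rightarrow> nat \<Rightarrow> int list \<Rightarrow> bool" where
  "ram_output P k ys \<longleftrightarrow> (\<exists>t. ram_computes P k t ys)"

text \<open>
  The running time is measured in \<open>k\<close> itself (unary input size) and not in the number of digits
  of \<open>k\<close>: an output of about \<open>k\<close> integers cannot be written in time polynomial in \<open>log k\<close>.
\<close>

definition polynomial_time :: "ram_program \<Rightarrow> bool" where
  "polynomial_time P \<longleftrightarrow>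
     (\<exists>p :: nat poly. \<forall>k. \<exists>t ys. ram_computes P k t ys \<and> t \<le> poly p k)"

end

theory Submission
  imports Defs
begin

text \<open>
  Apart from \<open>{1}\<close> and \<open>[X, 2X]\<close>, each interval of \<open>U(1,X)\<close> is determined by the earlier ones.
  It starts at the least linear polynomial, at least 2 above the preceding interval, that has
  exactly one representation as a sum of two distinct elements of the earlier intervals, and it
  ends just before the first larger polynomial that has a representation without the summand 1.
  Both are found among finitely many candidates, because the number of representations, capped
  at 2 for each pair of intervals, only changes close to sums of two endpoints.

  The rule refers only to comparisons of linear polynomials with coefficients exponentially bounded
  in \<open>k\<close>, and these survive the substitution of any integer \<open>n \<ge> 4 ^ (k + 8)\<close> for \<open>X\<close>. So
  the same rule describes an initial segment of \<open>U(1,n)\<close>, and the machine can work with the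
  integers obtained for \<open>n = 4 ^ (k + 8)\<close>, carrying the coefficients along. It executes
  polynomially many instructions, each of which at most doubles the largest register.
\<close>

section \<open>Structured programs for the random access machine\<close>

text \<open>Why the summand 1 can be left out: \<open>1 + (q - 1)\<close> represents
  \<open>q\<close> only if \<open>q - 1\<close> is a term. In a gap, past its first element, this
  never happens, so only the other representations count there. Inside an interval, past its least
  element s, it always happens, so the interval lasts exactly until a second representation appears.
  Except for \<open>[X, 2X]\<close>, this happens at \<open>s + X\<close> at the latest, a sum of
  two distinct terms; hence, up to the end of the interval, two summands that are both at least
  \<open>X\<close> are at most s. The end therefore depends on the new interval only through s, and
  the rule is not circular. The obstacle is that the positive elements of \<open>int poly\<close>
  are not well-ordered and its order is not Archimedean, so a least element cannot be reached by
  counting upwards. What \<open>int poly\<close> shares with \<open>int\<close> is discreteness,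
  \<open>p < q\<close> iff \<open>p + 1 \<le> q\<close>. The counting is done for this common class,
  which confines least elements to one list of candidates, the same for polynomials and for their
  values.\<close>

datatype com =
    Ins instr
  | Seq com com  (infixr ";;" 60)
  | Unless nat com
  | Repeat com nat

type_synonym state = "(nat \<Rightarrow> int) \<times> int list"

text \<open>Only the translation to machine code places jumps. Any other instruction just advances
  the program counter, so its effect does not depend on its position.\<close>

fun jump_free :: "instr \<Rightarrow> bool" where
  "jump_free (JumpPos j l) = False"
| "jump_free _ = True"

text \<open>\<open>run m c s s'\<close> bounds the number of iterations of every execution of every loop by \<open>m\<close>.\<close>

fun run :: "nat \<Rightarrow> com \<Rightarrow> state \<Rightarrow> state \<Rightarrow> bool" where
  "run m (Ins i) s s' = (jump_free i \<and> (\<exists>l. exec_instr i (0, s) = Some (l, s')))"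
| "run m (c1 ;; c2) s s' = (\<exists>s1. run m c1 s s1 \<and> run m c2 s1 s')"
| "run m (Unless r c) s s' = (if fst s r > 0 then s' = s else run m c s s')"
| "run m (Repeat c r) s s' = (\<exists>n \<sigma>. 1 \<le> n \<and> n \<le> m \<and> \<sigma> 0 = s \<and> \<sigma> n = s' \<and>
     (\<forall>i<n. run m c (\<sigma> i) (\<sigma> (Suc i)) \<and> (fst (\<sigma> (Suc i)) r > 0 \<longleftrightarrow> Suc i < n)))"

text \<open>\<open>Unless\<close> becomes one forward jump over its body, \<open>Repeat\<close> one
  backward jump after it; so the body of a \<open>Repeat\<close> is executed at least once.\<close>

fun code :: "com \<Rightarrow> nat \<Rightarrow> ram_program" where
  "code (Ins i) l = [i]"
| "code (c1 ;; c2) l = code c1 l @ code c2 (l + length (code c1 l))"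
| "code (Unless r c) l = JumpPos r (Suc l + length (code c (Suc l))) # code c (Suc l)"
| "code (Repeat c r) l = code c l @ [JumpPos r l]"

fun max_steps :: "nat \<Rightarrow> com \<Rightarrow> nat" where
  "max_steps m (Ins i) = 1"
| "max_steps m (c1 ;; c2) = max_steps m c1 + max_steps m c2"
| "max_steps m (Unless r c) = 1 + max_steps m c"
| "max_steps m (Repeat c r) = m * (max_steps m c + 1)"

text \<open>For a fixed program the degree is at most the nesting depth of its loops; only the
  iteration bound \<open>m\<close> varies with the input.\<close>

lemma max_steps_polynomial: "\<exists>p :: nat poly. \<forall>m. max_steps m c = poly p m"
proof (induction c)
  case (Ins i)
  show ?case by (rule exI[of _ 1]) simp
next
  case (Seq c1 c2)
  then obtain p1 p2 where "\<forall>m. max_steps m c1 = poly p1 m" "\<forall>m. max_steps m c2 = poly p2 m"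
    by blast
  then show ?case by (intro exI[of _ "p1 + p2"]) simp
next
  case (Unless r c)
  then obtain p where "\<forall>m. max_steps m c = poly p m" by blast
  then show ?case by (intro exI[of _ "1 + p"]) simp
next
  case (Repeat c r)
  then obtain p where "\<forall>m. max_steps m c = poly p m" by blast
  then show ?case by (intro exI[of _ "[:0, 1:] * (p + 1)"]) simp
qed

text \<open>Steps are first counted without their cost, because the growth of the registers, and
  with it the cost, is bounded through the number of steps.\<close>

definition ram_step :: "ram_program \<Rightarrow> (config \<times> config) set" where
  "ram_step P = {((l, s), s'). l < length P \<and> exec_instr (P ! l) (l, s) = Some s'}"

lemma exec_instr_jump_free:
  assumes "jump_free i" "exec_instr i (l, s) = Some (l', s')"
  shows "exec_instr i (k, s) = Some (Suc k, s')"
  using assms by (cases s; cases i) (auto split: if_splits)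

lemma ram_step_at:
  assumes "P = pre @ i # post" "l = length pre" "exec_instr i (l, s) = Some s'"
  shows "((l, s), s') \<in> ram_step P"
  using assms by (simp add: ram_step_def)

text \<open>Jump targets are absolute, so the induction needs the code placed between an arbitrary
  prefix of length \<open>l\<close> and an arbitrary suffix.\<close>

lemma code_run:
  assumes "run m c s s'" "P = pre @ code c l @ post" "l = length pre"
  shows "\<exists>n \<le> max_steps m c. ((l, s), (l + length (code c l), s')) \<in> ram_step P ^^ n"
  using assms
proof (induction c arbitrary: s s' l pre post)
  case (Ins i)
  then have "exec_instr i (l, s) = Some (Suc l, s')"
    by (simp del: split_paired_Ex) (blast intro: exec_instr_jump_free)
  with Ins have "((l, s), (Suc l, s')) \<in> ram_step P"
    by (intro ram_step_at) auto
  then show ?case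
    by (intro exI[of _ 1]) simp
next
  case (Seq c1 c2)
  from Seq.prems obtain s1 where s1: "run m c1 s s1" "run m c2 s1 s'" by auto
  define l1 where "l1 = l + length (code c1 l)"
  obtain n1 where n1: "n1 \<le> max_steps m c1" "((l, s), (l1, s1)) \<in> ram_step P ^^ n1"
    using Seq.IH(1)[OF s1(1), of pre l "code c2 l1 @ post"] Seq.prems by (auto simp: l1_def)
  obtain n2 where n2: "n2 \<le> max_steps m c2"
    "((l1, s1), (l1 + length (code c2 l1), s')) \<in> ram_step P ^^ n2"
    using Seq.IH(2)[OF s1(2), of "pre @ code c1 l" l1 post] Seq.prems by (auto simp: l1_def)
  have "((l, s), (l1 + length (code c2 l1), s')) \<in> ram_step P ^^ (n1 + n2)"
    using n1 n2 by (auto simp: relpow_add)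
  then show ?case
    using n1 n2 by (intro exI[of _ "n1 + n2"]) (auto simp: l1_def add.assoc)
next
  case (Unless r c)
  obtain R ys where s: "s = (R, ys)" by (cases s)
  show ?case
  proof (cases "R r > 0")
    case True
    with Unless.prems have "((l, s), (l + length (code (Unless r c) l), s')) \<in> ram_step P"
      by (intro ram_step_at) (auto simp: s)
    then show ?thesis
      by (intro exI[of _ 1]) simp
  next
    case False
    with Unless.prems have *: "run m c s s'" by (simp add: s)
    have 1: "((l, s), (Suc l, s)) \<in> ram_step P"
      using Unless.prems False by (intro ram_step_at) (auto simp: s)
    obtain n where n: "n \<le> max_steps m c"
      "((Suc l, s), (Suc l + length (code c (Suc l)), s')) \<in> ram_step P ^^ n"
      using Unless.IH[OF *, of "pre @ [JumpPos r (Suc l + length (code c (Suc l)))]" "Suc l" post]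
        Unless.prems by auto
    have "((l, s), (Suc l + length (code c (Suc l)), s')) \<in> ram_step P ^^ Suc n"
      using 1 n(2) by (rule relpow_Suc_I2)
    then show ?thesis
      using n(1) by (intro exI[of _ "Suc n"]) auto
  qed
next
  case (Repeat c r)
  from Repeat.prems obtain n \<sigma> where n: "1 \<le> n" "n \<le> m" "\<sigma> 0 = s" "\<sigma> n = s'"
    and \<sigma>: "\<And>i. i < n \<Longrightarrow> run m c (\<sigma> i) (\<sigma> (Suc i))"
      "\<And>i. i < n \<Longrightarrow> fst (\<sigma> (Suc i)) r > 0 \<longleftrightarrow> Suc i < n"
    by auto
  define l1 where "l1 = l + length (code c l)"
  have iter: "\<exists>k \<le> max_steps m c + 1.
      ((l, \<sigma> i), (if Suc i < n then l else Suc l1, \<sigma> (Suc i))) \<in> ram_step P ^^ k"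
    if i: "i < n" for i
  proof -
    obtain k where k: "k \<le> max_steps m c" "((l, \<sigma> i), (l1, \<sigma> (Suc i))) \<in> ram_step P ^^ k"
      using Repeat.IH[OF \<sigma>(1)[OF i], of pre l "JumpPos r l # post"] Repeat.prems
      by (auto simp: l1_def)
    obtain R ys where R: "\<sigma> (Suc i) = (R, ys)" by (cases "\<sigma> (Suc i)")
    have "((l1, \<sigma> (Suc i)), (if Suc i < n then l else Suc l1, \<sigma> (Suc i))) \<in> ram_step P"
      using Repeat.prems \<sigma>(2)[OF i]
      by (intro ram_step_at[of _ "pre @ code c l" "JumpPos r l"]) (auto simp: l1_def R)
    with k show ?thesis
      by (intro exI[of _ "Suc k"]) auto
  qed
  have "\<exists>k \<le> i * (max_steps m c + 1).
      ((l, s), (if i < n then l else Suc l1, \<sigma> i)) \<in> ram_step P ^^ k" if "i \<le> n" for i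
    using that
  proof (induction i)
    case 0
    then show ?case using n by auto
  next
    case (Suc i)
    then obtain k where k: "k \<le> i * (max_steps m c + 1)" "((l, s), (l, \<sigma> i)) \<in> ram_step P ^^ k"
      by auto
    obtain k' where k': "k' \<le> max_steps m c + 1"
      "((l, \<sigma> i), (if Suc i < n then l else Suc l1, \<sigma> (Suc i))) \<in> ram_step P ^^ k'"
      using iter[of i] Suc.prems by auto
    have "((l, s), (if Suc i < n then l else Suc l1, \<sigma> (Suc i))) \<in> ram_step P ^^ (k + k')"
      using k k' unfolding relpow_add by blast
    then show ?case
      using k k' by (intro exI[of _ "k + k'"]) auto
  qed
  from this[of n] obtain k where k: "k \<le> n * (max_steps m c + 1)"
    "((l, s), (Suc l1, s')) \<in> ram_step P ^^ k"
    using n by auto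
  have "k \<le> m * (max_steps m c + 1)"
    using k(1) n(2) by (meson le_trans mult_le_mono1)
  with k show ?case
    by (intro exI[of _ k]) (auto simp: l1_def)
qed

text \<open>
  One step at most doubles the largest register, so the logarithmic cost of a run is at most
  quadratic in its number of steps.
\<close>

lemma int_size_le: "int_size z \<le> w + 2" if "\<bar>z\<bar> \<le> 2 ^ w"
proof -
  have "nat \<bar>z\<bar> \<le> 2 ^ w" using that by (simp add: nat_le_iff)
  then have "nat \<bar>z\<bar> < 2 ^ (w + 1)"
    by (rule le_less_trans) simp
  then have "floorlog 2 (nat \<bar>z\<bar>) \<le> w + 1"
    by (intro floorlog_leI) auto
  then show ?thesis by (simp add: int_size_def)
qed

definition consts_le :: "int \<Rightarrow> ram_program \<Rightarrow> bool" where
  "consts_le B P \<longleftrightarrow> (\<forall>i z. Const i z \<in> set P \<longrightarrow> \<bar>z\<bar> \<le> B)"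

lemma ram_run_cost:
  assumes "(s, s') \<in> ram_step P ^^ n" "\<forall>i. \<bar>fst (snd s) i\<bar> \<le> 2 ^ w" "consts_le (2 ^ w) P"
  shows "\<exists>t \<le> n * (2 * (w + n + 2)). ram_run P s t s'"
  using assms
proof (induction n arbitrary: s w)
  case 0
  then show ?case using ram_run.refl by auto
next
  case (Suc n)
  obtain l R ys where s: "s = (l, R, ys)" by (cases s)
  from Suc.prems obtain s1 where s1: "(s, s1) \<in> ram_step P" "(s1, s') \<in> ram_step P ^^ n"
    by (meson relpow_Suc_E2)
  then have l: "l < length P" and ex: "exec_instr (P ! l) (l, R, ys) = Some s1"
    by (auto simp: s ram_step_def)
  have R: "\<bar>R i\<bar> \<le> 2 ^ w" for i using Suc.prems(2) by (simp add: s)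
  have C: "\<bar>z\<bar> \<le> 2 ^ w" if "P ! l = Const i z" for i z
    using Suc.prems(3) l that unfolding consts_le_def by (metis nth_mem)
  have cost: "instr_cost (P ! l) R \<le> 2 * (w + 2)"
  proof -
    have 1: "int_size (R i) \<le> w + 2" for i using int_size_le R by blast
    have 2: "int_size (R i) + int_size (R j) \<le> 2 * (w + 2)" for i j
      unfolding mult_2 by (intro add_mono 1)
    have 3: "int_size (R i) \<le> 2 * (w + 2)" for i using 1[of i] by simp
    show ?thesis
    proof (cases "P ! l")
      case (Const i z)
      then show ?thesis using int_size_le[OF C[OF Const]] by simp
    qed (use 2 3 in simp_all)
  qed
  have le: "(2::int) ^ w \<le> 2 ^ Suc w" by simp
  have R1: "\<bar>fst (snd s1) i\<bar> \<le> 2 ^ Suc w" for i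
  proof -
    have 1: "\<bar>R i\<bar> \<le> 2 ^ Suc w" for i using R[of i] le by linarith
    have 2: "\<bar>R i + R j\<bar> \<le> 2 ^ Suc w" "\<bar>R i - R j\<bar> \<le> 2 ^ Suc w" for i j
      using R[of i] R[of j] by auto
    show ?thesis
    proof (cases "P ! l")
      case (Const j z)
      then show ?thesis using ex C[OF Const] 1 le by (auto intro: order_trans)
    qed (use ex 1 2 in \<open>auto split: if_splits\<close>)
  qed
  have "consts_le (2 ^ Suc w) P"
    using Suc.prems(3) le unfolding consts_le_def by (meson order_trans)
  with Suc.IH[OF s1(2), of "Suc w"] R1 obtain t
    where t: "t \<le> n * (2 * (Suc w + n + 2))" "ram_run P s1 t s'" by blast
  have "ram_run P s (instr_cost (P ! l) R + t) s'"
    unfolding s using l ex t(2) by (rule ram_run.step)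
  moreover have "instr_cost (P ! l) R + t \<le> Suc n * (2 * (w + Suc n + 2))"
    using cost t(1) by (simp add: algebra_simps)
  ultimately show ?case by blast
qed

lemma consts_le_exists: "\<exists>w. consts_le (2 ^ w) P"
proof (induction P)
  case Nil
  then show ?case by (simp add: consts_le_def)
next
  case (Cons i P)
  then obtain w where w: "consts_le (2 ^ w) P" by blast
  obtain z where z: "\<And>j z'. i = Const j z' \<Longrightarrow> z' = z" by (cases i) auto
  have "\<bar>z\<bar> < 2 ^ nat \<bar>z\<bar>"
    using of_nat_less_two_power[of "nat \<bar>z\<bar>", where 'a = int] by simp
  then have "\<bar>z\<bar> \<le> 2 ^ (w + nat \<bar>z\<bar>)" "(2::int) ^ w \<le> 2 ^ (w + nat \<bar>z\<bar>)"
    by (auto intro: order_trans[OF less_imp_le power_increasing])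
  with w z show ?case
    unfolding consts_le_def
    by (intro exI[of _ "w + nat \<bar>z\<bar>"]) (force intro: order_trans)
qed

lemma ram_computes_code:
  assumes "\<And>k. \<exists>R. run (poly q k) c ((\<lambda>_. 0)(0 := int k), []) (R, out k)"
  shows "\<exists>p :: nat poly. \<forall>k. \<exists>t. ram_computes (code c 0) k t (out k) \<and> t \<le> poly p k"
proof -
  obtain p where p: "\<And>m. max_steps m c = poly p m" using max_steps_polynomial by blast
  obtain w where w: "consts_le (2 ^ w) (code c 0)" using consts_le_exists by blast
  define P where "P = pcompose p q"
  \<comment> \<open>The quadratic cost bound for at most \<open>poly P k\<close> steps, starting
    from the exponent \<open>w + k\<close>: \<open>2 ^ w\<close> bounds the constants of the program
    and \<open>2 ^ k\<close> the input.\<close>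
  have "\<exists>t. ram_computes (code c 0) k t (out k) \<and>
      t \<le> poly (P * (2 * ([:w, 1:] + P + 2))) k" for k
  proof -
    define R0 :: "nat \<Rightarrow> int" where "R0 = (\<lambda>_. 0)(0 := int k)"
    obtain R where "run (poly q k) c (R0, []) (R, out k)"
      using assms unfolding R0_def by blast
    from code_run[OF this, of "code c 0" "[]" 0 "[]"] obtain n where n: "n \<le> poly P k"
      "((0, R0, []), (length (code c 0), R, out k)) \<in> ram_step (code c 0) ^^ n"
      by (auto simp: p P_def poly_pcompose)
    have k: "int k \<le> 2 ^ (w + k)"
    proof -
      have "int k \<le> 2 ^ k" using of_nat_less_two_power[of k, where 'a = int] by simp
      also have "\<dots> \<le> 2 ^ (w + k)" by (simp add: power_increasing)
      finally show ?thesis .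
    qed
    then have R0: "\<forall>i. \<bar>fst (snd (0, R0, [])) i\<bar> \<le> 2 ^ (w + k)" by (simp add: R0_def)
    have "consts_le (2 ^ (w + k)) (code c 0)"
      using w unfolding consts_le_def by (meson le_add1 one_le_numeral order_trans power_increasing)
    then obtain t where t: "t \<le> n * (2 * (w + k + n + 2))"
      "ram_run (code c 0) (0, R0, []) t (length (code c 0), R, out k)"
      using ram_run_cost[OF n(2), of "w + k"] R0 by auto
    have "t \<le> poly P k * (2 * (w + k + poly P k + 2))"
      using t(1) n(1) by (elim order_trans) (intro mult_mono, auto)
    with t(2) show ?thesis
      unfolding ram_computes_def R0_def by (intro exI[of _ t]) (auto simp: algebra_simps)
  qed
  then show ?thesis by blast
qed

section \<open>Counting representations by intervals\<close>

text \<open>The sign of a difference is that of its leading coefficient, and subtracting 1 affects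
  it only for constants; so discreteness passes from the coefficients to the polynomials.\<close>

instance poly :: ("{linordered_idom, discrete_linordered_semidom}") discrete_linordered_semidom
proof
  fix p q :: "'a poly"
  have "pos_poly r \<longleftrightarrow> r = 1 \<or> pos_poly (r - 1)" for r :: "'a poly"
  proof (cases r)
    case (pCons a r')
    have "0 < a \<longleftrightarrow> a = 1 \<or> 1 < a"
      unfolding less_iff_succ_less_eq[of 0 a] add_0 order_le_less by (rule disj_commute[THEN trans]) blast
    with pCons show ?thesis
      by (simp add: one_pCons pos_poly_pCons) blast
  qed
  from this[of "q - p"] have "pos_poly (q - p) \<longleftrightarrow> p + 1 = q \<or> pos_poly (q - (p + 1))"
    by (simp add: diff_diff_eq[symmetric] diff_eq_eq eq_commute[of _ q] add.commute[of 1])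
  then show "p < q \<longleftrightarrow> p + 1 \<le> q"
    unfolding less_poly_def less_eq_poly_def .
qed

text \<open>
  The \<open>x \<in> {s..e}\<close> with \<open>q - x \<in> {s'..e'}\<close> and \<open>2 * x < q\<close> form an interval whose least element, if
  any, is \<open>max s (q - e')\<close>. Comparing doubled quantities avoids halving \<open>q\<close>. Capping the number of
  such \<open>x\<close> at 2 keeps it finite also in \<open>int poly\<close>.
\<close>

definition slack :: "'a::linordered_idom \<Rightarrow> 'a \<Rightarrow> 'a \<Rightarrow> 'a \<Rightarrow> 'a \<Rightarrow> 'a" where
  "slack s e s' e' q = min q (min (2 * e + 1) (2 * (q - s') + 1)) - max (2 * s) (2 * (q - e'))"

text \<open>With x0 the least possible summand, all upper bounds are strict bounds on the doubled
  summand. So x0 qualifies iff \<open>2 * x0 + 1\<close> stays within them, and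
  \<open>x0 + 1\<close> iff \<open>2 * x0 + 3\<close> does; hence the thresholds 1 and 3.\<close>

definition pair_count :: "'a::linordered_idom \<Rightarrow> 'a \<Rightarrow> 'a \<Rightarrow> 'a \<Rightarrow> 'a \<Rightarrow> nat" where
  "pair_count s e s' e' q =
     of_bool (1 \<le> slack s e s' e' q) + of_bool (3 \<le> slack s e s' e' q)"

text \<open>Index 0 is left out: that interval is \<open>{1}\<close>. Summing over ordered pairs of
  indices counts nothing twice, since \<open>2 * x < q\<close> singles out the smaller
  summand.\<close>

definition rep_count :: "(nat \<Rightarrow> 'a::linordered_idom) \<Rightarrow> (nat \<Rightarrow> 'a) \<Rightarrow> nat \<Rightarrow> 'a \<Rightarrow> nat" where
  "rep_count s e n q = (\<Sum>i = 1..n. \<Sum>j = 1..n. pair_count (s i) (e i) (s j) (e j) q)"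

lemma rep_count_cong:
  "(\<And>i. i \<in> {1..n} \<Longrightarrow> s i = s' i \<and> e i = e' i) \<Longrightarrow> rep_count s e n q = rep_count s' e' n q"
  unfolding rep_count_def by (intro sum.cong HOL.refl) auto

definition pair_reps :: "'a::linordered_idom \<Rightarrow> 'a \<Rightarrow> 'a \<Rightarrow> 'a \<Rightarrow> 'a \<Rightarrow> 'a set" where
  "pair_reps s e s' e' q = {x \<in> {s..e}. q - x \<in> {s'..e'} \<and> 2 * x < q}"

text \<open>Three upper and two lower bounds give six conditions, each on the sign of a single
  linear expression, which is the form that can be evaluated at an integer.\<close>

lemma le_slack_iff:
  "c \<le> slack s e s' e' q \<longleftrightarrow>
     0 \<le> q - 2 * s - c \<and> 0 \<le> q - 2 * (q - e') - c \<and>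
     0 \<le> 2 * e + 1 - 2 * s - c \<and> 0 \<le> 2 * e + 1 - 2 * (q - e') - c \<and>
     0 \<le> 2 * (q - s') + 1 - 2 * s - c \<and> 0 \<le> 2 * (q - s') + 1 - 2 * (q - e') - c"
  unfolding slack_def min_def max_def by auto

context
  fixes s e s' e' q :: "'a::{linordered_idom, discrete_linordered_semidom}"
begin

private lemma double_less: "2 * x < y \<longleftrightarrow> 2 * x + 1 \<le> (y::'a)"
  by (rule less_iff_succ_less_eq)

lemma slack_ge_1: "1 \<le> slack s e s' e' q \<longleftrightarrow> max s (q - e') \<in> pair_reps s e s' e' q"
  unfolding le_slack_iff pair_reps_def mem_Collect_eq double_less
  by (auto simp: max_def)

lemma slack_ge_3: "3 \<le> slack s e s' e' q \<longleftrightarrow> max s (q - e') + 1 \<in> pair_reps s e s' e' q"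
  unfolding le_slack_iff pair_reps_def mem_Collect_eq double_less
  by (auto simp: max_def algebra_simps)

lemma pair_reps_least: "x \<in> pair_reps s e s' e' q \<Longrightarrow> max s (q - e') \<in> pair_reps s e s' e' q"
  unfolding pair_reps_def by (auto simp: max_def algebra_simps)

lemma pair_reps_second:
  assumes "x \<in> pair_reps s e s' e' q" "x \<noteq> max s (q - e')"
  shows "max s (q - e') + 1 \<in> pair_reps s e s' e' q"
proof -
  have "max s (q - e') \<le> x" using assms by (auto simp: pair_reps_def algebra_simps)
  with assms have "max s (q - e') + 1 \<le> x" by (metis less_iff_succ_less_eq order_le_less)
  with assms(1) show ?thesis
    unfolding pair_reps_def by (auto simp: max_def algebra_simps split: if_splits)
qed

lemma pair_count_eq_0_iff: "pair_count s e s' e' q = 0 \<longleftrightarrow> pair_reps s e s' e' q = {}"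
  using pair_reps_least slack_ge_1 by (fastforce simp: pair_count_def)

lemma pair_count_eq_1_iff: "pair_count s e s' e' q = 1 \<longleftrightarrow> (\<exists>!x. x \<in> pair_reps s e s' e' q)"
proof -
  have "pair_count s e s' e' q = 1 \<longleftrightarrow>
      max s (q - e') \<in> pair_reps s e s' e' q \<and> max s (q - e') + 1 \<notin> pair_reps s e s' e' q"
    unfolding slack_ge_1[symmetric] slack_ge_3[symmetric] by (auto simp: pair_count_def)
  then show ?thesis
    by (metis add_cancel_left_right one_neq_zero pair_reps_least pair_reps_second)
qed

text \<open>
  Away from the sums of corresponding endpoints, \<open>q\<close> and \<open>q - 1\<close> lie in the same linear piece of
  the counting function.
\<close>

lemma pair_count_change:
  assumes "s \<le> e" "s' \<le> e'" and disj: "e < s' \<or> e' < s \<or> s = s' \<and> e = e'"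
    and "pair_count s e s' e' q \<noteq> pair_count s e s' e' (q - 1)"
  shows "\<bar>q - (s + s')\<bar> \<le> 3 \<or> \<bar>q - (e + e')\<bar> \<le> 3"
proof (rule ccontr)
  assume "\<not> ?thesis"
  then have far: "3 < \<bar>q - (s + s')\<bar>" "3 < \<bar>q - (e + e')\<bar>" by auto
  have D: "x < y \<longleftrightarrow> x + 1 \<le> y" for x y :: 'a by (rule less_iff_succ_less_eq)
  have far': "q + 4 \<le> s + s' \<or> s + s' + 4 \<le> q" "q + 4 \<le> e + e' \<or> e + e' + 4 \<le> q"
    using far D[of 3] by (auto simp: abs_if algebra_simps split: if_splits)
  \<comment> \<open>There are no pairs in the first three cases. In the fourth the count is 2, or 1
    if one of the intervals is a single point; in the fifth it is 2. The last case dictates the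
    margin 3: for \<open>s\<close> and \<open>s + 1\<close> both to lie below half of
    \<open>q - 1\<close>, \<open>q - 1\<close> must be at least \<open>2 * s + 3\<close>.\<close>
  consider "q + 4 \<le> s + s'" | "e + e' + 4 \<le> q" | "e' < s" |
      "s + s' + 4 \<le> q" "q + 4 \<le> e + e'" "e < s'" |
      "s + s' + 4 \<le> q" "q + 4 \<le> e + e'" "s = s'" "e = e'"
    using far' disj by blast
  then have "pair_count s e s' e' q = pair_count s e s' e' (q - 1)"
  proof cases
    case 1
    then have "\<not> 1 \<le> slack s e s' e' p \<and> \<not> 3 \<le> slack s e s' e' p" if "p \<le> q" for p
      using that unfolding le_slack_iff by auto
    from this[of q] this[of "q - 1"] show ?thesis by (simp add: pair_count_def)
  next
    case 2
    then have "\<not> 1 \<le> slack s e s' e' p \<and> \<not> 3 \<le> slack s e s' e' p" if "q - 1 \<le> p" for p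
      using that unfolding le_slack_iff by auto
    from this[of q] this[of "q - 1"] show ?thesis by (simp add: pair_count_def)
  next
    case 3
    then have "\<not> 1 \<le> slack s e s' e' p \<and> \<not> 3 \<le> slack s e s' e' p" for p
      using assms(1,2) unfolding le_slack_iff by auto
    from this[of q] this[of "q - 1"] show ?thesis by (simp add: pair_count_def)
  next
    case 4
    have s: "s = e \<or> s + 1 \<le> e" "s' = e' \<or> s' + 1 \<le> e'" "e + 1 \<le> s'"
      using assms(1,2) 4 by (auto simp: D[symmetric])
    have "1 \<le> slack s e s' e' p \<and> (3 \<le> slack s e s' e' p \<longleftrightarrow> s \<noteq> e \<and> s' \<noteq> e')"
      if "q - 1 \<le> p" "p \<le> q" for p
      using that 4 assms(1,2) s unfolding le_slack_iff by auto
    from this[of q] this[of "q - 1"] show ?thesis by (simp add: pair_count_def)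
  next
    case 5
    then have "1 \<le> slack s e s' e' p \<and> 3 \<le> slack s e s' e' p"
      if "q - 1 \<le> p" "p \<le> q" for p
      using that assms(1,2) unfolding le_slack_iff by auto
    from this[of q] this[of "q - 1"] show ?thesis by (simp add: pair_count_def)
  qed
  with assms show False by simp
qed

end


section \<open>Sums of two elements of a union of intervals\<close>

definition chain :: "(nat \<Rightarrow> 'a::linordered_idom) \<Rightarrow> (nat \<Rightarrow> 'a) \<Rightarrow> nat \<Rightarrow> bool" where
  "chain s e n \<longleftrightarrow> (\<forall>i \<in> {1..n}. s i \<le> e i \<and> (\<forall>j \<in> {1..n}. i < j \<longrightarrow> e i < s j))"

definition near_sum :: "(nat \<Rightarrow> 'a::linordered_idom) \<Rightarrow> (nat \<Rightarrow> 'a) \<Rightarrow> nat \<Rightarrow> 'a \<Rightarrow> bool" where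
  "near_sum s e n q \<longleftrightarrow>
     (\<exists>i \<in> {1..n}. \<exists>j \<in> {1..n}. \<bar>q - (s i + s j)\<bar> \<le> 3 \<or> \<bar>q - (e i + e j)\<bar> \<le> 3)"

abbreviation intervals :: "(nat \<Rightarrow> 'a::linordered_idom) \<Rightarrow> (nat \<Rightarrow> 'a) \<Rightarrow> nat \<Rightarrow> 'a set" where
  "intervals s e n \<equiv> (\<Union>i \<in> {1..n}. {s i..e i})"

lemma chain_unique:
  assumes "chain s e n" "i \<in> {1..n}" "j \<in> {1..n}" "x \<in> {s i..e i}" "x \<in> {s j..e j}"
  shows "i = j"
proof (rule linorder_cases[of i j])
  assume "i < j"
  then have "e i < s j" using assms(1-3) by (auto simp: chain_def)
  with assms(4,5) show ?thesis by auto
next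
  assume "j < i"
  then have "e j < s i" using assms(1-3) by (auto simp: chain_def)
  with assms(4,5) show ?thesis by auto
qed

lemma unique_sum_iff:
  fixes W :: "'a::linordered_idom set"
  shows "unique_sum W q \<longleftrightarrow> (\<exists>!x. x \<in> W \<and> q - x \<in> W \<and> 2 * x < q)"
proof -
  have "(case z of (x, y) \<Rightarrow> x \<in> W \<and> y \<in> W \<and> x < y \<and> q = x + y) \<longleftrightarrow>
      snd z = q - fst z \<and> fst z \<in> W \<and> q - fst z \<in> W \<and> 2 * fst z < q" for z
    by (cases z) (auto simp: algebra_simps)
  then show ?thesis
    unfolding unique_sum_def by (simp add: Ex1_def)
qed

context
  fixes s e :: "nat \<Rightarrow> 'a::{linordered_idom, discrete_linordered_semidom}" and n :: nat
begin

lemma reps_intervals_iff: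
  "x \<in> intervals s e n \<and> q - x \<in> intervals s e n \<and> 2 * x < q \<longleftrightarrow>
     (\<exists>p \<in> {1..n} \<times> {1..n}. x \<in> pair_reps (s (fst p)) (e (fst p)) (s (snd p)) (e (snd p)) q)"
  by (force simp: pair_reps_def)

lemma rep_count_eq_sum:
  "rep_count s e n q =
     (\<Sum>p \<in> {1..n} \<times> {1..n}. pair_count (s (fst p)) (e (fst p)) (s (snd p)) (e (snd p)) q)"
  by (simp add: rep_count_def sum.cartesian_product split_def)

lemma rep_count_eq_0_iff:
  "rep_count s e n q = 0 \<longleftrightarrow>
     \<not> (\<exists>x. x \<in> intervals s e n \<and> q - x \<in> intervals s e n \<and> 2 * x < q)"
  unfolding reps_intervals_iff rep_count_eq_sum
  by (subst sum_eq_0_iff) (auto simp: pair_count_eq_0_iff)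

lemma rep_count_ge_1_iff:
  "1 \<le> rep_count s e n q \<longleftrightarrow>
     (\<exists>x. x \<in> intervals s e n \<and> q - x \<in> intervals s e n \<and> 2 * x < q)"
proof -
  have "1 \<le> rep_count s e n q \<longleftrightarrow> rep_count s e n q \<noteq> 0" by auto
  then show ?thesis unfolding rep_count_eq_0_iff by (simp only: not_not)
qed

text \<open>In disjoint intervals each representation belongs to just one pair of indices, so a
  total of capped counts equal to 1 still means exactly one representation.\<close>

lemma rep_count_eq_1_iff:
  assumes "chain s e n"
  shows "rep_count s e n q = 1 \<longleftrightarrow> unique_sum (intervals s e n) q"
proof -
  define A where "A = {1..n} \<times> {1..n}"
  define Rp where "Rp p = pair_reps (s (fst p)) (e (fst p)) (s (snd p)) (e (snd p)) q" for p
  have dis: "p = p'" if "p \<in> A" "p' \<in> A" "x \<in> Rp p" "x \<in> Rp p'" for p p' x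
    using that chain_unique[OF assms, of "fst p" "fst p'" x]
      chain_unique[OF assms, of "snd p" "snd p'" "q - x"]
    by (auto simp: A_def Rp_def pair_reps_def prod_eq_iff)
  have "rep_count s e n q = 1 \<longleftrightarrow>
      (\<exists>p \<in> A. (\<exists>!x. x \<in> Rp p) \<and> (\<forall>p' \<in> A. p \<noteq> p' \<longrightarrow> Rp p' = {}))"
    unfolding rep_count_eq_sum A_def[symmetric] Rp_def
      pair_count_eq_0_iff[symmetric] pair_count_eq_1_iff[symmetric]
    by (rule sum_eq_1_iff) (simp add: A_def)
  also have "\<dots> \<longleftrightarrow> (\<exists>!x. \<exists>p \<in> A. x \<in> Rp p)"
  proof
    assume "\<exists>!x. \<exists>p \<in> A. x \<in> Rp p"
    then obtain x p where x: "p \<in> A" "x \<in> Rp p" and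
      unique: "\<And>x' p'. p' \<in> A \<Longrightarrow> x' \<in> Rp p' \<Longrightarrow> x' = x" by blast
    have "\<exists>!x. x \<in> Rp p" using x unique by blast
    moreover have "Rp p' = {}" if "p' \<in> A" "p \<noteq> p'" for p'
      using x unique dis that by blast
    ultimately show "\<exists>p \<in> A. (\<exists>!x. x \<in> Rp p) \<and> (\<forall>p' \<in> A. p \<noteq> p' \<longrightarrow> Rp p' = {})"
      using x(1) by blast
  next
    assume "\<exists>p \<in> A. (\<exists>!x. x \<in> Rp p) \<and> (\<forall>p' \<in> A. p \<noteq> p' \<longrightarrow> Rp p' = {})"
    then obtain p x where p: "p \<in> A" "x \<in> Rp p" "\<And>x'. x' \<in> Rp p \<Longrightarrow> x' = x"
      "\<And>p'. p' \<in> A \<Longrightarrow> p \<noteq> p' \<Longrightarrow> Rp p' = {}" by blast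
    have "x' = x" if "p' \<in> A" "x' \<in> Rp p'" for p' x'
      using p that by (cases "p = p'") auto
    with p(1,2) show "\<exists>!x. \<exists>p \<in> A. x \<in> Rp p" by blast
  qed
  also have "\<dots> \<longleftrightarrow> unique_sum (intervals s e n) q"
    unfolding unique_sum_iff reps_intervals_iff A_def Rp_def ..
  finally show ?thesis .
qed

lemma rep_count_change:
  assumes "chain s e n" "rep_count s e n q \<noteq> rep_count s e n (q - 1)"
  shows "near_sum s e n q"
proof -
  obtain i j where ij: "i \<in> {1..n}" "j \<in> {1..n}"
    "pair_count (s i) (e i) (s j) (e j) q \<noteq> pair_count (s i) (e i) (s j) (e j) (q - 1)"
  proof (rule ccontr)
    assume "\<not> thesis"
    with that have "pair_count (s i) (e i) (s j) (e j) q = pair_count (s i) (e i) (s j) (e j) (q - 1)"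
      if "i \<in> {1..n}" "j \<in> {1..n}" for i j using that by blast
    then have "rep_count s e n q = rep_count s e n (q - 1)"
      unfolding rep_count_def by (intro sum.cong HOL.refl)
    with assms(2) show False by simp
  qed
  have "s i \<le> e i" "s j \<le> e j" using assms(1) ij(1,2) by (auto simp: chain_def)
  moreover have "e i < s j \<or> e j < s i \<or> s i = s j \<and> e i = e j"
    using assms(1) ij(1,2) unfolding chain_def by (cases i j rule: linorder_cases) auto
  ultimately show ?thesis
    using pair_count_change ij unfolding near_sum_def by blast
qed

end

text \<open>The domain \<open>D\<close> will be \<open>deg_le 1\<close> for polynomials and
  \<open>UNIV\<close> for integers.\<close>

definition least_above :: "'a::linorder set \<Rightarrow> ('a \<Rightarrow> bool) \<Rightarrow> 'a \<Rightarrow> 'a \<Rightarrow> bool" where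
  "least_above D P b x \<longleftrightarrow> x \<in> D \<and> b < x \<and> P x \<and> (\<forall>q \<in> D. b < q \<longrightarrow> q < x \<longrightarrow> \<not> P q)"

text \<open>If the counts at \<open>x\<close> and \<open>x - 1\<close> agree, then
  \<open>x - 1\<close> meets the same condition, and leastness of \<open>x\<close> forces it down to
  the bound.\<close>

lemma least_above_near_sum:
  fixes s e :: "nat \<Rightarrow> 'a::{linordered_idom, discrete_linordered_semidom}"
  assumes "least_above D (\<lambda>q. Q (rep_count s e n q)) b x" "chain s e n" "x - 1 \<in> D"
  shows "x = b + 1 \<or> near_sum s e n x"
proof (cases "rep_count s e n x = rep_count s e n (x - 1)")
  case True
  then have "\<not> b < x - 1" using assms(1,3) by (auto simp: least_above_def)
  moreover have "b + 1 \<le> x"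
    using assms(1) by (auto simp: least_above_def less_iff_succ_less_eq)
  ultimately show ?thesis by auto
qed (use rep_count_change assms(2) in blast)

section \<open>Linear polynomials and their values\<close>

lemma deg_le_add: "p \<in> deg_le m \<Longrightarrow> q \<in> deg_le m \<Longrightarrow> p + q \<in> deg_le m"
  and deg_le_diff: "p \<in> deg_le m \<Longrightarrow> q \<in> deg_le m \<Longrightarrow> p - q \<in> deg_le m"
  and deg_le_1: "1 \<in> deg_le m"
  by (auto simp: deg_le_def intro: degree_add_le degree_diff_le)

text \<open>Once \<open>n\<close> exceeds the constant coefficient in absolute value, a nonzero
  coefficient of \<open>X\<close> decides the sign of the value just as it decides the
  order.\<close>

lemma nonneg_linear_iff:
  fixes p :: "int poly"
  assumes "degree p \<le> 1" "\<bar>coeff p 0\<bar> < n"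
  shows "0 \<le> p \<longleftrightarrow> 0 \<le> poly p n"
proof -
  define a b where "a = coeff p 1" and "b = coeff p 0"
  have p: "p = [:b, a:]"
    by (rule poly_eqI)
      (use assms(1) in \<open>auto simp: a_def b_def coeff_pCons coeff_eq_0 split: nat.splits\<close>)
  have b: "\<bar>b\<bar> < n" using assms(2) p by simp
  have "0 \<le> b + n * a" if "0 < a"
  proof -
    have "n * 1 \<le> n * a" using that b by (intro mult_left_mono) auto
    with b show ?thesis by linarith
  qed
  moreover have "b + n * a < 0" if "a < 0"
  proof -
    have "n * a \<le> n * (-1)" using that b by (intro mult_left_mono) auto
    with b show ?thesis by linarith
  qed
  moreover have "0 \<le> p \<longleftrightarrow> 0 < a \<or> a = 0 \<and> 0 \<le> b"
    by (auto simp: p less_eq_poly_def pos_poly_pCons)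
  ultimately show ?thesis
    by (cases "a = 0") (auto simp: p neq_iff)
qed

definition small :: "int \<Rightarrow> int poly \<Rightarrow> bool" where
  "small M p \<longleftrightarrow> degree p \<le> 1 \<and> (\<forall>i. \<bar>coeff p i\<bar> \<le> M)"

lemma small_add: "small M p \<Longrightarrow> small M' q \<Longrightarrow> small (M + M') (p + q)"
  unfolding small_def coeff_add by (meson abs_triangle_ineq add_mono degree_add_le order_trans)

lemma small_diff: "small M p \<Longrightarrow> small M' q \<Longrightarrow> small (M + M') (p - q)"
  unfolding small_def coeff_diff by (meson abs_triangle_ineq4 add_mono degree_diff_le order_trans)

lemma small_mono: "small M p \<Longrightarrow> M \<le> M' \<Longrightarrow> small M' p"
  unfolding small_def by (meson order_trans)

lemma small_of_int: "\<bar>t\<bar> \<le> M \<Longrightarrow> small M (of_int t)"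
  by (auto simp: small_def of_int_poly coeff_pCons split: nat.splits)

lemma small_1: "small 1 1"
  using small_of_int[of 1 1] by simp

lemma small_double: "small M p \<Longrightarrow> small (2 * M) (2 * p)"
  unfolding mult_2 by (rule small_add)

lemma small_ge_0: "small M p \<Longrightarrow> 0 \<le> M"
  unfolding small_def by (meson abs_ge_zero order_trans)

lemma small_deg_le: "small M p \<Longrightarrow> p \<in> deg_le 1"
  by (simp add: small_def deg_le_def)

lemma nonneg_small_iff: "small M p \<Longrightarrow> M < n \<Longrightarrow> 0 \<le> p \<longleftrightarrow> 0 \<le> poly p n"
  by (rule nonneg_linear_iff) (auto simp: small_def intro: le_less_trans)

lemma le_small_iff:
  assumes "small M p" "small M' q" "M + M' < n"
  shows "p \<le> q \<longleftrightarrow> poly p n \<le> poly q n"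
  using nonneg_small_iff[OF small_diff[OF assms(2,1)], of n] assms(3) by (simp add: add.commute)

lemma less_small_iff:
  assumes "small M p" "small M' q" "M + M' < n"
  shows "p < q \<longleftrightarrow> poly p n < poly q n"
  using le_small_iff[OF assms(2,1), of n] assms(3) by (simp add: not_le[symmetric] add.commute)

lemma poly_eq_small_iff:
  assumes "small M p" "small M' q" "M + M' < n"
  shows "poly p n = poly q n \<longleftrightarrow> p = q"
  using less_small_iff[OF assms] less_small_iff[OF assms(2,1), of n] assms(3)
  by (auto simp: neq_iff add.commute)

text \<open>Discreteness leaves no room between consecutive integers, even where infinitely large
  elements exist.\<close>

lemma of_int_between:
  fixes x :: "'a::{linordered_idom, discrete_linordered_semidom}"
  assumes "of_int l \<le> x" "x \<le> of_int (l + int k)"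
  shows "\<exists>t \<in> {l..l + int k}. x = of_int t"
  using assms(2)
proof (induction k)
  case 0
  then show ?case using assms(1) by auto
next
  case (Suc k)
  show ?case
  proof (cases "x = of_int (l + int (Suc k))")
    case False
    with Suc.prems have "x + 1 \<le> of_int (l + int (Suc k))"
      by (metis less_iff_succ_less_eq order_le_less)
    then have "x \<le> of_int (l + int k)" by simp
    with Suc.IH show ?thesis by force
  next
    case True
    then show ?thesis by (intro bexI[of _ "l + int (Suc k)"]) auto
  qed
qed

lemma abs_le_3:
  fixes x :: "'a::{linordered_idom, discrete_linordered_semidom}"
  assumes "\<bar>x\<bar> \<le> 3"
  shows "\<exists>t. \<bar>t\<bar> \<le> 3 \<and> x = of_int t"
proof -
  have "of_int (- 3) \<le> x" "x \<le> of_int (- 3 + int 6)" using assms by (auto simp: abs_le_iff)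
  then show ?thesis using of_int_between[of "- 3" x 6] by auto
qed

lemma near_sumE:
  fixes s e :: "nat \<Rightarrow> 'a::{linordered_idom, discrete_linordered_semidom}"
  assumes "near_sum s e n q"
  obtains i j t where "i \<in> {1..n}" "j \<in> {1..n}" "\<bar>t\<bar> \<le> 3"
    "q = s i + s j + of_int t \<or> q = e i + e j + of_int t"
proof -
  from assms obtain i j where ij: "i \<in> {1..n}" "j \<in> {1..n}"
    "\<bar>q - (s i + s j)\<bar> \<le> 3 \<or> \<bar>q - (e i + e j)\<bar> \<le> 3"
    unfolding near_sum_def by blast
  from ij(3) show thesis
  proof
    assume "\<bar>q - (s i + s j)\<bar> \<le> 3"
    then obtain t where "\<bar>t\<bar> \<le> 3" "q - (s i + s j) = of_int t" using abs_le_3 by blast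
    with ij show thesis by (intro that[of i j t]) (auto simp: algebra_simps)
  next
    assume "\<bar>q - (e i + e j)\<bar> \<le> 3"
    then obtain t where "\<bar>t\<bar> \<le> 3" "q - (e i + e j) = of_int t" using abs_le_3 by blast
    with ij show thesis by (intro that[of i j t]) (auto simp: algebra_simps)
  qed
qed

text \<open>Each of the six conditions behind the count concerns a polynomial with coefficients at
  most \<open>8 * M + 12\<close>, the worst being \<open>q - 2 * (q - e') - c\<close>.\<close>

lemma pair_count_eval:
  assumes "small M s" "small M e" "small M s'" "small M e'" "small (2 * M + 3) q" "8 * M + 20 < n"
  shows "pair_count (poly s n) (poly e n) (poly s' n) (poly e' n) (poly q n) =
    pair_count s e s' e' q"
proof -
  note sm = assms(1-5)
  have M: "0 \<le> M" using small_ge_0 assms(1) .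
  have iff: "0 \<le> poly p n \<longleftrightarrow> 0 \<le> p" if "small M' p" "M' \<le> 8 * M + 20" for p M'
    using nonneg_small_iff[OF that(1), of n] that(2) assms(6) by simp
  have "c \<le> slack (poly s n) (poly e n) (poly s' n) (poly e' n) (poly q n) \<longleftrightarrow>
      of_int c \<le> slack s e s' e' q" if "\<bar>c\<bar> \<le> 3" for c
  proof -
    note sc = small_of_int[OF that]
    have 1: "0 \<le> poly (q - 2 * s - of_int c) n \<longleftrightarrow> 0 \<le> q - 2 * s - of_int c"
      by (rule iff, (rule sm sc small_1 small_double small_diff small_add)+) (use M in simp)
    have 2: "0 \<le> poly (q - 2 * (q - e') - of_int c) n \<longleftrightarrow> 0 \<le> q - 2 * (q - e') - of_int c"
      by (rule iff, (rule sm sc small_1 small_double small_diff small_add)+) (use M in simp)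
    have 3: "0 \<le> poly (2 * e + 1 - 2 * s - of_int c) n \<longleftrightarrow> 0 \<le> 2 * e + 1 - 2 * s - of_int c"
      by (rule iff, (rule sm sc small_1 small_double small_diff small_add)+) (use M in simp)
    have 4: "0 \<le> poly (2 * e + 1 - 2 * (q - e') - of_int c) n \<longleftrightarrow>
        0 \<le> 2 * e + 1 - 2 * (q - e') - of_int c"
      by (rule iff, (rule sm sc small_1 small_double small_diff small_add)+) (use M in simp)
    \<comment> \<open>Cancelling \<open>q\<close> first matters: estimated term by term, the
      uncancelled expression only gets the bound \<open>12 * M + 16\<close>, too large for
      \<open>n\<close>.\<close>
    have "0 \<le> poly (2 * (e' - s') + 1 - of_int c) n \<longleftrightarrow> 0 \<le> 2 * (e' - s') + 1 - of_int c"
      by (rule iff, (rule sm sc small_1 small_double small_diff small_add)+) (use M in simp)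
    moreover have "2 * (q - s') + 1 - 2 * (q - e') - of_int c = 2 * (e' - s') + 1 - of_int c"
      by (simp add: algebra_simps)
    ultimately have 5: "0 \<le> poly (2 * (q - s') + 1 - 2 * (q - e') - of_int c) n \<longleftrightarrow>
        0 \<le> 2 * (q - s') + 1 - 2 * (q - e') - of_int c"
      by metis
    have 6: "0 \<le> poly (2 * (q - s') + 1 - 2 * s - of_int c) n \<longleftrightarrow>
        0 \<le> 2 * (q - s') + 1 - 2 * s - of_int c"
      by (rule iff, (rule sm sc small_1 small_double small_diff small_add)+) (use M in simp)
    show ?thesis
      unfolding le_slack_iff 1[symmetric] 2[symmetric] 3[symmetric] 4[symmetric] 5[symmetric]
        6[symmetric] by (simp add: of_int_poly)
  qed
  from this[of 1] this[of 3] show ?thesis by (simp add: pair_count_def)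
qed

lemma rep_count_eval:
  assumes "\<And>i. i \<in> {1..m} \<Longrightarrow> small M (s i) \<and> small M (e i)"
    and "small (2 * M + 3) q" "8 * M + 20 < n"
  shows "rep_count (\<lambda>i. poly (s i) n) (\<lambda>i. poly (e i) n) m (poly q n) = rep_count s e m q"
  unfolding rep_count_def using assms by (intro sum.cong HOL.refl pair_count_eval[where M = M]) auto

lemma chain_eval:
  assumes "\<And>i. i \<in> {1..m} \<Longrightarrow> small M (s i) \<and> small M (e i)" "2 * M < n" "chain s e m"
  shows "chain (\<lambda>i. poly (s i) n) (\<lambda>i. poly (e i) n) m"
  unfolding chain_def
proof (intro ballI conjI impI)
  fix i assume i: "i \<in> {1..m}"
  then have "s i \<le> e i" using assms(3) by (auto simp: chain_def)
  then show "poly (s i) n \<le> poly (e i) n"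
    using le_small_iff[of M "s i" M "e i" n] assms(1)[OF i] assms(2) by simp
  fix j assume j: "j \<in> {1..m}" "i < j"
  then have "e i < s j" using i assms(3) by (auto simp: chain_def)
  then show "poly (e i) n < poly (s j) n"
    using less_small_iff[of M "e i" M "s j" n] assms(1)[OF i] assms(1)[OF j(1)] assms(2) by simp
qed

text \<open>
  Both in \<open>int poly\<close> and in \<open>int\<close> the least element is bound + 1 or close to a sum of endpoints, so
  only finitely many polynomials with small coefficients have to be compared.
\<close>

lemma least_above_eval:
  assumes small: "\<And>i. i \<in> {1..m} \<Longrightarrow> small M (s i) \<and> small M (e i)" "small M b"
    and n: "8 * M + 20 < n" and M: "1 \<le> M" and chain: "chain s e m"
    and least: "least_above (deg_le 1) (\<lambda>q. Q (rep_count s e m q)) b x"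
  shows "least_above UNIV (\<lambda>q. Q (rep_count (\<lambda>i. poly (s i) n) (\<lambda>i. poly (e i) n) m q))
    (poly b n) (poly x n)"
proof -
  have cand: "small (2 * M + 3) q" if "q = b + 1 \<or> near_sum s e m q" for q
    using that
  proof
    assume "q = b + 1"
    then show ?thesis using small_mono[OF small_add[OF small(2) small_1]] M by simp
  next
    assume "near_sum s e m q"
    then show ?thesis
    proof (cases rule: near_sumE)
      case (1 i j t)
      have "small (M + M + 3) (s i + s j + of_int t)" "small (M + M + 3) (e i + e j + of_int t)"
        by (intro small_add small_of_int conjunct1[OF small(1)] conjunct2[OF small(1)] 1)+
      with 1(4) show ?thesis unfolding mult_2 by blast
    qed
  qed
  have x: "small (2 * M + 3) x"
    using cand least_above_near_sum[OF least chain] least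
    by (auto simp: least_above_def deg_le_diff deg_le_1)
  have chain': "chain (\<lambda>i. poly (s i) n) (\<lambda>i. poly (e i) n) m"
    using chain_eval[OF small(1) _ chain] n M by simp
  define P where "P q = Q (rep_count (\<lambda>i. poly (s i) n) (\<lambda>i. poly (e i) n) m q)" for q
  have P: "P (poly q n) = Q (rep_count s e m q)" if "small (2 * M + 3) q" for q
    unfolding P_def using rep_count_eval[OF small(1) that n] by simp
  have less: "p < q \<longleftrightarrow> poly p n < poly q n" if "small (2 * M + 3) p" "small (2 * M + 3) q" for p q
    using less_small_iff[OF that, of n] n M by simp
  have b: "small (2 * M + 3) b" using small_mono[OF small(2)] M by simp
  \<comment> \<open>An arbitrary qualifying integer need not be the value of a small polynomial. The
    least one, \<open>q0\<close>, is: it equals the bound plus 1 or is close to a sum of endpoint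
    values. The polynomial behind it contradicts the choice of \<open>x\<close>.\<close>
  have "\<not> (poly b n < q \<and> q < poly x n \<and> P q)" for q
  proof
    assume *: "poly b n < q \<and> q < poly x n \<and> P q"
    define F where "F k \<longleftrightarrow> P (poly b n + int k) \<and> k \<noteq> 0" for k
    define q0 where "q0 = poly b n + int (Least F)"
    have "F (nat (q - poly b n))" using * by (simp add: F_def)
    then have "F (Least F)" by (rule LeastI)
    then have q0: "P q0" "poly b n < q0" by (auto simp: q0_def F_def)
    have le: "q0 \<le> q'" if "P q'" "poly b n < q'" for q'
    proof -
      have "F (nat (q' - poly b n))" using that by (simp add: F_def)
      then have "Least F \<le> nat (q' - poly b n)" by (rule Least_le)
      then show ?thesis using that(2) by (simp add: q0_def)
    qed
    have "least_above UNIV P (poly b n) q0"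
      using q0 le by (auto simp: least_above_def not_less[symmetric])
    from least_above_near_sum[OF this[unfolded P_def] chain'] obtain r
      where r: "r = b + 1 \<or> near_sum s e m r" "q0 = poly r n"
    proof (elim disjE meta_impE[OF _ UNIV_I])
      assume "q0 = poly b n + 1"
      then show thesis by (intro that[of "b + 1"]) auto
    next
      assume "near_sum (\<lambda>i. poly (s i) n) (\<lambda>i. poly (e i) n) m q0"
      then obtain i j t where ij: "i \<in> {1..m}" "j \<in> {1..m}" "\<bar>t\<bar> \<le> 3"
        "q0 = poly (s i + s j + of_int t) n \<or> q0 = poly (e i + e j + of_int t) n"
        by (elim near_sumE) (auto simp: of_int_poly)
      have "\<bar>of_int t\<bar> \<le> (3 :: int poly)"
        using ij(3) by (metis of_int_abs of_int_le_iff of_int_numeral)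
      then have "near_sum s e m (s i + s j + of_int t)" "near_sum s e m (e i + e j + of_int t)"
        unfolding near_sum_def using ij(1,2) by (metis add_diff_cancel_left')+
      with ij(4) show thesis using that by blast
    qed
    note sr = cand[OF r(1)]
    have "r \<in> deg_le 1" using small_deg_le[OF sr] .
    moreover have "b < r" using less[OF b sr] q0(2) r(2) by simp
    moreover have "r < x" using less[OF sr x] le[of q] * r(2) by auto
    moreover have "Q (rep_count s e m r)" using P[OF sr] q0(1) r(2) by simp
    ultimately show False using least by (auto simp: least_above_def)
  qed
  moreover have "poly b n < poly x n" "P (poly x n)"
    using least less[OF b x] P[OF x] by (auto simp: least_above_def)
  ultimately show ?thesis unfolding least_above_def P_def by blast
qed

section \<open>Ulam sequences of integers\<close>

lemma Least_int:
  fixes P :: "int \<Rightarrow> bool"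
  assumes "P q" "\<And>x. P x \<Longrightarrow> l < x"
  shows "P (Least P)" "\<And>x. P x \<Longrightarrow> Least P \<le> x"
proof -
  define F where "F k \<longleftrightarrow> P (l + int k)" for k
  have nat: "x = l + int (nat (x - l))" if "P x" for x using assms(2)[OF that] by simp
  have F: "F (nat (x - l))" if "P x" for x using nat[OF that] that by (simp add: F_def)
  have "F (Least F)" using F[OF assms(1)] by (rule LeastI)
  then have "P (l + int (Least F))" by (simp only: F_def)
  moreover have le: "l + int (Least F) \<le> x" if "P x" for x
    using Least_le[of F, OF F[OF that]] nat[OF that] by linarith
  ultimately have "Least P = l + int (Least F)" by (rule Least_equality)
  then show "P (Least P)" "\<And>x. P x \<Longrightarrow> Least P \<le> x"
    using \<open>P (l + int (Least F))\<close> le by auto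
qed

context
  fixes n :: int
  assumes n: "2 \<le> n"
begin

definition extends :: "nat \<Rightarrow> int \<Rightarrow> bool" where
  "extends m q \<longleftrightarrow> (\<forall>x \<in> ulam n ` {..<m}. x < q) \<and> unique_sum (ulam n ` {..<m}) q"

lemma ulam_0: "ulam n 0 = 1" by (simp add: ulam.simps)

lemma ulam_1: "ulam n (Suc 0) = n" by (simp add: ulam.simps[of n "Suc 0"])

lemma ulam_extends:
  assumes "2 \<le> m" and inc: "\<And>i. Suc i < m \<Longrightarrow> ulam n i < ulam n (Suc i)"
  shows "extends m (ulam n m)" "\<And>q. extends m q \<Longrightarrow> ulam n m \<le> q"
proof -
  have ulam: "ulam n m = Least (extends m)"
    using assms(1) unfolding extends_def by (subst ulam.simps) auto
  have mono: "ulam n i < ulam n j" if "i < j" "j < m" for i j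
    using that
  proof (induction j)
    case (Suc j)
    then show ?case using inc[of j] by (cases "i = j") auto
  qed simp
  obtain k where k: "m = Suc (Suc k)" using assms(1) by (metis add_2_eq_Suc le_Suc_ex)
  have le: "ulam n i \<le> ulam n j" if "i \<le> j" "j < m" for i j
    using mono[of i j] that by (cases "i = j") auto
  \<comment> \<open>The sum of the two largest terms exceeds the sum of any other two, so it has no
    second representation.\<close>
  define q where "q = ulam n k + ulam n (Suc k)"
  have pos: "0 < ulam n k" using le[of 0 k] ulam_0 k by simp
  have "\<forall>x \<in> ulam n ` {..<m}. x < q"
  proof
    fix x assume "x \<in> ulam n ` {..<m}"
    then have "x \<le> ulam n (Suc k)" using le[of _ "Suc k"] k by auto
    then show "x < q" using pos by (simp add: q_def)
  qed
  moreover have "unique_sum (ulam n ` {..<m}) q"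
    unfolding unique_sum_iff
  proof (rule ex1I[of _ "ulam n k"])
    show "ulam n k \<in> ulam n ` {..<m} \<and> q - ulam n k \<in> ulam n ` {..<m} \<and> 2 * ulam n k < q"
      using inc[of k] k by (auto simp: q_def)
  next
    fix x assume x: "x \<in> ulam n ` {..<m} \<and> q - x \<in> ulam n ` {..<m} \<and> 2 * x < q"
    then obtain i j where ij: "x = ulam n i" "q - x = ulam n j" "i < m" "j < m" by auto
    then have "i < j" using le[of j i] x by (cases i j rule: linorder_cases) auto
    have "j = Suc k"
    proof (rule ccontr)
      assume "j \<noteq> Suc k"
      then have "ulam n j \<le> ulam n k" "ulam n i < ulam n (Suc k)"
        using le[of j k] mono[of i "Suc k"] \<open>i < j\<close> ij k by auto
      then show False using ij by (simp add: q_def)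
    qed
    then show "x = ulam n k" using ij by (simp add: q_def)
  qed
  ultimately have "extends m q" by (simp add: extends_def)
  moreover have "1 < x" if "extends m x" for x
  proof -
    have "ulam n 0 \<in> ulam n ` {..<m}" using assms(1) by (intro imageI) simp
    with that show ?thesis unfolding extends_def ulam_0 by blast
  qed
  ultimately show "extends m (ulam n m)" "\<And>q. extends m q \<Longrightarrow> ulam n m \<le> q"
    unfolding ulam using Least_int[of "extends m" q 1] by blast+
qed

lemma ulam_less_Suc: "ulam n m < ulam n (Suc m)"
proof (induction m rule: less_induct)
  case (less m)
  show ?case
  proof (cases "m = 0")
    case True
    then show ?thesis using n ulam_0 ulam_1 by simp
  next
    case False
    then have "extends (Suc m) (ulam n (Suc m))"
      using less.IH by (intro ulam_extends) auto
    then show ?thesis by (auto simp: extends_def)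
  qed
qed

lemma strict_mono_ulam: "strict_mono (ulam n)"
  using ulam_less_Suc by (simp add: strict_mono_Suc_iff)

lemma ulam_set_ge_1: "x \<in> ulam_set n \<Longrightarrow> 1 \<le> x"
  using strict_mono_less_eq[OF strict_mono_ulam, of 0] ulam_0 by (auto simp: ulam_set_def)

lemma ulam_set_init:
  assumes "p \<le> n"
  shows "p \<in> ulam_set n \<longleftrightarrow> p = 1 \<or> p = n"
proof
  assume "p \<in> ulam_set n"
  then obtain m where m: "p = ulam n m" by (auto simp: ulam_set_def)
  then have "m \<le> 1" using assms strict_mono_less_eq[OF strict_mono_ulam, of m 1] ulam_1 by simp
  then show "p = 1 \<or> p = n" using m ulam_0 ulam_1 by (cases m) auto
next
  assume "p = 1 \<or> p = n"
  then show "p \<in> ulam_set n" unfolding ulam_set_def by (metis rangeI ulam_0 ulam_1)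
qed

text \<open>This turns membership into a condition on the terms below \<open>p\<close>, ready for
  strong induction on \<open>p\<close>. For the first index \<open>m\<close> whose term reaches
  \<open>p\<close>, those terms are exactly the ones of index below \<open>m\<close>; if
  \<open>p\<close> is a unique sum of them, it is a candidate for term \<open>m\<close>, which
  leaves no choice but equality.\<close>

lemma ulam_set_iff:
  assumes "n < p"
  shows "p \<in> ulam_set n \<longleftrightarrow> unique_sum (ulam_set n \<inter> {..<p}) p"
proof -
  have "int m \<le> ulam n m" for m
    by (induction m) (use ulam_less_Suc ulam_0 in \<open>auto simp: less_le_trans[OF _ zless_imp_add1_zle]
      intro: order_trans[OF _ zless_imp_add1_zle]\<close>)
  then have ex: "p \<le> ulam n (nat p)" using nat_0_le[of p] n assms by (metis order_trans[of 0 2 p] less_imp_le order_trans zero_le_numeral)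
  define m where "m = (LEAST m. p \<le> ulam n m)"
  have m: "p \<le> ulam n m" unfolding m_def using ex by (rule LeastI)
  have less: "ulam n i < p \<longleftrightarrow> i < m" for i
  proof
    assume "ulam n i < p"
    then show "i < m" using m strict_mono_less[OF strict_mono_ulam, of i m] by simp
  next
    assume "i < m"
    then show "ulam n i < p" using not_less_Least[of i "\<lambda>m. p \<le> ulam n m"] by (simp add: m_def)
  qed
  have m2: "2 \<le> m" using less[of 1] assms ulam_1 by simp
  have A: "ulam_set n \<inter> {..<p} = ulam n ` {..<m}"
    using less by (auto simp: ulam_set_def)
  have ext: "extends m (ulam n m)" "\<And>q. extends m q \<Longrightarrow> ulam n m \<le> q"
    using ulam_extends[OF m2] ulam_less_Suc by blast+
  show ?thesis
  proof
    assume "p \<in> ulam_set n"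
    then obtain i where i: "p = ulam n i" by (auto simp: ulam_set_def)
    then have "i = m" using m less[of i] strict_mono_less_eq[OF strict_mono_ulam, of m i] less[of m]
      by (metis less_irrefl linorder_less_linear order_le_less strict_mono_less strict_mono_ulam)
    then show "unique_sum (ulam_set n \<inter> {..<p}) p" using ext(1) A i by (simp add: extends_def)
  next
    assume "unique_sum (ulam_set n \<inter> {..<p}) p"
    then have "extends m p" using A less by (auto simp: extends_def)
    then have "p = ulam n m" using ext(2) m by force
    then show "p \<in> ulam_set n" by (auto simp: ulam_set_def)
  qed
qed

end

text \<open>Any intervals that obey the rule describe an initial segment, by strong induction on
  \<open>p\<close>: both sets agree below \<open>p\<close>, so the representations of
  \<open>p\<close> by elements of \<open>W\<close> decide. For \<open>p > n\<close> the summand 1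
  occurs iff \<open>p - 1\<close> is in \<open>W\<close>, that is, inside an interval past its first
  element or directly after an interval.\<close>

lemma ulam_set_intervals:
  fixes s e :: "nat \<Rightarrow> int"
  assumes n: "2 \<le> n" and s: "s 0 = 1" "e 0 = 1" "s 1 = n" "e 1 = 2 * n"
    and chain: "chain s e k"
    and start: "\<And>i. 1 \<le> i \<Longrightarrow> Suc i \<le> k \<Longrightarrow>
      least_above UNIV (\<lambda>q. rep_count s e i q = 1) (e i + 1) (s (Suc i))"
    and fin: "\<And>i. 1 \<le> i \<Longrightarrow> Suc i \<le> k \<Longrightarrow>
      least_above UNIV (\<lambda>q. 1 \<le> rep_count s (e(Suc i := s (Suc i))) (Suc i) q)
        (s (Suc i)) (e (Suc i) + 1)"
    and p: "1 \<le> p" "p \<le> e k" and k: "1 \<le> k"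
  shows "p \<in> ulam_set n \<longleftrightarrow> (\<exists>i \<le> k. p \<in> {s i..e i})"
  using p
proof (induction "nat p" arbitrary: p rule: less_induct)
  case less
  define W where "W = {x. \<exists>i \<le> k. x \<in> {s i..e i}}"
  have chain_i: "chain s e i" if "i \<le> k" for i using chain that by (auto simp: chain_def)
  have sk: "s i \<le> e i" if "i \<le> k" for i
    using chain that s by (cases i) (auto simp: chain_def)
  have es: "e i < s j" if "i < j" "1 \<le> i" "j \<le> k" for i j
    using chain that by (auto simp: chain_def)
  have s_ge: "n \<le> s i" if "1 \<le> i" "i \<le> k" for i
  proof (cases "i = 1")
    case False
    then show ?thesis using that es[of 1 i] s n by auto
  qed (use s in simp)
  have W_cases: "x = 1 \<or> n \<le> x" if "x \<in> W" for x
  proof -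
    from that obtain i where i: "i \<le> k" "x \<in> {s i..e i}" by (auto simp: W_def)
    then show ?thesis using s s_ge[of i] by (cases "i = 0") auto
  qed
  have W_below: "x = 1 \<or> x \<in> intervals s e i"
    if "x \<in> W" "x < s (Suc i)" "Suc i \<le> k" for x i
  proof -
    from that obtain j where j: "j \<le> k" "x \<in> {s j..e j}" by (auto simp: W_def)
    have "j \<le> i"
    proof (rule ccontr)
      assume "\<not> j \<le> i"
      then have "s (Suc i) \<le> s j"
        using es[of "Suc i" j] sk[of "Suc i"] j that by (cases "j = Suc i") auto
      then show False using that j by simp
    qed
    then show ?thesis using j s by (cases "j = 0") auto
  qed
  have inW: "x \<in> W" if "x \<in> intervals s e i" "i \<le> k" for x i
  proof -
    from that(1) obtain j where "j \<in> {1..i}" "x \<in> {s j..e j}" by blast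
    then show ?thesis using that(2) by (auto simp: W_def intro!: exI[of _ j])
  qed
  have 1: "1 \<in> W" using s unfolding W_def by auto
  show ?case
  proof (cases "p \<le> n")
    case True
    then have "p \<in> ulam_set n \<longleftrightarrow> p = 1 \<or> p = n" using ulam_set_init n by blast
    also have "\<dots> \<longleftrightarrow> p \<in> W"
    proof
      show "p \<in> W \<Longrightarrow> p = 1 \<or> p = n" using W_cases True by force
      show "p = 1 \<or> p = n \<Longrightarrow> p \<in> W" using s n k 1 by (auto simp: W_def intro: exI[of _ 1])
    qed
    finally show ?thesis by (simp add: W_def)
  next
    case False
    have IH: "x \<in> ulam_set n \<longleftrightarrow> x \<in> W" if "1 \<le> x" "x < p" for x
      using less.hyps[of x] that less.prems by (simp add: W_def)
    have W_ge: "1 \<le> x" if "x \<in> W" for x using W_cases[OF that] n by auto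
    have eq: "ulam_set n \<inter> {..<p} = W \<inter> {..<p}"
      using IH ulam_set_ge_1[OF n] W_ge by blast
    define rep where "rep x \<longleftrightarrow> x \<in> W \<and> p - x \<in> W \<and> 2 * x < p" for x
    have "p \<in> ulam_set n \<longleftrightarrow> unique_sum (ulam_set n \<inter> {..<p}) p"
      using ulam_set_iff[OF n] False by simp
    also have "\<dots> \<longleftrightarrow> (\<exists>!x. rep x)"
    proof -
      have "x \<in> W \<inter> {..<p} \<and> p - x \<in> W \<inter> {..<p} \<and> 2 * x < p \<longleftrightarrow> rep x" for x
        using W_ge[of x] W_ge[of "p - x"] by (auto simp: rep_def)
      then show ?thesis unfolding eq unique_sum_iff by simp
    qed
    finally have ulam: "p \<in> ulam_set n \<longleftrightarrow> (\<exists>!x. rep x)" .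
    \<comment> \<open>In this range \<open>p - 1\<close> is not in \<open>W\<close>, so the summand
      1 is impossible, and both summands are too small for the intervals after
      \<open>i\<close>.\<close>
    have rep_below: "rep x \<longleftrightarrow> x \<in> intervals s e i \<and> p - x \<in> intervals s e i \<and> 2 * x < p"
      if i: "Suc i \<le> k" "p \<le> s (Suc i)" "e i + 1 < p" "1 \<le> i" for x i
    proof
      assume x: "rep x"
      then have "x \<in> W" "p - x \<in> W" "2 * x < p" by (auto simp: rep_def)
      moreover have "x < s (Suc i)" "p - x < s (Suc i)"
        using W_ge[of x] W_ge[of "p - x"] calculation i by auto
      moreover have "x \<noteq> 1"
      proof
        assume "x = 1"
        then have "p - 1 \<in> intervals s e i"
          using W_below[of "p - 1" i] calculation i W_cases[of "p - 1"] False n by auto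
        then obtain j where "j \<in> {1..i}" "p - 1 \<le> e j" by auto
        moreover have "e j \<le> e i"
          using es[of j i] sk[of i] \<open>j \<in> {1..i}\<close> i by (cases "j = i") auto
        ultimately show False using i by simp
      qed
      moreover have "p - x \<noteq> 1" using W_ge[of x] calculation False n by auto
      ultimately show "x \<in> intervals s e i \<and> p - x \<in> intervals s e i \<and> 2 * x < p"
        using W_below i by blast
    next
      assume "x \<in> intervals s e i \<and> p - x \<in> intervals s e i \<and> 2 * x < p"
      then show "rep x" using inW[of _ i] i unfolding rep_def by (meson Suc_leD)
    qed
    define i where "i = Max {i \<in> {1..k}. s i \<le> p}"
    have fin_i: "finite {i \<in> {1..k}. s i \<le> p}" "{i \<in> {1..k}. s i \<le> p} \<noteq> {}"
      using k s False by (auto intro!: exI[of _ 1])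
    have i: "1 \<le> i" "i \<le> k" "s i \<le> p"
      using Max_in[OF fin_i] by (auto simp: i_def)
    have i_Suc: "p < s (Suc i)" if "Suc i \<le> k"
    proof (rule ccontr)
      assume "\<not> ?thesis"
      then have "Suc i \<in> {i \<in> {1..k}. s i \<le> p}" using that by simp
      from Max_ge[OF fin_i(1) this] show False by (simp add: i_def)
    qed
    have rep1: "rep 1 \<longleftrightarrow> p - 1 \<in> W" using 1 False n by (auto simp: rep_def)
    have e'_reps: "1 \<le> rep_count s (e(i := s i)) i q \<longleftrightarrow>
        (\<exists>x. x \<in> intervals s (e(i := s i)) i \<and> q - x \<in> intervals s (e(i := s i)) i \<and> 2 * x < q)" for q
      by (rule rep_count_ge_1_iff)
    have inW': "x \<in> W \<and> n \<le> x" if "x \<in> intervals s (e(i := s i)) i" for x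
    proof -
      from that obtain j where j: "j \<in> {1..i}" "s j \<le> x" "x \<le> (e(i := s i)) j" by auto
      then have "x \<le> e j" using sk[of j] i by (auto split: if_splits)
      then show ?thesis using j i s_ge[of j] by (auto simp: W_def intro!: exI[of _ j])
    qed
    show ?thesis
    proof (cases "p \<le> e i")
      case True
      have pW: "p \<in> W" using i True by (auto simp: W_def)
      have "\<exists>!x. rep x"
      proof (cases "p = s i")
        case True
        then obtain j where j: "i = Suc j" "1 \<le> j" using i False s by (cases i) (auto simp: Suc_le_eq)
        have st: "rep_count s e j p = 1" "e j + 1 < p"
          using start[of j] i j True by (auto simp: least_above_def)
        then have "unique_sum (intervals s e j) p"
          using rep_count_eq_1_iff[OF chain_i] i j by simp
        then show ?thesis
          unfolding unique_sum_iff using rep_below[of j] st j i True by simp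
      next
        case False': False
        have "p - 1 \<in> W" using i True False' unfolding W_def by (auto intro!: exI[of _ i])
        then have r1: "rep 1" using rep1 by simp
        moreover have "x = 1" if x: "rep x" for x
        proof (rule ccontr)
          assume "x \<noteq> 1"
          then have ge: "n \<le> x" "n \<le> p - x" "2 * x < p"
            using x W_cases[of x] W_cases[of "p - x"] n by (auto simp: rep_def)
          show False
          proof (cases "i = 1")
            case True
            then show ?thesis using ge \<open>p \<le> e i\<close> s by simp
          next
            case ne: False
            then obtain j where j: "i = Suc j" "1 \<le> j" using i by (cases i) auto
            have lst: "least_above UNIV (\<lambda>q. 1 \<le> rep_count s (e(i := s i)) i q) (s i) (e i + 1)"
              using fin[of j] j i by simp
            have none: "\<not> 1 \<le> rep_count s (e(i := s i)) i q" if "s i < q" "q < e i + 1" for q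
              using lst that unfolding least_above_def by blast
            have mem: "y \<in> intervals s (e(i := s i)) i" if "y \<in> W" "y \<noteq> 1" "y \<le> s i" for y
            proof (cases "y = s i")
              case True
              then show ?thesis using i by auto
            next
              case False
              then have "y \<in> intervals s e j" using W_below[of y j] that j i by auto
              then obtain l where "l \<in> {1..j}" "y \<in> {s l..e l}" by auto
              then show ?thesis using j by (intro UN_I[of l]) auto
            qed
            \<comment> \<open>\<open>n + s i\<close> is a representation without 1, so the interval
              ends before this sum. Two summands of \<open>p\<close>, both at least
              \<open>n\<close>, are then at most \<open>s i\<close>, and shrinking interval
              \<open>i\<close> to its first element loses neither.\<close>
            have "1 \<le> rep_count s (e(i := s i)) i (s i + n)"
              unfolding e'_reps
              using mem[of n] mem[of "s i"] i s ne es[of 1 i] n k inW[of n 1]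
              by (intro exI[of _ n]) (auto simp: W_def intro: exI[of _ 1])
            then have "e i + 1 \<le> s i + n"
              using none[of "s i + n"] n by fastforce
            then have "p - x \<le> s i" "x \<le> s i" using \<open>p \<le> e i\<close> ge by auto
            then have "1 \<le> rep_count s (e(i := s i)) i p"
              unfolding e'_reps using mem[of x] mem[of "p - x"] x ge n
              by (intro exI[of _ x]) (auto simp: rep_def)
            then show False
              using none[of p] \<open>p \<le> e i\<close> False' i by simp
          qed
        qed
        ultimately show ?thesis by blast
      qed
      then show ?thesis using ulam pW by (simp add: W_def)
    next
      case gt: False
      then have Suc_i: "Suc i \<le> k" using i less.prems by (cases "i = k") auto
      have pW: "p \<notin> W"
      proof
        assume "p \<in> W"
        then have "p \<in> intervals s e i" using W_below[of p i] i_Suc[OF Suc_i] Suc_i False n by auto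
        then obtain j where "j \<in> {1..i}" "p \<le> e j" by auto
        moreover have "e j \<le> e i"
          using es[of j i] sk[of i] \<open>j \<in> {1..i}\<close> i by (cases "j = i") auto
        ultimately show False using gt by simp
      qed
      have "\<not> (\<exists>!x. rep x)"
      proof (cases "p = e i + 1")
        case True
        have "p - 1 \<in> W" using True i sk[of i] by (auto simp: W_def)
        then have r1: "rep 1" using rep1 by simp
        have "\<exists>x. rep x \<and> x \<noteq> 1"
        proof (cases "i = 1")
          case True
          \<comment> \<open>For the first interval the second representation is
            \<open>2 * n + 1 = n + (n + 1)\<close>.\<close>
          then have "p - n \<in> W" "n \<in> W" using s n \<open>p = e i + 1\<close> k unfolding W_def
            by (auto intro!: exI[of _ 1])
          then show ?thesis using True s n \<open>p = e i + 1\<close> by (intro exI[of _ n]) (auto simp: rep_def)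
        next
          case False
          then obtain j where j: "i = Suc j" "1 \<le> j" using i by (cases i) auto
          have "1 \<le> rep_count s (e(i := s i)) i p"
            using fin[of j] j i True by (simp add: least_above_def)
          then obtain x where x: "x \<in> intervals s (e(i := s i)) i"
            "p - x \<in> intervals s (e(i := s i)) i" "2 * x < p" unfolding e'_reps by blast
          show ?thesis using inW'[OF x(1)] inW'[OF x(2)] x(3) n
            by (intro exI[of _ x]) (simp add: rep_def)
        qed
        with r1 show ?thesis by blast
      next
        case False
        then have gt1: "e i + 1 < p" using gt by simp
        have "rep_count s e i p \<noteq> 1"
          using start[OF i(1) Suc_i] gt1 i_Suc[OF Suc_i] by (auto simp: least_above_def)
        then have "\<not> unique_sum (intervals s e i) p"
          using rep_count_eq_1_iff[OF chain_i] i by simp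
        then show ?thesis
          unfolding unique_sum_iff using rep_below[OF Suc_i _ gt1 i(1)] i_Suc[OF Suc_i] by simp
      qed
      then show ?thesis using ulam pW by (simp add: W_def)
    qed
  qed
qed

section \<open>The coefficients of the Ulam sequence of polynomials\<close>

lemma discrete_less_iff: "x < y \<longleftrightarrow> x + 1 \<le> y" and discrete_le_iff: "x \<le> y \<longleftrightarrow> x < y + 1"
  for x y :: "'a::{linordered_idom, discrete_linordered_semidom}"
  by (rule less_iff_succ_less_eq less_eq_iff_succ_less)+

abbreviation (input) X :: "int poly" where "X \<equiv> [:0, 1:]"

lemma of_int_less_X: "of_int z < X"
  by (simp add: less_poly_def pos_poly_pCons of_int_poly)

text \<open>The solution of \<open>B (i + 1) = 4 * B i + 12\<close> with \<open>B 1 = 12\<close>.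
  The factor 4 is two doublings: a new lower endpoint is close to a sum of two earlier endpoints,
  and the upper one to a sum that may involve the new lower endpoint.\<close>

definition size_bound :: "nat \<Rightarrow> int" where
  "size_bound i = 4 ^ Suc i - 4"

lemma size_bound_mono: "i \<le> j \<Longrightarrow> size_bound i \<le> size_bound j"
  by (simp add: size_bound_def power_increasing)

lemma size_bound_Suc: "size_bound (Suc i) = 4 * size_bound i + 12"
  by (simp add: size_bound_def)

lemma size_bound_ge: "1 \<le> i \<Longrightarrow> 12 \<le> size_bound i"
  using size_bound_mono[of 1 i] by (simp add: size_bound_def)

locale poly_ulam =
  fixes U :: "int poly set" and a b c d :: "nat \<Rightarrow> int"
  assumes ulam: "poly_ulam_sequence 1 X U" and coefficients: "ulam_coefficients U a b c d"
begin

definition s :: "nat \<Rightarrow> int poly" where "s i = lin (a i) (b i)"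
definition e :: "nat \<Rightarrow> int poly" where "e i = lin (c i) (d i)"

lemma U_iff: "x \<in> U \<longleftrightarrow> (\<exists>i. x \<in> {s i..e i})"
  and s_le_e: "s i \<le> e i" and e_less_s_Suc: "e i + 1 < s (Suc i)"
  using coefficients by (auto simp: ulam_coefficients_def s_def e_def)

lemma e_less_s: "i < j \<Longrightarrow> e i + 1 < s j"
proof (induction j)
  case (Suc j)
  show ?case
  proof (cases "i = j")
    case False
    then have "e i + 1 < s j" using Suc by simp
    also have "s j \<le> e j" by (rule s_le_e)
    also have "e j < s (Suc j)" using e_less_s_Suc[of j] by (simp add: discrete_le_iff[symmetric] less_imp_le)
    finally show ?thesis .
  qed (simp add: e_less_s_Suc)
qed simp

lemma e_less_s': "i < j \<Longrightarrow> e i < s j"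
  using e_less_s[of i j] by (simp add: discrete_le_iff[symmetric] less_imp_le)

lemma s_mono: "i \<le> j \<Longrightarrow> s i \<le> s j"
  using e_less_s'[of i j] s_le_e[of i] by (cases "i = j") auto

lemma e_mono: "i \<le> j \<Longrightarrow> e i \<le> e j"
  using e_less_s'[of i j] s_le_e[of j] by (cases "i = j") auto

lemma chain: "chain s e n"
  using s_le_e e_less_s' by (auto simp: chain_def)

lemma U_init: "x \<le> X \<Longrightarrow> x \<in> U \<longleftrightarrow> x = 1 \<or> x = X"
  using ulam unfolding poly_ulam_sequence_def by blast

lemma U_deg_le: "x \<in> U \<Longrightarrow> x \<in> deg_le 1"
  using ulam unfolding poly_ulam_sequence_def by auto

lemma s_in_U: "s i \<in> U" and e_in_U: "e i \<in> U"
  using U_iff s_le_e by auto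

lemma s_deg_le: "s i \<in> deg_le 1" and e_deg_le: "e i \<in> deg_le 1"
  using U_deg_le s_in_U e_in_U by auto

lemma U_less_s: "x \<in> U \<Longrightarrow> x < s (Suc i) \<Longrightarrow> \<exists>j \<le> i. x \<in> {s j..e j}"
proof -
  assume x: "x \<in> U" "x < s (Suc i)"
  then obtain j where j: "x \<in> {s j..e j}" using U_iff by blast
  have "j \<le> i"
  proof (rule ccontr)
    assume "\<not> j \<le> i"
    then have "s (Suc i) \<le> s j" by (intro s_mono) simp
    with x(2) j show False by simp
  qed
  with j show ?thesis by blast
qed

lemma U_less_s_le_e: "x \<in> U \<Longrightarrow> x < s (Suc i) \<Longrightarrow> x \<le> e i"
  using U_less_s e_mono by (meson atLeastAtMost_iff order_trans)

lemma one_less_X: "1 < X" and two_less_X: "2 < X"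
  using of_int_less_X[of 1] of_int_less_X[of 2] by simp_all

lemma s_0: "s 0 = 1" and e_0: "e 0 = 1"
proof -
  have "1 \<in> U" using U_init one_less_X by auto
  then obtain i where "s i \<le> 1" using U_iff by auto
  then have le: "s 0 \<le> 1" using s_mono[of 0 i] by simp
  then show "s 0 = 1" using U_init[of "s 0"] s_in_U one_less_X by auto
  show "e 0 = 1"
  proof (rule ccontr)
    assume "e 0 \<noteq> 1"
    then have "1 + 1 \<le> e 0"
      using s_le_e[of 0] \<open>s 0 = 1\<close> by (simp only: discrete_less_iff[symmetric])
    then have "2 \<in> U" using U_iff \<open>s 0 = 1\<close> by (auto intro: exI[of _ 0])
    then show False using U_init[of 2] two_less_X by auto
  qed
qed

lemma s_1: "s 1 = X"
proof -
  have "X \<in> U" using U_init by simp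
  then obtain i where i: "s i \<le> X" "X \<le> e i" using U_iff by auto
  then have "i \<noteq> 0" using e_0 one_less_X by (metis leD)
  then have "s 1 \<le> X" using s_mono[of 1 i] i(1) by simp
  moreover have "1 < s 1" using e_less_s'[of 0 1] e_0 by simp
  ultimately show ?thesis using U_init[of "s 1"] s_in_U by auto
qed

lemma U_cases: "x \<in> U \<Longrightarrow> x = 1 \<or> X \<le> x"
proof -
  assume "x \<in> U"
  then obtain i where "x \<in> {s i..e i}" using U_iff by auto
  then show ?thesis using s_0 e_0 s_mono[of 1 i] s_1 by (cases "i = 0") auto
qed

lemma U_ge_1: "x \<in> U \<Longrightarrow> 1 \<le> x"
  using U_cases one_less_X by force

lemma X_le_s: "1 \<le> i \<Longrightarrow> X \<le> s i"
  using s_mono[of 1 i] s_1 by simp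

lemma U_minimum:
  assumes "p \<in> U" "X < p"
  shows "unique_sum U p"
    and "\<And>q. q \<in> deg_le 1 \<Longrightarrow> (\<And>x. x \<in> U \<Longrightarrow> x < p \<Longrightarrow> x < q) \<Longrightarrow> unique_sum U q \<Longrightarrow> p \<le> q"
proof -
  have "is_minimum {q \<in> deg_le (degree X). (\<forall>x \<in> U \<inter> {..<p}. x < q) \<and> unique_sum U q} p"
    using ulam assms unfolding poly_ulam_sequence_def by blast
  then show "unique_sum U p"
    "\<And>q. q \<in> deg_le 1 \<Longrightarrow> (\<And>x. x \<in> U \<Longrightarrow> x < p \<Longrightarrow> x < q) \<Longrightarrow> unique_sum U q \<Longrightarrow> p \<le> q"
    by (auto simp: is_minimum_def)
qed

text \<open>Such a \<open>q\<close> would be a smaller candidate than \<open>s (Suc i)\<close>, the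
  next term after \<open>e i\<close>.\<close>

lemma not_unique_sum_gap:
  assumes "1 \<le> i" "q \<in> deg_le 1" "e i < q" "q < s (Suc i)"
  shows "\<not> unique_sum U q"
proof
  assume "unique_sum U q"
  moreover have "X < s (Suc i)"
    using e_less_s'[of i "Suc i"] X_le_s[OF assms(1)] s_le_e[of i] by simp
  ultimately have "s (Suc i) \<le> q"
    using U_minimum(2)[OF s_in_U, of "Suc i" q] assms U_less_s_le_e by force
  with assms(4) show False by simp
qed

definition rep :: "int poly \<Rightarrow> int poly \<Rightarrow> bool" where
  "rep q x \<longleftrightarrow> x \<in> U \<and> q - x \<in> U \<and> 2 * x < q"

lemma unique_sum_rep: "unique_sum U q \<longleftrightarrow> (\<exists>!x. rep q x)"
  by (simp add: unique_sum_iff rep_def)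

lemma rep_1: "q - 1 \<in> U \<Longrightarrow> X < q \<Longrightarrow> rep q 1"
  using U_init one_less_X two_less_X by (auto simp: rep_def)

text \<open>\<open>2X + 1\<close> is both \<open>1 + 2X\<close> and \<open>X + (X + 1)\<close>, so
  the interval does not extend past \<open>2X\<close>. It does not stop earlier either:
  \<open>e 1 + 1\<close> needs a second representation besides \<open>1 + e 1\<close>, and then both
  summands are at least \<open>X\<close>.\<close>

lemma e_1: "e 1 = 2 * X"
proof (rule antisym)
  have U1: "x \<in> U" if "X \<le> x" "x \<le> e 1" for x
    using that U_iff s_1 by (auto intro: exI[of _ 1])
  show "e 1 \<le> 2 * X"
  proof (rule ccontr)
    define Y where "Y = X"
    assume "\<not> e 1 \<le> 2 * X"
    then have le: "2 * Y + 1 \<le> e 1" unfolding Y_def by (simp only: not_le discrete_less_iff)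
    have Y: "1 < Y" using one_less_X by (simp only: Y_def)
    note U1 = U1[folded Y_def] and rep_1 = rep_1[folded Y_def] and min = U_minimum(1)[folded Y_def]
    have "unique_sum U (2 * Y + 1)" using Y le by (intro min U1) auto
    moreover have "rep (2 * Y + 1) 1" using Y le by (intro rep_1 U1) auto
    moreover have "rep (2 * Y + 1) Y" using Y le unfolding rep_def by (intro conjI U1) auto
    ultimately show False using Y by (auto simp: unique_sum_rep)
  qed
  have X: "X \<le> e 1" using s_le_e[of 1] s_1 by simp
  have "\<not> unique_sum U (e 1 + 1)"
    using e_less_s_Suc[of 1] e_deg_le by (intro not_unique_sum_gap[of 1]) (auto intro: deg_le_add deg_le_1)
  moreover have "rep (e 1 + 1) 1" using X e_in_U[of 1] by (intro rep_1) (simp_all add: discrete_le_iff[symmetric])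
  ultimately obtain x where "rep (e 1 + 1) x" "x \<noteq> 1" unfolding unique_sum_rep by blast
  then have x: "X \<le> x" "2 * x \<le> e 1" using U_cases[of x] by (auto simp: rep_def discrete_le_iff)
  have "2 * X \<le> 2 * x" using x(1) by (intro mult_left_mono) simp_all
  with x(2) show "2 * X \<le> e 1" by simp
qed

text \<open>For \<open>q\<close> beyond \<open>e i + 1\<close> and up to the next term,
  \<open>q - 1\<close> lies in the gap, which excludes the summand 1, and summands are smaller than
  \<open>s (Suc i)\<close>. So counting over the intervals 1 to \<open>i\<close> sees every
  representation in \<open>U\<close>.\<close>

lemma start:
  assumes i: "1 \<le> i"
  shows "least_above (deg_le 1) (\<lambda>q. rep_count s e i q = 1) (e i + 1) (s (Suc i))"
proof -
  have iff: "rep_count s e i q = 1 \<longleftrightarrow> unique_sum U q" if q: "e i + 1 < q" "q \<le> s (Suc i)" for q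
  proof -
    have "rep q x \<longleftrightarrow> x \<in> intervals s e i \<and> q - x \<in> intervals s e i \<and> 2 * x < q" for x
    proof
      assume x: "rep q x"
      have "q - 1 < q" by simp
      have lt: "x < s (Suc i)" "q - x < s (Suc i)"
        using x q U_ge_1[of x] U_ge_1[of "q - x"] unfolding rep_def by auto
      have "x \<noteq> 1"
      proof
        assume "x = 1"
        then have "q - 1 \<le> e i" using x lt U_less_s_le_e unfolding rep_def by blast
        with q show False by (simp add: diff_le_eq)
      qed
      moreover have "q - x \<noteq> 1" using x U_ge_1[of x] unfolding rep_def by auto
      moreover have "y \<in> intervals s e i" if y: "y \<in> U" "y < s (Suc i)" "y \<noteq> 1" for y
      proof -
        obtain j where j: "j \<le> i" "y \<in> {s j..e j}" using U_less_s y by blast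
        then have "j \<noteq> 0" using y(3) s_0 e_0 by (auto intro: ccontr)
        with j show ?thesis by (intro UN_I[of j]) auto
      qed
      ultimately show "x \<in> intervals s e i \<and> q - x \<in> intervals s e i \<and> 2 * x < q"
        using x lt by (auto simp: rep_def)
    next
      assume "x \<in> intervals s e i \<and> q - x \<in> intervals s e i \<and> 2 * x < q"
      then show "rep q x" using U_iff unfolding rep_def by blast
    qed
    then have "rep q = (\<lambda>x. x \<in> intervals s e i \<and> q - x \<in> intervals s e i \<and> 2 * x < q)"
      by (rule ext)
    then show ?thesis
      unfolding rep_count_eq_1_iff[OF chain] unique_sum_rep unique_sum_iff[of "intervals s e i"]
      by (simp only:)
  qed
  have e1: "e i < e i + 1" by simp
  have "rep_count s e i (s (Suc i)) = 1"
    unfolding iff[OF e_less_s_Suc order_refl]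
    by (rule U_minimum(1)[OF s_in_U])
      (use e_less_s'[of i "Suc i"] X_le_s[OF i] s_le_e[of i] in simp)
  moreover have "rep_count s e i q \<noteq> 1" if "q \<in> deg_le 1" "e i + 1 < q" "q < s (Suc i)" for q
    using iff[of q] that not_unique_sum_gap[OF i that(1)] less_trans[OF e1] by simp
  ultimately show ?thesis
    using e_less_s_Suc s_deg_le by (simp add: least_above_def)
qed

text \<open>Elements of the interval past \<open>s i\<close> are 1 plus their predecessor, so they
  admit no other representation, whereas \<open>e i + 1\<close>, not being a term, must have one.
  The interval is shorter than \<open>X\<close> because \<open>s i + X\<close> has a representation
  without 1; for \<open>i = 1\<close> this fails, as the summands of \<open>X + X\<close>
  coincide.\<close>

lemma finish:
  assumes i: "2 \<le> i"
  shows "least_above (deg_le 1) (\<lambda>q. 1 \<le> rep_count s (e(i := s i)) i q) (s i) (e i + 1)"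
proof -
  define e' where "e' = e(i := s i)"
  have s: "X < s i" using e_less_s'[of 1 i] i s_le_e[of 1] s_1 by simp
  have W_U: "x \<in> U \<and> X \<le> x" if "x \<in> intervals s e' i" for x
  proof -
    from that obtain j where j: "j \<in> {1..i}" "s j \<le> x" "x \<le> e' j" by auto
    then have "x \<le> e j" using s_le_e[of j] by (auto simp: e'_def split: if_splits)
    then show ?thesis using U_iff j X_le_s[of j] by auto
  qed
  have U_W: "x \<in> intervals s e' i" if x: "x \<in> U" "X \<le> x" "x \<le> s i" for x
  proof (cases "x = s i")
    case True
    then show ?thesis using i by (intro UN_I[of i]) (auto simp: e'_def)
  next
    case False
    obtain i' where i': "i = Suc i'" using i by (cases i) auto
    obtain j where j: "j \<le> i'" "x \<in> {s j..e j}"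
      using U_less_s[of x i'] x False i' by auto
    then have "j \<noteq> 0" using x(2) e_0 one_less_X by (metis atLeastAtMost_iff leD order_trans)
    with j i' show ?thesis by (intro UN_I[of j]) (auto simp: e'_def)
  qed
  have no: "\<not> 1 \<le> rep_count s e' i q" if q: "s i < q" "q \<le> e i" for q
  proof
    assume "1 \<le> rep_count s e' i q"
    then obtain x where x: "x \<in> intervals s e' i" "q - x \<in> intervals s e' i" "2 * x < q"
      unfolding rep_count_ge_1_iff by blast
    have "q \<in> U" using q U_iff by (metis atLeastAtMost_iff less_imp_le)
    have "s i \<le> q - 1" using q by (simp only: discrete_less_iff le_diff_eq)
    moreover have "q - 1 \<le> q" by simp
    ultimately have "q - 1 \<in> U" using q U_iff by (meson atLeastAtMost_iff order_trans)
    then have "rep q 1" using s q by (intro rep_1) auto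
    moreover have "rep q x" using W_U x by (auto simp: rep_def)
    moreover have "unique_sum U q" using U_minimum(1)[OF \<open>q \<in> U\<close>] s q by auto
    ultimately have "x = 1" unfolding unique_sum_rep by blast
    then show False using W_U[OF x(1)] one_less_X by auto
  qed
  have "1 \<le> rep_count s e' i (s i + X)"
    unfolding rep_count_ge_1_iff
  proof (intro exI[of _ X] conjI)
    show "X \<in> intervals s e' i" "s i + X - X \<in> intervals s e' i"
      using U_W[of X] U_W[of "s i"] s s_in_U[of i] s_in_U[of 1] unfolding s_1 by simp_all
    show "2 * X < s i + X" using s unfolding mult_2 by (rule add_strict_right_mono)
  qed
  then have less: "e i < s i + X"
    using no[of "s i + X"] one_less_X by (meson less_add_same_cancel1 less_trans not_le zero_less_one)
  have "\<not> unique_sum U (e i + 1)"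
    using e_less_s_Suc[of i] e_deg_le i
    by (intro not_unique_sum_gap[of i]) (auto intro: deg_le_add deg_le_1)
  moreover have "rep (e i + 1) 1"
    using e_in_U[of i] s s_le_e[of i] by (intro rep_1) (auto simp: discrete_le_iff[symmetric])
  ultimately obtain x where x: "rep (e i + 1) x" "x \<noteq> 1" unfolding unique_sum_rep by blast
  have Xx: "X \<le> x" using U_cases[of x] x by (simp add: rep_def)
  have x2: "2 * x < e i + 1" "x \<in> U" "e i + 1 - x \<in> U" using x by (auto simp: rep_def)
  have "x < e i + 1 - x" using x2(1) by simp
  moreover have "e i + 1 - x \<le> s i"
  proof -
    have "e i + 1 \<le> s i + X" using less by (simp only: discrete_less_iff)
    also have "\<dots> \<le> s i + x" using Xx by simp
    finally show ?thesis by (simp only: diff_le_eq)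
  qed
  ultimately have "x \<in> intervals s e' i" "e i + 1 - x \<in> intervals s e' i"
    using U_W x2 Xx by auto
  then have "1 \<le> rep_count s e' i (e i + 1)"
    unfolding rep_count_ge_1_iff using x2(1) by blast
  moreover have "s i < e i + 1" using s_le_e by (simp only: discrete_le_iff)
  moreover have "e i + 1 \<in> deg_le 1" using deg_le_add[OF e_deg_le deg_le_1] .
  ultimately show ?thesis
    using no unfolding least_above_def e'_def by (simp add: discrete_le_iff)
qed

lemma chain_single: "chain s (e(i := s i)) i"
  using s_le_e e_less_s' by (auto simp: chain_def)

text \<open>
  The lower bounds at 4 keep the later intervals from falling behind the first ones when a fixed
  large integer is substituted for \<open>X\<close>.
\<close>

definition tame :: "int \<Rightarrow> int poly \<Rightarrow> bool" where
  "tame M p \<longleftrightarrow> small M p \<and> 4 \<le> poly p 4"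

text \<open>Since \<open>4 + 4 - 3 = 5\<close>, there is one unit to spare for the passage from
  \<open>e i + 1\<close> to \<open>e i\<close>.\<close>

lemma tame_sum: "tame M p \<Longrightarrow> tame M q \<Longrightarrow> \<bar>t\<bar> \<le> 3 \<Longrightarrow>
    small (2 * M + 3) (p + q + of_int t) \<and> 5 \<le> poly (p + q + of_int t) 4"
  using small_add[OF small_add small_of_int, of M p M q t 3]
  by (auto simp: tame_def of_int_poly)

lemma tame_near_sum:
  assumes "near_sum s' e' m q" "\<And>j. j \<in> {1..m} \<Longrightarrow> tame M (s' j) \<and> tame M (e' j)"
  shows "small (2 * M + 3) q \<and> 5 \<le> poly q 4"
  using assms(1)
proof (cases rule: near_sumE)
  case (1 i j t)
  then show ?thesis using tame_sum[of M _ _ t] assms(2)[OF 1(1)] assms(2)[OF 1(2)] by auto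
qed

lemma tame_s_e: "1 \<le> i \<Longrightarrow> tame (size_bound i) (s i) \<and> tame (size_bound i) (e i)"
proof (induction i rule: less_induct)
  case (less i)
  show ?case
  proof (cases "i = 1")
    case True
    have "small 12 X" "small 12 (2 * X)"
      by (auto simp: small_def coeff_pCons numeral_poly split: nat.splits)
    then show ?thesis using True s_1 e_1 by (auto simp: tame_def size_bound_def)
  next
    case False
    then obtain m where m: "i = Suc m" "1 \<le> m" using less.prems by (cases i) auto
    define M where "M = size_bound m"
    have M: "12 \<le> M" using size_bound_ge m by (simp add: M_def)
    have mono: "tame M' p \<Longrightarrow> M' \<le> M'' \<Longrightarrow> tame M'' p" for M' M'' p
      using small_mono by (auto simp: tame_def)
    have IH: "tame M (s j) \<and> tame M (e j)" if "j \<in> {1..m}" for j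
      using less.IH[of j] m that size_bound_mono[of j m] mono by (auto simp: M_def)
    have "s i = e m + 1 + 1 \<or> near_sum s e m (s i)"
      using least_above_near_sum[OF start[OF m(2)] chain deg_le_diff[OF s_deg_le deg_le_1]] m by simp
    then have s: "tame (2 * M + 3) (s i)"
    proof
      assume "s i = e m + 1 + 1"
      moreover have "small M (e m)" "4 \<le> poly (e m) 4" using IH[of m] m by (auto simp: tame_def)
      moreover have "small (M + 1 + 1) (e m + 1 + 1)" by (intro small_add small_1 calculation)
      ultimately show ?thesis using M small_mono[of "M + 1 + 1" _ "2 * M + 3"] by (simp add: tame_def)
    next
      assume "near_sum s e m (s i)"
      from tame_near_sum[OF this IH] show ?thesis by (simp add: tame_def)
    qed
    define M' where "M' = 2 * M + 3"
    have IH': "tame M' (s j) \<and> tame M' ((e(i := s i)) j)" if "j \<in> {1..i}" for j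
      using s IH[of j] mono[of M _ M'] M m that by (cases "j = i") (auto simp: M'_def)
    have "i \<ge> 2" using m by simp
    have "e i + 1 = s i + 1 \<or> near_sum s (e(i := s i)) i (e i + 1)"
      by (rule least_above_near_sum[OF finish[OF \<open>i \<ge> 2\<close>] chain_single]) (use e_deg_le in simp)
    then have "tame (2 * M' + 4) (e i)"
    proof
      assume "e i + 1 = s i + 1"
      then show ?thesis using s mono[of M' "s i" "2 * M' + 4"] M by (simp add: M'_def)
    next
      assume "near_sum s (e(i := s i)) i (e i + 1)"
      from tame_near_sum[OF this IH'] have "small (2 * M' + 3) (e i + 1)" "5 \<le> poly (e i + 1) 4"
        by auto
      then show ?thesis
        using small_diff[OF _ small_1, of "2 * M' + 3" "e i + 1"]
        by (simp add: tame_def add.commute)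
    qed
    moreover have "size_bound i = 4 * M + 12" using m by (simp add: M_def size_bound_Suc)
    ultimately show ?thesis
      using s mono[of _ _ "size_bound i"] M by (auto simp: M'_def)
  qed
qed

lemma small_s: "1 \<le> i \<Longrightarrow> i \<le> k \<Longrightarrow> small (size_bound k) (s i)"
  and small_e: "1 \<le> i \<Longrightarrow> i \<le> k \<Longrightarrow> small (size_bound k) (e i)"
  using tame_s_e[of i] size_bound_mono[of i k] small_mono by (auto simp: tame_def)

section \<open>Values of the endpoints at a large integer\<close>

definition sv :: "int \<Rightarrow> nat \<Rightarrow> int" where "sv n i = poly (s i) n"
definition ev :: "int \<Rightarrow> nat \<Rightarrow> int" where "ev n i = poly (e i) n"

lemma sv_fun: "sv n = (\<lambda>i. poly (s i) n)" and ev_fun: "ev n = (\<lambda>i. poly (e i) n)"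
  by (auto simp: sv_def ev_def)

lemma sv_eq: "sv n i = a i * n + b i" and ev_eq: "ev n i = c i * n + d i"
  by (simp_all add: sv_def ev_def s_def e_def lin_def mult.commute)

lemma sv_0: "sv n 0 = 1" and ev_0: "ev n 0 = 1" and sv_1: "sv n 1 = n" and ev_1: "ev n 1 = 2 * n"
  using s_0 e_0 s_1 e_1 by (simp_all add: sv_def ev_def)

context
  fixes k :: nat and n :: int
  assumes k: "1 \<le> k" and n: "8 * size_bound k + 20 < n"
begin

lemma chain_values: "i \<le> k \<Longrightarrow> chain (sv n) (ev n) i"
  unfolding sv_def ev_def
  using n small_s[of _ k] small_e[of _ k] size_bound_ge[OF k]
  by (intro chain_eval[OF _ _ chain, where M = "size_bound k"]) auto

lemma start_values:
  assumes "1 \<le> i" "Suc i \<le> k"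
  shows "least_above UNIV (\<lambda>q. rep_count (sv n) (ev n) i q = 1) (ev n i + 1) (sv n (Suc i))"
proof -
  have "size_bound i + 1 \<le> size_bound k"
    using size_bound_mono[OF assms(2)] size_bound_ge[OF assms(1)] by (simp add: size_bound_Suc)
  then have "small (size_bound k) (e i + 1)"
    using small_mono[OF small_add[OF small_e[of i i] small_1]] assms by simp
  from least_above_eval[OF _ this n _ chain start[OF assms(1)]]
  show ?thesis
    using small_s[of _ k] small_e[of _ k] assms size_bound_ge[OF k]
    by (simp add: sv_fun ev_fun)
qed

lemma finish_values:
  assumes "2 \<le> i" "i \<le> k"
  shows "least_above UNIV (\<lambda>q. 1 \<le> rep_count (sv n) ((ev n)(i := sv n i)) i q)
    (sv n i) (ev n i + 1)"
proof -
  have eq: "(\<lambda>j. poly ((e(i := s i)) j) n) = (\<lambda>j. poly (e j) n)(i := poly (s i) n)"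
    by auto
  have "small (size_bound k) (s i)" using small_s[of i k] assms by simp
  moreover have "small (size_bound k) (s j) \<and> small (size_bound k) ((e(i := s i)) j)"
    if "j \<in> {1..i}" for j
    using small_s[of j k] small_e[of j k] assms that by auto
  moreover have "1 \<le> size_bound k" using size_bound_ge[OF k] by simp
  ultimately show ?thesis
    using least_above_eval[OF _ _ n _ chain_single finish[OF assms(1)]]
    unfolding sv_fun ev_fun eq by simp
qed

lemma ulam_set_values:
  assumes "1 \<le> p" "p \<le> ev n k"
  shows "p \<in> ulam_set n \<longleftrightarrow> (\<exists>i \<le> k. p \<in> {sv n i..ev n i})"
proof -
  have "12 \<le> size_bound k" by (rule size_bound_ge[OF k])
  then have "2 \<le> n" using n by simp
  then show ?thesis
    using assms k
    by (intro ulam_set_intervals chain_values start_values finish_values sv_0 ev_0 sv_1 ev_1) auto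
qed

text \<open>Here \<open>i\<close> is unbounded while \<open>n\<close> is fixed, so
  \<open>s i\<close> may have large coefficients. From the value at 4 follows
  \<open>a i * n + b i \<ge> a i * (n - 4) + 4\<close>, and with \<open>a i \<ge> c k + 1\<close>
  this exceeds \<open>c k * n + d k\<close>.\<close>

lemma ev_less_sv:
  assumes "k < i"
  shows "ev n k < sv n i"
proof -
  have "12 \<le> size_bound k" by (rule size_bound_ge[OF k])
  have "e k < s i" using e_less_s'[OF assms] .
  then have ac: "c k < a i \<or> c k = a i \<and> d k < b i"
    by (auto simp: s_def e_def lin_def less_poly_def pos_poly_pCons)
  have "coeff (e k) 1 = c k" "coeff (e k) 0 = d k" by (simp_all add: e_def lin_def)
  then have cd: "\<bar>c k\<bar> \<le> size_bound k" "\<bar>d k\<bar> \<le> size_bound k"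
    using small_e[of k k] k unfolding small_def by (metis order_refl)+
  have "4 \<le> poly (s i) 4" using tame_s_e[of i] assms by (simp add: tame_def)
  then have b: "4 \<le> b i + 4 * a i" by (simp add: s_def lin_def)
  from ac show ?thesis
  proof
    assume "c k < a i"
    then have "(c k + 1) * (n - 4) \<le> a i * (n - 4)"
      using n \<open>12 \<le> size_bound k\<close> by (intro mult_right_mono) auto
    then show ?thesis
      using b cd n \<open>12 \<le> size_bound k\<close> by (simp add: sv_eq ev_eq algebra_simps)
  qed (simp add: sv_eq ev_eq)
qed

end

lemma ulam_set_initial_segment:
  assumes n: "8 * size_bound (max 1 k) + 20 < n"
  shows "ulam_set n \<inter> {1..c k * n + d k} =
    (\<Union>i. {a i * n + b i..c i * n + d i}) \<inter> {1..c k * n + d k}"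
proof -
  \<comment> \<open>The rule starts from the interval \<open>[X, 2X]\<close>, so
    \<open>k = 0\<close> is read off from the segment for index 1.\<close>
  define K where "K = max 1 k"
  have K: "1 \<le> K" "k \<le> K" by (auto simp: K_def)
  note nK = n[folded K_def]
  have 12: "12 \<le> size_bound K" by (rule size_bound_ge[OF K(1)])
  have "ev n k \<le> ev n K"
    using nK 12 chain_values[OF K(1) nK, of K] ev_0 ev_1 K(2)
    by (cases "k = 0") (auto simp: K_def max_def ev_1[simplified])
  then have "p \<in> ulam_set n \<longleftrightarrow> (\<exists>i. p \<in> {sv n i..ev n i})" if "1 \<le> p" "p \<le> ev n k" for p
    using ulam_set_values[OF K(1) nK, of p] ev_less_sv[OF K(1) nK] that
    by (metis atLeastAtMost_iff leD le_less_trans not_le order_trans)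
  then show ?thesis unfolding sv_eq ev_eq by auto
qed

end

section \<open>Verification of structured programs\<close>

text \<open>Being existential, this includes termination, with every loop staying within
  \<open>m\<close> iterations.\<close>

definition wp :: "nat \<Rightarrow> com \<Rightarrow> (state \<Rightarrow> bool) \<Rightarrow> state \<Rightarrow> bool" where
  "wp m c Q s \<longleftrightarrow> (\<exists>s'. run m c s s' \<and> Q s')"

lemma wp_simps [simp]:
  "wp m (Ins (Const i z)) Q (R, ys) \<longleftrightarrow> Q (R(i := z), ys)"
  "wp m (Ins (Add i j k)) Q (R, ys) \<longleftrightarrow> Q (R(i := R j + R k), ys)"
  "wp m (Ins (Sub i j k)) Q (R, ys) \<longleftrightarrow> Q (R(i := R j - R k), ys)"
  "wp m (Ins (Load i j)) Q (R, ys) \<longleftrightarrow> 0 \<le> R j \<and> Q (R(i := R (nat (R j))), ys)"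
  "wp m (Ins (Store i j)) Q (R, ys) \<longleftrightarrow> 0 \<le> R i \<and> Q (R(nat (R i) := R j), ys)"
  "wp m (Ins (Print j)) Q (R, ys) \<longleftrightarrow> Q (R, ys @ [R j])"
  "wp m (c1 ;; c2) Q s \<longleftrightarrow> wp m c1 (wp m c2 Q) s"
  "wp m (Unless r c) Q (R, ys) \<longleftrightarrow> (if R r > 0 then Q (R, ys) else wp m c Q (R, ys))"
  by (auto simp: wp_def)

lemma wp_mono: "wp m c Q s \<Longrightarrow> (\<And>s'. Q s' \<Longrightarrow> Q' s') \<Longrightarrow> wp m c Q' s"
  unfolding wp_def by blast

text \<open>A syntactic frame condition. \<open>Store\<close> counts as changing every register
  because its target is only known at run time.\<close>

fun keeps :: "com \<Rightarrow> nat \<Rightarrow> bool" where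
  "keeps (Ins (Const i z)) r = (r \<noteq> i)"
| "keeps (Ins (Add i j k)) r = (r \<noteq> i)"
| "keeps (Ins (Sub i j k)) r = (r \<noteq> i)"
| "keeps (Ins (Load i j)) r = (r \<noteq> i)"
| "keeps (Ins (Store i j)) r = False"
| "keeps (Ins _) r = True"
| "keeps (c1 ;; c2) r = (keeps c1 r \<and> keeps c2 r)"
| "keeps (Unless _ c) r = keeps c r"
| "keeps (Repeat c _) r = keeps c r"

lemma keeps_run: "run m c s s' \<Longrightarrow> keeps c r \<Longrightarrow> fst s' r = fst s r"
proof (induction c arbitrary: s s')
  case (Ins i)
  then show ?case by (cases s; cases i) (auto split: if_splits)
next
  case (Repeat c x)
  then obtain n \<sigma> where \<sigma>: "\<sigma> 0 = s" "\<sigma> n = s'" "\<And>i. i < n \<Longrightarrow> run m c (\<sigma> i) (\<sigma> (Suc i))"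
    by auto
  have "i \<le> n \<Longrightarrow> fst (\<sigma> i) r = fst s r" for i
  proof (induction i)
    case (Suc i)
    then have "fst (\<sigma> (Suc i)) r = fst (\<sigma> i) r"
      using Repeat.IH[OF \<sigma>(3)[of i]] Repeat.prems(2) by simp
    with Suc show ?case by simp
  qed (use \<sigma> in simp)
  from this[of n] \<sigma>(2) show ?case by simp
qed (auto split: if_splits, metis)

lemma wp_keeps:
  assumes "wp m c Q (R, ys)"
    and "\<And>R' ys'. Q (R', ys') \<Longrightarrow> (\<And>r. keeps c r \<Longrightarrow> R' r = R r) \<Longrightarrow> Q' (R', ys')"
  shows "wp m c Q' (R, ys)"
proof -
  from assms(1) obtain R' ys' where "run m c (R, ys) (R', ys')" "Q (R', ys')"
    by (auto simp: wp_def)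
  with keeps_run[OF this(1)] assms(2) show ?thesis by (fastforce simp: wp_def)
qed

lemma wp_Repeat:
  assumes n: "1 \<le> n" "n \<le> m" and "I 0 s"
    and body: "\<And>i s. i < n \<Longrightarrow> I i s \<Longrightarrow> wp m c (\<lambda>s'. I (Suc i) s' \<and> (fst s' r > 0 \<longleftrightarrow> Suc i < n)) s"
    and "\<And>s. I n s \<Longrightarrow> Q s"
  shows "wp m (Repeat c r) Q s"
proof -
  have "\<exists>\<sigma>. \<sigma> 0 = s \<and> (\<forall>i. i < n \<longrightarrow> run m c (\<sigma> i) (\<sigma> (Suc i)) \<and> I (Suc i) (\<sigma> (Suc i)) \<and>
      (fst (\<sigma> (Suc i)) r > 0 \<longleftrightarrow> Suc i < n))"
  proof -
    define step where "step i t = (SOME t'. run m c t t' \<and> I (Suc i) t' \<and> (fst t' r > 0 \<longleftrightarrow> Suc i < n))"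
      for i t
    define \<sigma> where "\<sigma> = rec_nat s step"
    have step: "run m c t (step i t) \<and> I (Suc i) (step i t) \<and> (fst (step i t) r > 0 \<longleftrightarrow> Suc i < n)"
      if "i < n" "I i t" for i t
      using someI_ex[OF body[OF that, unfolded wp_def]] unfolding step_def .
    have I: "i \<le> n \<Longrightarrow> I i (\<sigma> i)" for i
      by (induction i) (use assms(3) step in \<open>auto simp: \<sigma>_def\<close>)
    show ?thesis
      by (intro exI[of _ \<sigma>]) (use I step in \<open>auto simp: \<sigma>_def\<close>)
  qed
  then obtain \<sigma> where \<sigma>: "\<sigma> 0 = s" "\<And>i. i < n \<Longrightarrow> run m c (\<sigma> i) (\<sigma> (Suc i)) \<and> I (Suc i) (\<sigma> (Suc i)) \<and>
      (fst (\<sigma> (Suc i)) r > 0 \<longleftrightarrow> Suc i < n)" by blast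
  then have "run m (Repeat c r) s (\<sigma> n)" using n by auto
  moreover have "Q (\<sigma> n)" using \<sigma>(2)[of "n - 1"] n assms(5) by simp
  ultimately show ?thesis unfolding wp_def by blast
qed

text \<open>Throughout, register 1 holds the constant 1, register 3 holds 0 and register 2 is scratch.\<close>

definition Loop :: "nat \<Rightarrow> com \<Rightarrow> com" where
  "Loop r c = Repeat (c ;; Ins (Sub r r 1)) r"

definition Move :: "nat \<Rightarrow> nat \<Rightarrow> com" where "Move i j = Ins (instr.Add i j 3)"
definition Inc :: "nat \<Rightarrow> int \<Rightarrow> com" where "Inc i z = Ins (Const 2 z) ;; Ins (instr.Add i i 2)"
definition Offset :: "nat \<Rightarrow> nat \<Rightarrow> int \<Rightarrow> com" where
  "Offset i j z = Ins (Const 2 z) ;; Ins (instr.Add i j 2)"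

lemma keeps_macros [simp]:
  "keeps (Loop r c) x \<longleftrightarrow> keeps c x \<and> x \<noteq> r"
  "keeps (Move i j) x \<longleftrightarrow> x \<noteq> i"
  "keeps (Inc i z) x \<longleftrightarrow> x \<noteq> 2 \<and> x \<noteq> i"
  "keeps (Offset i j z) x \<longleftrightarrow> x \<noteq> 2 \<and> x \<noteq> i"
  by (simp_all add: Loop_def Move_def Inc_def Offset_def)

lemma wp_macros [simp]:
  "wp m (Move i j) Q (R, ys) \<longleftrightarrow> Q (R(i := R j + R 3), ys)"
  "i \<noteq> 2 \<Longrightarrow> wp m (Inc i z) Q (R, ys) \<longleftrightarrow> Q (R(2 := z, i := R i + z), ys)"
  "j \<noteq> 2 \<Longrightarrow> wp m (Offset i j z) Q (R, ys) \<longleftrightarrow> Q (R(2 := z, i := R j + z), ys)"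
  by (simp_all add: Move_def Inc_def Offset_def)

lemma wp_Loop:
  assumes n: "1 \<le> n" "n \<le> m" and R: "R r = int n" "R 1 = 1" "r \<noteq> 1" and "I 0 R ys"
    and indep: "\<And>i R' ys' v. I i R' ys' \<Longrightarrow> I i (R'(r := v)) ys'"
    and body: "\<And>i R' ys'. i < n \<Longrightarrow> I i R' ys' \<Longrightarrow> R' 1 = 1 \<Longrightarrow>
      wp m c (\<lambda>(R'', ys''). I (Suc i) R'' ys'' \<and> R'' r = R' r \<and> R'' 1 = 1) (R', ys')"
    and Q: "\<And>R' ys'. I n R' ys' \<Longrightarrow> R' 1 = 1 \<Longrightarrow> Q (R', ys')"
  shows "wp m (Loop r c) Q (R, ys)"
  unfolding Loop_def
proof (rule wp_Repeat[OF n, where I =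
      "\<lambda>i (R', ys'). I i R' ys' \<and> R' r = int (n - i) \<and> R' 1 = 1"])
  show "case (R, ys) of (R', ys') \<Rightarrow> I 0 R' ys' \<and> R' r = int (n - 0) \<and> R' 1 = 1"
    using assms by simp
next
  fix i s assume i: "i < n" "case s of (R', ys') \<Rightarrow> I i R' ys' \<and> R' r = int (n - i) \<and> R' 1 = 1"
  then obtain R' ys' where s: "s = (R', ys')" "I i R' ys'" "R' r = int (n - i)" "R' 1 = 1"
    by (cases s) auto
  show "wp m (c ;; Ins (Sub r r 1)) (\<lambda>s'. (case s' of (R', ys') \<Rightarrow>
      I (Suc i) R' ys' \<and> R' r = int (n - Suc i) \<and> R' 1 = 1) \<and> (0 < fst s' r \<longleftrightarrow> Suc i < n)) s"
    unfolding s(1) wp_simps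
    by (rule wp_mono[OF body[OF i(1) s(2,4)]]) (use indep i(1) s(3) R(3) in auto)
qed (use Q in auto)

text \<open>All registers other than the counter that the body keeps join the invariant with their
  values on entry, so that \<open>I\<close> only has to mention what changes.\<close>

lemma wp_Loop_keeps:
  assumes n: "1 \<le> n" "n \<le> m" and R: "R r = int n" "R 1 = 1" "r \<noteq> 1" and "I 0 R"
    and keeps: "keeps c r" "keeps c 1"
    and indep: "\<And>i R' v. I i R' \<Longrightarrow> I i (R'(r := v))"
    and body: "\<And>i R'. i < n \<Longrightarrow> I i R' \<Longrightarrow> (\<And>x. keeps c x \<Longrightarrow> x \<noteq> r \<Longrightarrow> R' x = R x) \<Longrightarrow>
      wp m c (\<lambda>(R'', ys''). I (Suc i) R'' \<and> ys'' = ys) (R', ys)"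
    and Q: "\<And>R'. I n R' \<Longrightarrow> (\<And>x. keeps c x \<Longrightarrow> x \<noteq> r \<Longrightarrow> R' x = R x) \<Longrightarrow> Q (R', ys)"
  shows "wp m (Loop r c) Q (R, ys)"
proof (rule wp_Loop[OF n, where I = "\<lambda>i R' ys'. I i R' \<and> ys' = ys \<and>
      (\<forall>x. keeps c x \<longrightarrow> x \<noteq> r \<longrightarrow> R' x = R x)"])
  fix i R' ys'
  assume i: "i < n" and I: "I i R' \<and> ys' = ys \<and> (\<forall>x. keeps c x \<longrightarrow> x \<noteq> r \<longrightarrow> R' x = R x)"
    and 1: "R' 1 = 1"
  then have "wp m c (\<lambda>(R'', ys''). I (Suc i) R'' \<and> ys'' = ys) (R', ys')"
    using body[of i R'] by simp
  then show "wp m c (\<lambda>(R'', ys''). (I (Suc i) R'' \<and> ys'' = ys \<and>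
      (\<forall>x. keeps c x \<longrightarrow> x \<noteq> r \<longrightarrow> R'' x = R x)) \<and> R'' r = R' r \<and> R'' 1 = 1) (R', ys')"
    by (rule wp_keeps) (use I keeps 1 in auto)
qed (use assms in auto)

section \<open>The program\<close>

text \<open>
  Register 0 holds \<open>k\<close>, register 4 the integer \<open>n\<close> substituted for \<open>X\<close>, register 6 the number of
  intervals found so far and register 7 the first free address. From address 40 on, each endpoint
  of these intervals occupies three registers: its value at \<open>n\<close>, its coefficient of \<open>X\<close> and its
  constant coefficient. The triples in registers 12-14 and 24-26 hold the least suitable sum beyond
  the bound in register 10 and the sum under consideration.
\<close>

definition cap_min :: com where
  "cap_min = Ins (Sub 39 38 36) ;; Ins (instr.Add 39 39 1) ;; Unless 39 (Move 36 38)"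

text \<open>For integers, adding 1 turns the test for a positive register into a test for a
  nonnegative one.\<close>

definition cap_max :: com where
  "cap_max = Ins (Sub 39 37 38) ;; Ins (instr.Add 39 39 1) ;; Unless 39 (Move 37 38)"

text \<open>
  Adds to register 30 the pair count for the sum in register 24 and the intervals whose lower
  endpoints are at the addresses in registers 32 and 34.
\<close>

definition count_pair :: com where
  "count_pair =
     Ins (Load 37 32) ;; Ins (instr.Add 37 37 37) ;; Move 36 24 ;;
     Offset 38 32 3 ;; Ins (Load 38 38) ;; Ins (instr.Add 38 38 38) ;; Ins (instr.Add 38 38 1) ;; cap_min ;;
     Ins (Load 38 34) ;; Ins (Sub 38 24 38) ;; Ins (instr.Add 38 38 38) ;; Ins (instr.Add 38 38 1) ;; cap_min ;;
     Offset 38 34 3 ;; Ins (Load 38 38) ;; Ins (Sub 38 24 38) ;; Ins (instr.Add 38 38 38) ;; cap_max ;;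
     Ins (Sub 36 36 37) ;; Ins (Sub 39 1 36) ;; Unless 39 (Ins (instr.Add 30 30 1)) ;;
     Ins (Const 2 3) ;; Ins (Sub 39 2 36) ;; Unless 39 (Ins (instr.Add 30 30 1))"

text \<open>Address 46 skips the six registers of the interval \<open>{1}\<close>, and accordingly
  the loops run once less than the number of intervals.\<close>

definition count_reps :: com where
  "count_reps =
     Ins (Const 30 0) ;; Ins (Const 32 46) ;; Ins (Sub 33 6 1) ;;
     Loop 33 (Ins (Const 34 46) ;; Ins (Sub 35 6 1) ;; Loop 35 (count_pair ;; Inc 34 6) ;; Inc 32 6)"

definition load_sum :: com where
  "load_sum =
     Ins (Load 24 20) ;; Ins (Load 38 22) ;; Ins (instr.Add 24 24 38) ;; Inc 24 (- 3) ;;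
     Offset 25 20 1 ;; Ins (Load 25 25) ;; Offset 38 22 1 ;; Ins (Load 38 38) ;; Ins (instr.Add 25 25 38) ;;
     Offset 26 20 2 ;; Ins (Load 26 26) ;; Offset 38 22 2 ;; Ins (Load 38 38) ;; Ins (instr.Add 26 26 38) ;;
     Inc 26 (- 3)"

definition test_sum :: "bool \<Rightarrow> com" where
  "test_sum unique =
     Ins (Sub 39 10 24) ;; Ins (instr.Add 39 39 1) ;; Unless 39 (
       Ins (Sub 39 24 12) ;; Ins (instr.Add 39 39 1) ;; Unless 39 (
         Ins (Sub 39 1 30) ;; Unless 39 (
           Ins (if unique then Sub 39 30 1 else Const 39 0) ;; Unless 39 (
             Move 12 24 ;; Move 13 25 ;; Move 14 26))))"

text \<open>All sums of two stored endpoints are tried with the offsets -3 to 3. When every endpoint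
  is at most the bound and the bound is positive, the start value, 4 times the bound plus 100,
  exceeds all these sums and acts as infinity.\<close>

definition find_sum :: "bool \<Rightarrow> com" where
  "find_sum unique =
     Ins (instr.Add 12 10 10) ;; Ins (instr.Add 12 12 12) ;; Inc 12 100 ;;
     Ins (Const 20 40) ;; Ins (instr.Add 21 6 6) ;;
     Loop 21 (
       Ins (Const 22 40) ;; Ins (instr.Add 23 6 6) ;;
       Loop 23 (
         load_sum ;; Ins (Const 27 7) ;;
         Loop 27 (count_reps ;; test_sum unique ;; Inc 24 1 ;; Inc 26 1) ;;
         Inc 22 3) ;;
       Inc 20 3)"

text \<open>\<open>16384\<close> is \<open>4 ^ 7\<close>, and \<open>k + 1\<close> further
  quadruplings give \<open>4 ^ (k + 8)\<close>.\<close>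

definition ulam_init :: com where
  "ulam_init =
     Ins (Const 1 1) ;; Ins (Const 4 16384) ;; Ins (instr.Add 5 0 1) ;;
     Loop 5 (Ins (instr.Add 4 4 4) ;; Ins (instr.Add 4 4 4)) ;;
     Ins (Const 40 1) ;; Ins (Const 41 0) ;; Ins (Const 42 1) ;;
     Ins (Const 43 1) ;; Ins (Const 44 0) ;; Ins (Const 45 1) ;;
     Move 46 4 ;; Ins (Const 47 1) ;; Ins (Const 48 0) ;;
     Ins (instr.Add 49 4 4) ;; Ins (Const 50 2) ;; Ins (Const 51 0) ;;
     Ins (Const 6 2) ;; Ins (Const 7 52) ;; Ins (instr.Add 5 0 1)"

definition store_best :: com where
  "store_best = Ins (Store 8 12) ;; Inc 8 1 ;; Ins (Store 8 13) ;; Inc 8 1 ;; Ins (Store 8 14) ;; Inc 8 1"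

text \<open>Storing the lower endpoint twice makes the new interval a single point during the second
  search, as the rule requires. That search yields \<open>e i + 1\<close>, whence the subtractions
  from the value and the constant coefficient; the result overwrites the provisional upper
  endpoint.\<close>

definition next_interval :: com where
  "next_interval =
     Offset 8 7 (- 3) ;; Ins (Load 10 8) ;; Ins (instr.Add 10 10 1) ;; find_sum True ;;
     Move 8 7 ;; store_best ;; store_best ;; Ins (instr.Add 6 6 1) ;; Inc 7 6 ;;
     Move 10 12 ;; find_sum False ;; Ins (Sub 12 12 1) ;; Ins (Sub 14 14 1) ;;
     Offset 8 7 (- 3) ;; store_best"

definition print_column :: "int \<Rightarrow> com" where
  "print_column z = Ins (Const 20 z) ;; Ins (instr.Add 21 0 1) ;;
     Loop 21 (Ins (Load 38 20) ;; Ins (Print 38) ;; Inc 20 6)"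

text \<open>Only \<open>k - 1\<close> further intervals are needed for \<open>k \<ge> 1\<close>.
  Since loops execute their bodies at least once, \<open>k + 1\<close> rounds are made, which also
  covers \<open>k = 0\<close>.\<close>

definition ulam_program :: com where
  "ulam_program = ulam_init ;; Loop 5 next_interval ;;
     print_column 41 ;; print_column 42 ;; print_column 44 ;; print_column 45 ;; Ins (Print 4)"

section \<open>Correctness of the counting and of the exhaustive search\<close>

lemma wp_count_pair:
  assumes "R 32 = int x" "R 34 = int y" "R 1 = 1" "R 3 = 0" "40 \<le> x" "40 \<le> y"
  shows "wp m count_pair (\<lambda>(R', ys'). R' 30 = R 30 +
    int (pair_count (R x) (R (x + 3)) (R y) (R (y + 3)) (R 24)) \<and> ys' = ys) (R, ys)"
proof -
  have "nat (3 + int x) = x + 3" "nat (int x + 3) = x + 3" "nat (3 + int y) = y + 3" "nat (int y + 3) = y + 3" by auto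
  then show ?thesis
    unfolding count_pair_def cap_min_def cap_max_def using assms
    by (auto simp: pair_count_def slack_def min_def max_def)
qed

lemma keeps_count_pair [simp]: "keeps count_pair x \<longleftrightarrow> x \<notin> {2, 30, 36, 37, 38, 39}"
  by (auto simp: count_pair_def cap_min_def cap_max_def)

lemma keeps_count_reps [simp]:
  "keeps count_reps x \<longleftrightarrow> x \<notin> {2, 30, 32, 33, 34, 35, 36, 37, 38, 39}"
  by (auto simp: count_reps_def)

lemma keeps_load_sum [simp]: "keeps load_sum x \<longleftrightarrow> x \<notin> {2, 24, 25, 26, 38}"
  by (auto simp: load_sum_def)

lemma keeps_test_sum [simp]: "keeps (test_sum unique) x \<longleftrightarrow> x \<notin> {12, 13, 14, 39}"
  by (auto simp: test_sum_def)

definition mem_count :: "nat \<Rightarrow> (nat \<Rightarrow> int) \<Rightarrow> int \<Rightarrow> nat" where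
  "mem_count L R q = rep_count (\<lambda>i. R (40 + 6 * i)) (\<lambda>i. R (43 + 6 * i)) (L - 1) q"

lemma wp_count_reps:
  assumes R: "R 1 = 1" "R 3 = 0" "R 6 = int L" and L: "2 \<le> L" "L \<le> m"
  shows "wp m count_reps (\<lambda>(R', ys'). R' 30 = int (mem_count L R (R 24)) \<and> ys' = ys) (R, ys)"
proof -
  define n where "n = L - 1"
  have n: "1 \<le> n" "n \<le> m" "int L - 1 = int n" using L by (auto simp: n_def)
  define f where "f i j = pair_count (R (46 + 6 * i)) (R (49 + 6 * i)) (R (46 + 6 * j)) (R (49 + 6 * j)) (R 24)" for i j
  have mem: "mem_count L R (R 24) = (\<Sum>i<n. \<Sum>j<n. f i j)"
    by (simp add: mem_count_def rep_count_def sum.atLeast1_atMost_eq f_def n_def)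
  have inner: "wp m (Ins (Const 34 46) ;; Ins (Sub 35 6 1) ;; Loop 35 (count_pair ;; Inc 34 6))
      (\<lambda>(R2, ys'). R2 30 = R1 30 + int (\<Sum>j<n. f i j) \<and> ys' = ys) (R1, ys)"
    if R1: "\<And>x. x \<notin> {2, 30, 32, 33, 34, 35, 36, 37, 38, 39} \<Longrightarrow> R1 x = R x" and i: "R1 32 = int (46 + 6 * i)"
    for R1 i
    unfolding wp_simps
  proof (rule wp_Loop_keeps[where n = n and
        I = "\<lambda>j R2. R2 34 = int (46 + 6 * j) \<and> R2 30 = R1 30 + int (\<Sum>j'<j. f i j')"])
    fix j R2
    assume j: "j < n" and I: "R2 34 = int (46 + 6 * j) \<and> R2 30 = R1 30 + int (\<Sum>j'<j. f i j')"
      and keep: "\<And>x. keeps (count_pair ;; Inc 34 6) x \<Longrightarrow> x \<noteq> 35 \<Longrightarrow>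
        R2 x = (R1(34 := 46, 35 := (R1(34 := 46)) 6 - (R1(34 := 46)) 1)) x"
    have "R2 32 = int (46 + 6 * i)" using keep[of 32] i by simp
    moreover have "R2 1 = 1" "R2 3 = 0" using keep[of 1] keep[of 3] R1[of 1] R1[of 3] R by simp_all
    moreover have "R2 24 = R 24" using keep[of 24] R1[of 24] by simp
    moreover have "R2 x = R x" if "40 \<le> x" for x using keep[of x] R1[of x] that by auto
    ultimately show "wp m (count_pair ;; Inc 34 6) (\<lambda>(R3, ys'). (R3 34 = int (46 + 6 * Suc j) \<and>
        R3 30 = R1 30 + int (\<Sum>j'<Suc j. f i j')) \<and> ys' = ys) (R2, ys)"
      unfolding wp_simps
      by (intro wp_keeps[OF wp_count_pair[of R2 "46 + 6 * i" "46 + 6 * j"]])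
        (use I in \<open>auto simp: f_def add.assoc\<close>)
  qed (use R1[of 1] R1[of 6] R n in auto)
  show ?thesis
    unfolding count_reps_def wp_simps(1-7)
  proof (rule wp_Loop_keeps[where n = n and
        I = "\<lambda>i R2. R2 32 = int (46 + 6 * i) \<and> R2 30 = int (\<Sum>i'<i. \<Sum>j<n. f i' j)"])
    fix i R1
    assume i: "i < n" and I: "R1 32 = int (46 + 6 * i) \<and> R1 30 = int (\<Sum>i'<i. \<Sum>j<n. f i' j)"
      and keep: "\<And>x. keeps (Ins (Const 34 46) ;; Ins (Sub 35 6 1) ;; Loop 35 (count_pair ;; Inc 34 6) ;; Inc 32 6) x \<Longrightarrow>
        x \<noteq> 33 \<Longrightarrow> R1 x = (R(30 := 0, 32 := 46,
          33 := (R(30 := 0, 32 := 46)) 6 - (R(30 := 0, 32 := 46)) 1)) x"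
    have *: "R1 x = R x" if "x \<notin> {2, 30, 32, 33, 34, 35, 36, 37, 38, 39}" for x
      using keep[of x] that by auto
    show "wp m (Ins (Const 34 46) ;; Ins (Sub 35 6 1) ;; Loop 35 (count_pair ;; Inc 34 6) ;; Inc 32 6)
      (\<lambda>(R2, ys'). (R2 32 = int (46 + 6 * Suc i) \<and> R2 30 = int (\<Sum>i'<Suc i. \<Sum>j<n. f i' j)) \<and> ys' = ys) (R1, ys)"
      using wp_keeps[OF inner[OF *, of i], of
          "wp m (Inc 32 6) (\<lambda>(R2, ys'). (R2 32 = int (46 + 6 * Suc i) \<and> R2 30 = int (\<Sum>i'<Suc i. \<Sum>j<n. f i' j)) \<and> ys' = ys)"] I
      by simp
  qed (use R n mem in auto)
qed

lemma wp_test_sum: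
  assumes "R 1 = 1" "R 3 = 0"
  shows "wp m (test_sum unique) (\<lambda>(R', ys'). ys' = ys \<and>
    (if R 10 < R 24 \<and> R 24 < R 12 \<and> 1 \<le> R 30 \<and> (unique \<longrightarrow> R 30 \<le> 1)
     then R' 12 = R 24 \<and> R' 13 = R 25 \<and> R' 14 = R 26
     else R' 12 = R 12 \<and> R' 13 = R 13 \<and> R' 14 = R 14)) (R, ys)"
  using assms by (cases unique) (auto simp: test_sum_def)

lemma wp_load_sum:
  assumes "R 20 = int x" "R 22 = int y" "40 \<le> x" "40 \<le> y"
  shows "wp m load_sum (\<lambda>(R', ys'). R' 24 = R x + R y - 3 \<and> R' 25 = R (x + 1) + R (y + 1) \<and>
    R' 26 = R (x + 2) + R (y + 2) - 3 \<and> ys' = ys) (R, ys)"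
proof -
  have "nat (int x + 1) = x + 1" "nat (int x + 2) = x + 2"
    "nat (int y + 1) = y + 1" "nat (int y + 2) = y + 2" by auto
  then show ?thesis using assms by (simp add: load_sum_def)
qed

context
  fixes m L :: nat and R0 :: "nat \<Rightarrow> int" and ys :: "int list" and unique :: bool
    and bnd gv ga gb :: int and u0 v0 t0 :: nat
  assumes L: "2 \<le> L" "2 * L \<le> m" "7 \<le> m"
    and R0: "R0 1 = 1" "R0 3 = 0" "R0 6 = int L" "R0 10 = bnd"
    and least: "least_above UNIV
      (\<lambda>q. 1 \<le> mem_count L R0 q \<and> (unique \<longrightarrow> mem_count L R0 q \<le> 1)) bnd gv"
    and bounded: "gv < 4 * bnd + 100"
    and found: "u0 < 2 * L" "v0 < 2 * L" "t0 < 7" "R0 (40 + 3 * u0) + R0 (40 + 3 * v0) - 3 + int t0 = gv"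
    and match: "\<And>u v t. u < 2 * L \<Longrightarrow> v < 2 * L \<Longrightarrow> t < 7 \<Longrightarrow>
      R0 (40 + 3 * u) + R0 (40 + 3 * v) - 3 + int t = gv \<Longrightarrow>
      R0 (41 + 3 * u) + R0 (41 + 3 * v) = ga \<and> R0 (42 + 3 * u) + R0 (42 + 3 * v) - 3 + int t = gb"
begin

private definition env where
  "env R \<longleftrightarrow> (\<forall>x \<ge> 40. R x = R0 x) \<and> R 1 = 1 \<and> R 3 = 0 \<and> R 6 = int L \<and> R 10 = bnd"

text \<open>The search invariant. By leastness nothing between the bound and \<open>gv\<close>
  passes the test, so the search only has to meet \<open>gv\<close> once; \<open>match\<close> makes
  the coefficients independent of the pair of endpoints that produces it.\<close>

private definition best where
  "best R \<longleftrightarrow> gv \<le> R 12 \<and> (R 12 = gv \<longrightarrow> R 13 = ga \<and> R 14 = gb)"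

private lemma env_mem_count: "env R \<Longrightarrow> mem_count L R = mem_count L R0"
  by (simp add: env_def mem_count_def fun_eq_iff)

private lemma wp_try_sum:
  assumes "env R" "best R" and eq: "R 24 = gv \<Longrightarrow> R 25 = ga \<and> R 26 = gb"
  shows "wp m (count_reps ;; test_sum unique ;; Inc 24 1 ;; Inc 26 1)
    (\<lambda>(R', ys'). ys' = ys \<and> best R' \<and> (R 12 = gv \<or> R 24 = gv \<longrightarrow> R' 12 = gv) \<and>
      R' 24 = R 24 + 1 \<and> R' 25 = R 25 \<and> R' 26 = R 26 + 1) (R, ys)"
proof -
  have R: "R 1 = 1" "R 3 = 0" "R 6 = int L" "R 10 = bnd" using assms(1) by (simp_all add: env_def)
  have g: "bnd < gv" "1 \<le> mem_count L R0 gv" "unique \<Longrightarrow> mem_count L R0 gv \<le> 1"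
    "\<And>q. bnd < q \<Longrightarrow> q < gv \<Longrightarrow> 1 \<le> mem_count L R0 q \<Longrightarrow> unique \<and> 1 < mem_count L R0 q"
    using least by (auto simp: least_above_def not_le)
  show ?thesis
    unfolding wp_simps
  proof (rule wp_keeps[OF wp_count_reps[OF R(1-3)]], goal_cases)
    case (3 R1 ys1)
    have R1: "R1 x = R x" if "x \<notin> {2, 30, 32, 33, 34, 35, 36, 37, 38, 39}" for x
      using 3(2)[of x] that by simp
    have cnt: "R1 30 = int (mem_count L R0 (R 24))" and ys1: "ys1 = ys"
      using 3(1) env_mem_count[OF assms(1)] by auto
    show ?case
    proof (rule wp_keeps[OF wp_test_sum], goal_cases)
      case (3 R2 ys2)
      have R2: "R2 24 = R 24" "R2 25 = R 25" "R2 26 = R 26"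
        using 3(2)[of 24] 3(2)[of 25] 3(2)[of 26] R1 by simp_all
      let ?pass = "bnd < R 24 \<and> R 24 < R 12 \<and> 1 \<le> mem_count L R0 (R 24) \<and>
        (unique \<longrightarrow> mem_count L R0 (R 24) \<le> 1)"
      have R2': "ys2 = ys" "if ?pass then R2 12 = R 24 \<and> R2 13 = R 25 \<and> R2 14 = R 26
          else R2 12 = R 12 \<and> R2 13 = R 13 \<and> R2 14 = R 14"
        using 3(1) R1 R cnt ys1 by auto
      have "best R2 \<and> (R 12 = gv \<or> R 24 = gv \<longrightarrow> R2 12 = gv)"
      proof (cases ?pass)
        case True
        then have "gv \<le> R 24" using g(4)[of "R 24"] by force
        with True R2'(2) eq show ?thesis using assms(2) by (auto simp: best_def)
      next
        case False
        then have "R 24 = gv \<Longrightarrow> R 12 \<le> gv" using g(1-3) by (auto simp: not_less)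
        with False R2'(2) show ?thesis using assms(2) by (auto simp: best_def)
      qed
      then show ?case using R2 R2'(1) by (simp add: best_def)
    qed (use R1 R in simp_all)
  qed (use L in simp_all)
qed

private abbreviation sum_loop :: com where
  "sum_loop \<equiv> load_sum ;; Ins (Const 27 7) ;;
     Loop 27 (count_reps ;; test_sum unique ;; Inc 24 1 ;; Inc 26 1) ;; Inc 22 3"

private lemma wp_sum_loop:
  assumes env: "env R" and best: "best R" and uv: "u < 2 * L" "v < 2 * L"
    and R: "R 20 = int (40 + 3 * u)" "R 22 = int (40 + 3 * v)"
  shows "wp m sum_loop (\<lambda>(R', ys'). ys' = ys \<and> best R' \<and> R' 22 = int (40 + 3 * Suc v) \<and>
      (R 12 = gv \<or> u = u0 \<and> v = v0 \<longrightarrow> R' 12 = gv)) (R, ys)"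
  unfolding wp_simps(7)
proof (rule wp_keeps[OF wp_load_sum[OF R]], goal_cases)
  case (3 R1 ys1)
  have R1: "R1 24 = R0 (40 + 3 * u) + R0 (40 + 3 * v) - 3"
    "R1 25 = R0 (41 + 3 * u) + R0 (41 + 3 * v)"
    "R1 26 = R0 (42 + 3 * u) + R0 (42 + 3 * v) - 3" "ys1 = ys"
    using 3(1) env by (auto simp: env_def ac_simps)
  have keep1: "R1 x = R x" if "x \<notin> {2, 24, 25, 26, 38}" for x using 3(2)[of x] that by simp
  have env1: "env R1" using env keep1 by (auto simp: env_def)
  have best1: "best R1" using best keep1[of 12] keep1[of 13] keep1[of 14] by (simp add: best_def)
  show ?case
    unfolding wp_simps(1)
  proof (rule wp_Loop_keeps[where n = 7 and I = "\<lambda>t R2. best R2 \<and> R2 24 = R1 24 + int t \<and>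
      R2 25 = R1 25 \<and> R2 26 = R1 26 + int t \<and>
      (R 12 = gv \<or> (\<exists>t' < t. R1 24 + int t' = gv) \<longrightarrow> R2 12 = gv)"], goal_cases)
    case (10 t R2)
    have "env R2" using env1 10(3) by (auto simp: env_def)
    moreover have "R2 25 = ga \<and> R2 26 = gb" if "R2 24 = gv"
      using match[OF uv 10(1)] that 10(2) R1 by auto
    ultimately show ?case
      unfolding \<open>ys1 = ys\<close>
      by (intro wp_mono[OF wp_try_sum]) (use 10(2) in \<open>auto simp: less_Suc_eq\<close>)
  next
    case (11 R2)
    have "R2 22 = int (40 + 3 * v)" using 11(2)[of 22] keep1[of 22] R by simp
    moreover have "\<exists>t' < 7. R1 24 + int t' = gv" if "u = u0" "v = v0"
      using found(3,4) that R1(1) by (intro exI[of _ t0]) simp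
    ultimately show ?case using 11(1) R1(4) by (auto simp: best_def)
  qed (use L best1 env1 keep1[of 12] in \<open>auto simp: best_def env_def\<close>)
qed auto

private abbreviation row_loop :: com where
  "row_loop \<equiv> Ins (Const 22 40) ;; Ins (instr.Add 23 6 6) ;; Loop 23 sum_loop ;; Inc 20 3"

private lemma wp_row_loop:
  assumes env: "env R" and best: "best R" and u: "u < 2 * L" and R: "R 20 = int (40 + 3 * u)"
  shows "wp m row_loop (\<lambda>(R', ys'). ys' = ys \<and> best R' \<and> R' 20 = int (40 + 3 * Suc u) \<and>
      (R 12 = gv \<or> u = u0 \<longrightarrow> R' 12 = gv)) (R, ys)"
  unfolding wp_simps(1,2,7)
proof (rule wp_Loop_keeps[where n = "2 * L" and I = "\<lambda>v R2. best R2 \<and> R2 22 = int (40 + 3 * v) \<and>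
      (R 12 = gv \<or> u = u0 \<and> v0 < v \<longrightarrow> R2 12 = gv)"], goal_cases)
  case (10 v R2)
  have "env R2" using env 10(3) by (auto simp: env_def)
  moreover have "R2 20 = int (40 + 3 * u)" using 10(3)[of 20] R by simp
  ultimately show ?case
    by (intro wp_mono[OF wp_sum_loop[of R2 u v]]) (use 10(1,2) u in \<open>auto simp: less_Suc_eq\<close>)
next
  case (11 R2)
  have "R2 20 = int (40 + 3 * u)" using 11(2)[of 20] R by simp
  then show ?case using 11(1) found(2) by (auto simp: best_def)
qed (use L best env R in \<open>auto simp: best_def env_def\<close>)

lemma wp_find_sum:
  "wp m (find_sum unique) (\<lambda>(R', ys'). ys' = ys \<and> R' 12 = gv \<and> R' 13 = ga \<and> R' 14 = gb) (R0, ys)"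
proof -
  have ne: "(12::nat) \<noteq> 2" by simp
  show ?thesis
    unfolding find_sum_def wp_simps(1,2,7) wp_macros(2)[OF ne]
  proof (rule wp_Loop_keeps[where n = "2 * L" and I = "\<lambda>u R2. best R2 \<and> R2 20 = int (40 + 3 * u) \<and>
      (u0 < u \<longrightarrow> R2 12 = gv)"], goal_cases)
    case (10 u R2)
    have "env R2" using R0 10(3) by (auto simp: env_def)
    then show ?case
      by (intro wp_mono[OF wp_row_loop[of R2 u]]) (use 10(1,2) in \<open>auto simp: less_Suc_eq\<close>)
  next
    case (11 R2)
    then show ?case using found(1) by (auto simp: best_def)
  qed (use L R0 bounded in \<open>auto simp: best_def\<close>)
qed

end

lemma keeps_find_sum [simp]:
  "keeps (find_sum unique) x \<longleftrightarrow>
     x \<notin> {2, 12, 13, 14, 20, 21, 22, 23, 24, 25, 26, 27, 30, 32, 33, 34, 35, 36, 37, 38, 39}"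
  by (auto simp: find_sum_def)

lemma wp_store_best:
  assumes "R 8 = int x" "40 \<le> x"
  shows "wp m store_best (\<lambda>(R', ys'). ys' = ys \<and> R' 8 = int (x + 3) \<and> R' x = R 12 \<and>
    R' (x + 1) = R 13 \<and> R' (x + 2) = R 14 \<and>
    (\<forall>y. y \<notin> {2, 8, x, x + 1, x + 2} \<longrightarrow> R' y = R y)) (R, ys)"
proof -
  have "nat (int x + 1) = x + 1" "nat (int x + 2) = x + 2" "nat (2 + int x) = x + 2" by auto
  then show ?thesis using assms by (simp add: store_best_def)
qed

lemma wp_print_column:
  assumes "R 0 = int k" "R 1 = 1" "40 \<le> x" "Suc k \<le> m"
  shows "wp m (print_column (int x)) (\<lambda>(R', ys'). ys' = ys @ map (\<lambda>i. R (x + 6 * i)) [0..<Suc k] \<and>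
    (\<forall>y. y \<notin> {2, 20, 21, 38} \<longrightarrow> R' y = R y)) (R, ys)"
  unfolding print_column_def wp_simps(1,2,7)
proof (rule wp_Loop[where n = "Suc k" and I = "\<lambda>i R' ys'. R' 20 = int (x + 6 * i) \<and>
    ys' = ys @ map (\<lambda>i. R (x + 6 * i)) [0..<i] \<and> (\<forall>y. y \<notin> {2, 20, 21, 38} \<longrightarrow> R' y = R y)"], goal_cases)
  case (8 i R' ys')
  then have "R' (x + 6 * i) = R (x + 6 * i)" using assms(3) by auto
  moreover have "nat (int x + 6 * int i) = x + 6 * i" by simp
  ultimately show ?case using 8 by auto
qed (use assms in auto)

definition holds :: "int \<Rightarrow> (nat \<Rightarrow> int) \<Rightarrow> nat \<Rightarrow> int poly \<Rightarrow> bool" where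
  "holds n R x p \<longleftrightarrow> R x = poly p n \<and> R (x + 1) = coeff p 1 \<and> R (x + 2) = coeff p 0"

text \<open>
  The program computes with values at the large integer \<open>n\<close>; the table of endpoints
  \<open>P\<close> also carries their coefficients, which are determined by the values.
\<close>

lemma wp_find_sum_holds:
  assumes table: "\<And>u. u < 2 * L \<Longrightarrow> holds n R (40 + 3 * u) (P u)"
    and L: "2 \<le> L" "2 * L \<le> m" "7 \<le> m"
    and R: "R 1 = 1" "R 3 = 0" "R 6 = int L" "R 10 = bnd"
    and small: "\<And>u. u < 2 * L \<Longrightarrow> small M (P u)" "4 * M + 6 < n"
    and le: "\<And>u. u < 2 * L \<Longrightarrow> poly (P u) n \<le> bnd" "0 < bnd"
    and least: "least_above UNIV
      (\<lambda>q. 1 \<le> rep_count (\<lambda>i. poly (P (2 * i)) n) (\<lambda>i. poly (P (2 * i + 1)) n) (L - 1) q \<and>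
        (unique \<longrightarrow> rep_count (\<lambda>i. poly (P (2 * i)) n) (\<lambda>i. poly (P (2 * i + 1)) n) (L - 1) q \<le> 1))
      bnd (poly g n)"
    and g: "u0 < 2 * L" "v0 < 2 * L" "\<bar>t0\<bar> \<le> 3" "g = P u0 + P v0 + of_int t0"
  shows "wp m (find_sum unique) (\<lambda>(R', ys'). ys' = ys \<and> holds n R' 12 g) (R, ys)"
proof -
  have R_eq: "R (40 + 3 * u) = poly (P u) n" "R (41 + 3 * u) = coeff (P u) 1"
    "R (42 + 3 * u) = coeff (P u) 0" if "u < 2 * L" for u
    using table[OF that] by (simp_all add: holds_def)
  have cnt: "mem_count L R =
      rep_count (\<lambda>i. poly (P (2 * i)) n) (\<lambda>i. poly (P (2 * i + 1)) n) (L - 1)"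
  proof (rule ext)
    fix q
    show "mem_count L R q =
        rep_count (\<lambda>i. poly (P (2 * i)) n) (\<lambda>i. poly (P (2 * i + 1)) n) (L - 1) q"
      unfolding mem_count_def
    proof (rule rep_count_cong)
      fix i assume "i \<in> {1..L - 1}"
      then have "i < L" using L(1) by auto
      then show "R (40 + 6 * i) = poly (P (2 * i)) n \<and> R (43 + 6 * i) = poly (P (2 * i + 1)) n"
        using R_eq(1)[of "2 * i"] R_eq(1)[of "2 * i + 1"] by (simp add: algebra_simps)
    qed
  qed
  have sm: "small (2 * M + 3) (P u + P v + of_int t)" if "u < 2 * L" "v < 2 * L" "\<bar>t\<bar> \<le> 3" for u v t
    using small_add[OF small_add[OF small(1)[OF that(1)] small(1)[OF that(2)]] small_of_int[OF that(3)]]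
    by (simp only: mult_2)
  have match: "R (41 + 3 * u) + R (41 + 3 * v) = coeff g 1 \<and>
      R (42 + 3 * u) + R (42 + 3 * v) - 3 + int t = coeff g 0"
    if uv: "u < 2 * L" "v < 2 * L" "t < 7" "R (40 + 3 * u) + R (40 + 3 * v) - 3 + int t = poly g n"
    for u v t
  proof -
    have t: "\<bar>int t - 3\<bar> \<le> 3" using uv(3) by auto
    have "poly (P u + P v + of_int (int t - 3)) n = poly g n"
      using uv R_eq by (simp add: of_int_poly)
    then have "P u + P v + of_int (int t - 3) = g"
      using poly_eq_small_iff[OF sm[OF uv(1,2) t] sm[OF g(1-3)]] small(2) g(4) by simp
    then show ?thesis using R_eq[OF uv(1)] R_eq[OF uv(2)] by (auto simp: of_int_poly)
  qed
  have gv: "poly g n = poly (P u0) n + poly (P v0) n + t0" using g(4) by (simp add: of_int_poly)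
  have "wp m (find_sum unique) (\<lambda>(R', ys'). ys' = ys \<and> R' 12 = poly g n \<and> R' 13 = coeff g 1 \<and>
      R' 14 = coeff g 0) (R, ys)"
  proof (rule wp_find_sum[OF L R, where ?u0.0 = u0 and ?v0.0 = v0 and ?t0.0 = "nat (t0 + 3)"])
    show "poly g n < 4 * bnd + 100" using le(1)[OF g(1)] le(1)[OF g(2)] le(2) g(3) gv by simp
    show "R (40 + 3 * u0) + R (40 + 3 * v0) - 3 + int (nat (t0 + 3)) = poly g n"
      using R_eq(1)[OF g(1)] R_eq(1)[OF g(2)] gv g(3) by simp
  qed (use least cnt g match in auto)
  then show ?thesis by (simp add: holds_def)
qed

section \<open>The table of endpoints and the candidates it provides\<close>

context poly_ulam
begin

definition endpoint :: "nat \<Rightarrow> int poly" where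
  "endpoint u = (if even u then s (u div 2) else e (u div 2))"

lemma endpoint_simps [simp]:
  "endpoint (2 * i) = s i" "endpoint (2 * i + 1) = e i" "endpoint (Suc (2 * i)) = e i"
  by (simp_all add: endpoint_def)

lemma endpoint_cases:
  obtains i where "u = 2 * i" "endpoint u = s i" | i where "u = 2 * i + 1" "endpoint u = e i"
  by (metis endpoint_simps(1,2) evenE oddE)

lemma start_candidate:
  assumes "1 \<le> i"
  obtains u v t where "u < 2 * Suc i" "v < 2 * Suc i" "\<bar>t\<bar> \<le> 3"
    "s (Suc i) = endpoint u + endpoint v + of_int t"
proof -
  have "s (Suc i) = e i + 1 + 1 \<or> near_sum s e i (s (Suc i))"
    by (rule least_above_near_sum[OF start[OF assms] chain deg_le_diff[OF s_deg_le deg_le_1]])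
  then show thesis
  proof
    assume "s (Suc i) = e i + 1 + 1"
    \<comment> \<open>The candidate next to the bound is \<open>e 0 + e i + 1\<close> with
      \<open>e 0 = 1\<close>: the table keeps the interval \<open>{1}\<close> for this purpose
      although the counting skips it.\<close>
    then show thesis by (intro that[of 1 "2 * i + 1" 1]) (simp_all add: endpoint_def e_0)
  next
    assume "near_sum s e i (s (Suc i))"
    then show thesis
    proof (cases rule: near_sumE)
      case (1 j l t)
      then show thesis
        using that[of "2 * j" "2 * l" t] that[of "2 * j + 1" "2 * l + 1" t] by auto
    qed
  qed
qed

text \<open>The contents of the table between the two searches of a round.\<close>

definition endpoint' :: "nat \<Rightarrow> nat \<Rightarrow> int poly" where
  "endpoint' i = endpoint(2 * i + 1 := s i)"

lemma endpoint'_simps [simp]: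
  "endpoint' i (2 * j) = s j" "endpoint' i (2 * j + 1) = (e(i := s i)) j"
  "endpoint' i (Suc (2 * j)) = (e(i := s i)) j"
proof -
  have "2 * j \<noteq> 2 * i + 1" by presburger
  then show "endpoint' i (2 * j) = s j" by (simp add: endpoint'_def)
qed (auto simp: endpoint'_def)

lemma finish_candidate:
  assumes "2 \<le> i"
  obtains u v t where "u < 2 * Suc i" "v < 2 * Suc i" "\<bar>t\<bar> \<le> 3"
    "e i + 1 = endpoint' i u + endpoint' i v + of_int t"
proof -
  have "e i + 1 = s i + 1 \<or> near_sum s (e(i := s i)) i (e i + 1)"
    by (rule least_above_near_sum[OF finish[OF assms] chain_single]) (use e_deg_le in simp)
  then show thesis
  proof
    assume "e i + 1 = s i + 1"
    then show thesis
      using that[of "2 * 0" "2 * i" 0] unfolding endpoint'_simps s_0 by (simp add: add.commute)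
  next
    assume "near_sum s (e(i := s i)) i (e i + 1)"
    then show thesis
    proof (cases rule: near_sumE)
      case (1 j l t)
      then show thesis
        using that[of "2 * j" "2 * l" t] that[of "2 * j + 1" "2 * l + 1" t]
        unfolding endpoint'_simps by auto
    qed
  qed
qed

context
  fixes k :: nat and n :: int and m :: nat
  assumes n: "8 * size_bound (k + 3) + 20 < n" and m: "2 * k + 20 \<le> m"
begin

private lemma small_1_bound: "small (size_bound (k + 3)) 1"
  using small_mono[OF small_1, of "size_bound (k + 3)"] size_bound_ge[of "k + 3"] by simp

private lemma small_endpoints:
  assumes "i \<le> k + 3"
  shows "small (size_bound (k + 3)) (s i)" "small (size_bound (k + 3)) (e i)"
  using small_s[of i "k + 3"] small_e[of i "k + 3"] s_0 e_0 assms small_1_bound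
  by (cases "i = 0"; simp)+

private lemma eval_le: "p \<le> q \<Longrightarrow> small (size_bound (k + 3)) p \<Longrightarrow> small (size_bound (k + 3)) q \<Longrightarrow>
    poly p n \<le> poly q n"
  using le_small_iff[of "size_bound (k + 3)" p "size_bound (k + 3)" q n] n size_bound_ge[of "k + 3"]
  by simp

private lemma n4: "4 * size_bound (k + 3) + 6 < n"
  using n size_bound_ge[of "k + 3"] by simp

private lemma ev_pos: "i \<le> k + 3 \<Longrightarrow> 1 \<le> ev n i"
  using eval_le[of 1 "e i"] small_1_bound small_endpoints U_ge_1[OF e_in_U] by (simp add: ev_def)

private lemma sv_pos: "i \<le> k + 3 \<Longrightarrow> 1 \<le> sv n i"
  using eval_le[of 1 "s i"] small_1_bound small_endpoints U_ge_1[OF s_in_U] by (simp add: sv_def)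

lemma wp_find_start:
  assumes table: "\<And>u. u < 2 * Suc i \<Longrightarrow> holds n R (40 + 3 * u) (endpoint u)"
    and i: "1 \<le> i" "Suc i \<le> k + 3"
    and R: "R 1 = 1" "R 3 = 0" "R 6 = int (Suc i)" "R 10 = ev n i + 1"
  shows "wp m (find_sum True) (\<lambda>(R', ys'). ys' = ys \<and> holds n R' 12 (s (Suc i))) (R, ys)"
proof -
  obtain u v t where uvt: "u < 2 * Suc i" "v < 2 * Suc i" "\<bar>t\<bar> \<le> 3"
    "s (Suc i) = endpoint u + endpoint v + of_int t"
    using start_candidate[OF i(1)] .
  have small: "small (size_bound (k + 3)) (endpoint u)" if "u < 2 * Suc i" for u
    using small_endpoints[of "u div 2"] i that by (cases u rule: endpoint_cases) auto
  show ?thesis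
  proof (rule wp_find_sum_holds[OF table _ _ _ R small n4 _ _ _ uvt])
    fix u assume u: "u < 2 * Suc i"
    have "endpoint u \<le> e i"
      using u s_le_e[of "u div 2"] e_mono[of "u div 2" i]
      by (cases u rule: endpoint_cases) auto
    then have "poly (endpoint u) n \<le> ev n i"
      unfolding ev_def using small[OF u] small_endpoints[of i] i by (intro eval_le) auto
    then show "poly (endpoint u) n \<le> ev n i + 1" by simp
  next
    have eq: "1 \<le> c \<and> (True \<longrightarrow> c \<le> 1) \<longleftrightarrow> c = 1" for c :: nat by auto
    show "least_above UNIV (\<lambda>q. 1 \<le> rep_count (\<lambda>i. poly (endpoint (2 * i)) n)
        (\<lambda>i. poly (endpoint (2 * i + 1)) n) (Suc i - 1) q \<and>
        (True \<longrightarrow> rep_count (\<lambda>i. poly (endpoint (2 * i)) n)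
        (\<lambda>i. poly (endpoint (2 * i + 1)) n) (Suc i - 1) q \<le> 1)) (ev n i + 1) (poly (s (Suc i)) n)"
      unfolding eq endpoint_simps using start_values[OF _ n i] unfolding sv_fun ev_fun by simp
  qed (use i m ev_pos[of i] in auto)
qed

lemma wp_find_finish:
  assumes table: "\<And>u. u < 2 * Suc i \<Longrightarrow> holds n R (40 + 3 * u) (endpoint' i u)"
    and i: "2 \<le> i" "i \<le> k + 3"
    and R: "R 1 = 1" "R 3 = 0" "R 6 = int (Suc i)" "R 10 = sv n i"
  shows "wp m (find_sum False) (\<lambda>(R', ys'). ys' = ys \<and> holds n R' 12 (e i + 1)) (R, ys)"
proof -
  obtain u v t where uvt: "u < 2 * Suc i" "v < 2 * Suc i" "\<bar>t\<bar> \<le> 3"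
    "e i + 1 = endpoint' i u + endpoint' i v + of_int t"
    using finish_candidate[OF i(1)] .
  have small: "small (size_bound (k + 3)) (endpoint' i u)" if "u < 2 * Suc i" for u
    using small_endpoints[of "u div 2"] small_endpoints[of i] i that
    by (cases u rule: endpoint_cases) (auto simp: endpoint'_def)
  show ?thesis
  proof (rule wp_find_sum_holds[OF table _ _ _ R small n4 _ _ _ uvt])
    fix u assume u: "u < 2 * Suc i"
    have "endpoint' i u \<le> s i"
    proof (cases u rule: endpoint_cases)
      case (1 j)
      then show ?thesis using u s_mono[of j i] by (simp add: endpoint'_def)
    next
      case (2 j)
      then show ?thesis using u e_less_s'[of j i] by (cases "j = i") (auto simp: endpoint'_def)
    qed
    then show "poly (endpoint' i u) n \<le> sv n i"
      unfolding sv_def using small[OF u] small_endpoints[of i] i by (intro eval_le) auto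
  next
    have eq: "(\<lambda>j. poly ((e(i := s i)) j) n) = (ev n)(i := sv n i)" by (auto simp: sv_def ev_def)
    show "least_above UNIV (\<lambda>q. 1 \<le> rep_count (\<lambda>j. poly (endpoint' i (2 * j)) n)
        (\<lambda>j. poly (endpoint' i (2 * j + 1)) n) (Suc i - 1) q \<and>
        (False \<longrightarrow> rep_count (\<lambda>j. poly (endpoint' i (2 * j)) n)
        (\<lambda>j. poly (endpoint' i (2 * j + 1)) n) (Suc i - 1) q \<le> 1)) (sv n i) (poly (e i + 1) n)"
      unfolding endpoint'_simps eq using finish_values[OF _ n i] unfolding sv_fun ev_fun by simp
  qed (use i m sv_pos[of i] in auto)
qed

end

end

section \<open>Correctness of the main loop and of the whole program\<close>

context poly_ulam
begin

context
  fixes k :: nat and n :: int and m :: nat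
  assumes n: "8 * size_bound (k + 3) + 20 < n" and m: "2 * k + 20 \<le> m"
begin

definition stored :: "nat \<Rightarrow> (nat \<Rightarrow> int) \<Rightarrow> bool" where
  "stored i R \<longleftrightarrow> R 0 = int k \<and> R 1 = 1 \<and> R 3 = 0 \<and> R 4 = n \<and> R 6 = int (Suc i) \<and>
     R 7 = int (40 + 6 * Suc i) \<and> (\<forall>u < 2 * Suc i. holds n R (40 + 3 * u) (endpoint u))"

lemma wp_next_interval:
  assumes R: "stored i R" and i: "1 \<le> i" "Suc i \<le> k + 3"
  shows "wp m next_interval (\<lambda>(R', ys'). ys' = ys \<and> stored (Suc i) R' \<and> R' 5 = R 5) (R, ys)"
proof -
  have ne: "(7::nat) \<noteq> 2" by simp
  define x where "x = 40 + 6 * Suc i"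
  have R': "R 0 = int k" "R 1 = 1" "R 3 = 0" "R 4 = n" "R 6 = int (Suc i)" "R 7 = int x"
    and table: "\<And>u. u < 2 * Suc i \<Longrightarrow> holds n R (40 + 3 * u) (endpoint u)"
    using R by (auto simp: stored_def x_def)
  have last: "R (x - 3) = ev n i"
    using table[of "2 * i + 1"] by (simp add: holds_def x_def ev_def)
  have x: "x \<ge> 43" "x - 3 \<ge> 40" "nat (int x - 3) = x - 3" "0 \<le> int x - 3" by (auto simp: x_def)
  show ?thesis
    unfolding next_interval_def wp_simps(2,4,7) wp_macros(3)[OF ne]
  proof (intro conjI, goal_cases)
    case 1
    show ?case using R' x by simp
  next
    case 2
    define R0 where "R0 = R(2 := - 3, 8 := R 7 + - 3,
      10 := (R(2 := - 3, 8 := R 7 + - 3)) (nat ((R(2 := - 3, 8 := R 7 + - 3)) 8)),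
      10 := (R(2 := - 3, 8 := R 7 + - 3,
        10 := (R(2 := - 3, 8 := R 7 + - 3)) (nat ((R(2 := - 3, 8 := R 7 + - 3)) 8)))) 10 +
        (R(2 := - 3, 8 := R 7 + - 3,
        10 := (R(2 := - 3, 8 := R 7 + - 3)) (nat ((R(2 := - 3, 8 := R 7 + - 3)) 8)))) 1)"
    have R0: "R0 10 = ev n i + 1" "\<And>y. y \<notin> {2, 8, 10} \<Longrightarrow> R0 y = R y"
      using R' x last by (auto simp: R0_def)
    have table0: "holds n R0 (40 + 3 * u) (endpoint u)" if "u < 2 * Suc i" for u
      using table[OF that] R0(2) by (simp add: holds_def)
    show ?case
      unfolding R0_def[symmetric]
    proof (rule wp_keeps[OF wp_find_start[OF n m table0 i]], goal_cases)
      case (6 R1 ys1)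
      have h1: "holds n R1 12 (s (Suc i))" and ys1: "ys1 = ys" using 6(1) by auto
      have R1: "R1 y = R y" if "y \<in> {0, 1, 3, 4, 5, 6, 7} \<or> 40 \<le> y" for y
        using 6(2)[of y] R0(2)[of y] that by fastforce
      show ?case
        unfolding wp_simps(7) wp_macros(1)
      proof (rule wp_mono[OF wp_store_best[of _ x]], goal_cases)
        case (3 st2)
        obtain R2 ys2 where st2: "st2 = (R2, ys2)" by (cases st2)
        have R2: "R2 y = R1 y" if "y \<notin> {2, 8, x, x + 1, x + 2}" for y
          using 3 that by (auto simp: st2)
        have s2': "ys2 = ys" "R2 8 = int (x + 3)" "holds n R2 x (s (Suc i))"
          using 3 h1 x ys1 by (auto simp: st2 holds_def)
        have h2: "holds n R2 12 (s (Suc i))" using h1 R2[of 12] R2[of 13] R2[of 14] x by (simp add: holds_def)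
        show ?case
          unfolding st2 s2'(1)
        proof (rule wp_mono[OF wp_store_best[of _ "x + 3"]], goal_cases)
          case (3 st3)
          obtain R3 ys3 where st3: "st3 = (R3, ys3)" by (cases st3)
          have R3: "R3 y = R2 y" if "y \<notin> {2, 8, x + 3, x + 4, x + 5}" for y
            using 3 that by (auto simp: st3 eval_nat_numeral)
          have s3: "ys3 = ys" "holds n R3 (x + 3) (s (Suc i))"
            using 3 h2 by (auto simp: st3 holds_def add.assoc)
          have s3': "holds n R3 x (s (Suc i))"
            using s2'(3) R3[of x] R3[of "x + 1"] R3[of "x + 2"] x by (simp add: holds_def)
          have h3: "R3 12 = sv n (Suc i)"
            using h2 R3[of 12] x by (simp add: holds_def sv_def)
          have R3': "R3 y = R y" if "y \<in> {0, 1, 3, 4, 5, 6, 7} \<or> 40 \<le> y \<and> y < x" for y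
            using that x R3[of y] R2[of y] R1[of y] by auto
          define R4 where "R4 = (R3(6 := R3 6 + R3 1, 2 := 6, 7 := R3 7 + 6, 10 := R3 12 + R3 3))"
          have R4: "R4 1 = 1" "R4 3 = 0" "R4 6 = int (Suc (Suc i))" "R4 10 = sv n (Suc i)"
            "R4 0 = int k" "R4 4 = n" "R4 5 = R 5" "R4 7 = int (x + 6)"
            using R3' R' h3 by (simp_all add: R4_def)
          have R4_mem: "R4 y = R3 y" if "40 \<le> y" for y using that by (simp add: R4_def)
          \<comment> \<open>Below address \<open>x\<close> the table is unchanged; both new slots,
            at \<open>x\<close> and \<open>x + 3\<close>, hold \<open>s (Suc i)\<close>.\<close>
          have table4: "holds n R4 (40 + 3 * u) (endpoint' (Suc i) u)" if u: "u < 2 * Suc (Suc i)" for u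
          proof -
            have "u < 2 * Suc i \<or> u = 2 * Suc i \<or> u = 2 * Suc i + 1" using u by auto
            then consider "u < 2 * Suc i" | "u = 2 * Suc i" | "u = 2 * Suc i + 1" by blast
            then show ?thesis
            proof cases
              case 1
              then have "40 + 3 * u + 2 < x" by (simp add: x_def)
              then show ?thesis
                using table[OF 1] R4_mem R3' 1 by (simp add: holds_def endpoint'_def)
            next
              case 2
              then have "40 + 3 * u = x" by (simp add: x_def)
              moreover have "endpoint' (Suc i) u = s (Suc i)"
                unfolding 2 endpoint'_simps ..
              ultimately show ?thesis using s3' R4_mem x by (simp add: holds_def)
            next
              case 3
              then have "40 + 3 * u = x + 3" by (simp add: x_def)
              moreover have "endpoint' (Suc i) u = s (Suc i)"
                unfolding 3 endpoint'_simps by simp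
              moreover have "holds n R4 (x + 3) (s (Suc i))"
                using s3(2) R4_mem x by (simp add: holds_def)
              ultimately show ?thesis by (simp only:)
            qed
          qed
          have fin: "wp m (find_sum False) (\<lambda>(R', ys'). ys' = ys \<and> holds n R' 12 (e (Suc i) + 1)) (R4, ys)"
            by (rule wp_find_finish[OF n m table4]) (use R4 i in simp_all)
          have "wp m (find_sum False) (wp m (Ins (Sub 12 12 1)) (wp m (Ins (Sub 14 14 1))
              (wp m (Offset 8 7 (- 3)) (wp m store_best
              (\<lambda>(R', ys'). ys' = ys \<and> stored (Suc i) R' \<and> R' 5 = R 5))))) (R4, ys)"
          proof (rule wp_keeps[OF fin], goal_cases)
            case (1 R5 ys5)
            have R5: "R5 y = R4 y" if "y \<in> {0, 1, 3, 4, 5, 6, 7} \<or> 40 \<le> y" for y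
              using 1(2)[of y] that by fastforce
            define R6 where "R6 = R5(12 := R5 12 - R5 1, 14 := R5 14 - R5 1, 2 := - 3, 8 := R5 7 - 3)"
            have h6: "holds n R6 12 (e (Suc i))"
              using 1(1) R5[of 1] R4(1) by (simp add: R6_def holds_def)
            have R6: "R6 y = R4 y" if "y \<in> {0, 1, 3, 4, 5, 6, 7} \<or> 40 \<le> y" for y
              using R5[OF that] that by (auto simp: R6_def)
            have R6_8: "R6 8 = int (x + 3)" using R5[of 7] R4(8) by (simp add: R6_def)
            have "wp m store_best (\<lambda>(R', ys'). ys' = ys \<and> stored (Suc i) R' \<and> R' 5 = R 5) (R6, ys)"
            proof (rule wp_mono[OF wp_store_best[of R6 "x + 3"]], goal_cases)
              case (3 st7)
              obtain R7 ys7 where st7: "st7 = (R7, ys7)" by (cases st7)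
              have R7: "R7 y = R6 y" if "y \<notin> {2, 8, x + 3, x + 4, x + 5}" for y
                using 3 that by (auto simp: st7 eval_nat_numeral)
              have R7': "R7 y = R4 y" if "y \<in> {0, 1, 3, 4, 5, 6, 7} \<or> 40 \<le> y \<and> y < x + 3" for y
                using R7[of y] R6[of y] that x by auto
              have h7: "ys7 = ys" "holds n R7 (x + 3) (e (Suc i))"
                using 3 h6 by (auto simp: st7 holds_def add.assoc)
              have "holds n R7 (40 + 3 * u) (endpoint u)" if u: "u < 2 * Suc (Suc i)" for u
              proof (cases "u = 2 * Suc i + 1")
                case True
                then have "40 + 3 * u = x + 3" by (simp add: x_def)
                moreover have "endpoint u = e (Suc i)" unfolding True endpoint_simps ..
                ultimately show ?thesis using h7(2) by (simp only:)
              next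
                case False
                then have "40 + 3 * u + 2 < x + 3" using u by (simp add: x_def)
                then show ?thesis
                  using table4[OF u] R7' False by (simp add: holds_def endpoint'_def)
              qed
              then show ?case
                using R7' R4 h7(1) by (simp add: st7 stored_def x_def)
            qed (use x R6_8 in simp_all)
            then show ?case using 1(1) by (auto simp: R6_def)
          qed
          then show ?case by (simp add: st3 s3(1) R4_def)
        qed (use s2'(2) x in simp_all)
      qed (use R1 R' x in simp_all)
    qed (use R' R0 in simp_all)
  qed
qed

lemma wp_ulam_init:
  assumes "n = 4 ^ (k + 8)"
  shows "wp m ulam_init (\<lambda>(R', ys'). ys' = [] \<and> stored 1 R' \<and> R' 5 = int (k + 1))
    ((\<lambda>_. 0)(0 := int k), [])"
  unfolding ulam_init_def wp_simps(1,2,7)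
proof (rule wp_Loop_keeps[where n = "k + 1" and I = "\<lambda>i R. R 4 = 16384 * 4 ^ i"], goal_cases)
  case (11 R)
  have R: "R 0 = int k" "R 1 = 1" "R 3 = 0" using 11(2)[of 0] 11(2)[of 1] 11(2)[of 3] by simp_all
  have R4: "R 4 = n" using 11(1) assms by (simp add: power_add)
  have ep: "endpoint 0 = 1" "endpoint 1 = 1" "endpoint 2 = X" "endpoint 3 = [:0, 2:]"
    using s_0 e_0 s_1 e_1 by (simp_all add: endpoint_def numeral_poly)
  have all: "(\<forall>u < 2 * Suc 1. Q u) \<longleftrightarrow> Q 0 \<and> Q 1 \<and> Q 2 \<and> Q 3" for Q :: "nat \<Rightarrow> bool"
    by (auto simp: less_Suc_eq numeral_eq_Suc)
  show ?case
    unfolding stored_def all ep using R R4 by (simp add: holds_def)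
qed (use m in auto)

lemma wp_ulam_program:
  assumes "n = 4 ^ (k + 8)"
  shows "wp m ulam_program (\<lambda>(R', ys'). ys' =
      map a [0..<Suc k] @ map b [0..<Suc k] @ map c [0..<Suc k] @ map d [0..<Suc k] @ [n])
    ((\<lambda>_. 0)(0 := int k), [])"
  unfolding ulam_program_def wp_simps(7)
proof (rule wp_mono[OF wp_ulam_init[OF assms]], goal_cases)
  case (1 st)
  then obtain R where R: "st = (R, [])" "stored 1 R" "R 5 = int (k + 1)" by (cases st) auto
  show ?case
    unfolding R(1)
  proof (rule wp_Loop[where n = "k + 1" and I = "\<lambda>i R' ys'. ys' = [] \<and> stored (Suc i) R'"], goal_cases)
    case (7 i R' ys' v)
    then show ?case by (auto simp: stored_def holds_def)
  next
    case (8 i R' ys')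
    then have i: "1 \<le> Suc i" "Suc (Suc i) \<le> k + 3" by simp_all
    show ?case
      using 8 by (intro wp_mono[OF wp_next_interval[OF _ i, of R']]) (auto simp: stored_def)
  next
    case (9 R' ys')
    have R': "R' 0 = int k" "R' 1 = 1" "R' 4 = n" and
      table: "\<And>u. u < 2 * (k + 3) \<Longrightarrow> holds n R' (40 + 3 * u) (endpoint u)"
      using 9 by (auto simp: stored_def)
    have col: "R' (41 + 6 * i) = a i" "R' (42 + 6 * i) = b i" "R' (44 + 6 * i) = c i" "R' (45 + 6 * i) = d i"
      if "i \<le> k" for i
      using table[of "2 * i"] table[of "2 * i + 1"] that
      by (simp_all add: holds_def s_def e_def lin_def)
    define same where "same R1 \<longleftrightarrow> (\<forall>y. y \<notin> {2, 20, 21, 38} \<longrightarrow> R1 y = R' y)" for R1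
    have print: "wp m (print_column z) Q (R1, ys1)"
      if z: "z = int x" "40 \<le> x" and R1: "same R1" and f: "\<And>i. i \<le> k \<Longrightarrow> R' (x + 6 * i) = f i"
        and Q: "\<And>R2. same R2 \<Longrightarrow> Q (R2, ys1 @ map f [0..<Suc k])" for z x f Q R1 ys1
      unfolding z(1)
    proof (rule wp_mono[OF wp_print_column[where k = k]], goal_cases)
      case (5 st)
      obtain R2 ys2 where st: "st = (R2, ys2)" by (cases st)
      have "map (\<lambda>i. R1 (x + 6 * i)) [0..<Suc k] = map f [0..<Suc k]"
        using R1 f z(2) by (intro map_cong) (auto simp: same_def)
      then have "ys2 = ys1 @ map f [0..<Suc k]" using 5 by (simp only: st prod.case)
      moreover have "same R2" using 5 R1 by (simp add: st same_def)
      ultimately show ?case using Q st by simp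
    qed (use R1 R' z m in \<open>auto simp: same_def\<close>)
    have ys': "ys' = []" using 9 by simp
    show ?case
      unfolding ys'
      by (rule print[where x = 41], simp, simp, simp add: same_def, erule col,
          rule print[where x = 42], simp, simp, assumption, erule col,
          rule print[where x = 44], simp, simp, assumption, erule col,
          rule print[where x = 45], simp, simp, assumption, erule col)
        (simp add: same_def R')
  qed (use R m in \<open>auto simp: stored_def\<close>)
qed

end

end

theorem theorem1p5:
  shows "\<exists>A :: ram_program. polynomial_time A \<and>
    (\<forall>(U :: int poly set) (a :: nat \<Rightarrow> int) (b :: nat \<Rightarrow> int) (c :: nat \<Rightarrow> int) (d :: nat \<Rightarrow> int).
      poly_ulam_sequence 1 [:0, 1:] U \<and> ulam_coefficients U a b c d \<longrightarrow>
      (\<forall>k :: nat. \<exists>N :: int. N \<ge> 2 \<and>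
         ram_output A k
           (map a [0..<Suc k] @ map b [0..<Suc k] @ map c [0..<Suc k] @ map d [0..<Suc k] @ [N]) \<and>
         (\<forall>n \<ge> N.
            ulam_set n \<inter> {1..c k * n + d k} =
            (\<Union>i. {a i * n + b i..c i * n + d i}) \<inter> {1..c k * n + d k})))"
proof (cases "\<exists>U a b c d. poly_ulam U a b c d")
  \<comment> \<open>The running time of the program is only bounded by relating its run to an existing \<open>U\<close>.\<close>
  case False
  \<comment> \<open>Without any such \<open>U\<close> correctness is vacuous, and the empty program,
    which halts at once, will do.\<close>
  have "ram_computes [] k 0 []" for k
    unfolding ram_computes_def using ram_run.refl by fastforce
  then have "polynomial_time []"
    unfolding polynomial_time_def by blast
  moreover have "\<not> (poly_ulam_sequence 1 X U \<and> ulam_coefficients U a b c d)" for U a b c d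
    using False unfolding poly_ulam_def by blast
  ultimately show ?thesis
    by (intro exI[of _ "[]"] conjI allI impI) (simp, metis)
next
  case True
  \<comment> \<open>Up to \<open>k + 3\<close> intervals are handled, so \<open>N k\<close> has to
    exceed \<open>2048 * 4 ^ k - 12\<close>; \<open>4 ^ (k + 8)\<close> does so amply.\<close>
  define N :: "nat \<Rightarrow> int" where "N k = 4 ^ (k + 8)" for k
  have N: "8 * size_bound (k + 3) + 20 < N k" for k
  proof -
    have "8 * size_bound (k + 3) + 20 = 2048 * 4 ^ k - 12" "N k = 65536 * 4 ^ k"
      by (simp_all add: N_def size_bound_def power_add)
    moreover have "(0::int) < 4 ^ k" by simp
    ultimately show ?thesis by linarith
  qed
  have time: "\<exists>p :: nat poly. \<forall>k. \<exists>t. ram_computes (code ulam_program 0) k t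
      (map a [0..<Suc k] @ map b [0..<Suc k] @ map c [0..<Suc k] @ map d [0..<Suc k] @ [N k]) \<and>
      t \<le> poly p k" if "poly_ulam U a b c d" for U a b c d
  \<comment> \<open>The longest loops run over the endpoints of at most \<open>k + 3\<close>
    intervals, \<open>2 * k + 6\<close> in number; \<open>2 * k + 20\<close> also covers the 7
    offsets for every \<open>k\<close>.\<close>
  proof (rule ram_computes_code[where q = "[:20, 2:]"])
    fix k
    interpret poly_ulam U a b c d by fact
    have "wp (poly [:20, 2:] k) ulam_program (\<lambda>(R', ys'). ys' =
        map a [0..<Suc k] @ map b [0..<Suc k] @ map c [0..<Suc k] @ map d [0..<Suc k] @ [N k])
      ((\<lambda>_. 0)(0 := int k), [])"
      by (rule wp_ulam_program[OF N]) (simp_all add: N_def)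
    then show "\<exists>R. run (poly [:20, 2:] k) ulam_program ((\<lambda>_. 0)(0 := int k), []) (R,
        map a [0..<Suc k] @ map b [0..<Suc k] @ map c [0..<Suc k] @ map d [0..<Suc k] @ [N k])"
      unfolding wp_def by auto
  qed
  have poly_time: "polynomial_time (code ulam_program 0)"
  proof -
    from True obtain U a b c d where "poly_ulam U a b c d" by blast
    from time[OF this] show ?thesis unfolding polynomial_time_def by (elim exE) (intro exI, blast)
  qed
  have correct: "N k \<ge> 2 \<and> ram_output (code ulam_program 0) k
        (map a [0..<Suc k] @ map b [0..<Suc k] @ map c [0..<Suc k] @ map d [0..<Suc k] @ [N k]) \<and>
      (\<forall>n \<ge> N k. ulam_set n \<inter> {1..c k * n + d k} =
        (\<Union>i. {a i * n + b i..c i * n + d i}) \<inter> {1..c k * n + d k})"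
    if "poly_ulam_sequence 1 [:0, 1:] U" "ulam_coefficients U a b c d" for U a b c d k
  proof (intro conjI allI impI)
    interpret poly_ulam U a b c d using that by unfold_locales
    show "ram_output (code ulam_program 0) k
        (map a [0..<Suc k] @ map b [0..<Suc k] @ map c [0..<Suc k] @ map d [0..<Suc k] @ [N k])"
      unfolding ram_output_def using time[OF poly_ulam_axioms] by blast
    have "12 \<le> size_bound (k + 3)" by (rule size_bound_ge) simp
    then show "N k \<ge> 2" using N[of k] by simp
    fix n assume "n \<ge> N k"
    moreover have "size_bound (max 1 k) \<le> size_bound (k + 3)" by (rule size_bound_mono) simp
    ultimately show "ulam_set n \<inter> {1..c k * n + d k} =
        (\<Union>i. {a i * n + b i..c i * n + d i}) \<inter> {1..c k * n + d k}"
      using N[of k] by (intro ulam_set_initial_segment) simp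
  qed
  show ?thesis
  proof (intro exI[of _ "code ulam_program 0"] conjI poly_time allI impI, goal_cases)
    case (1 U a b c d k)
    then show ?case using correct[of U a b c d k] by (intro exI[of _ "N k"]) simp
  qed
qed

end
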